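(* Let $n\ge 0$, let $C_0,\ldots,C_n\in\mathcal{P}(\mathbb{R}^d)$ be polyhedral cones, let $T_0,\ldots,T_n\in \mathrm{GL}_d$, and let $k>0$ (an integer, $k\le d$). Then for $Q_0,\ldots,Q_n\in O(d)$ independent and uniformly at random, $$\mathbb{E}\bigg[ v_{d-k}\bigg( \sum_{i=0}^n T_iQ_i C_i \bigg)\bigg] = v_{d-k}(C_0\times\cdots\times C_n),$$ where the sum on the left is the Minkowski sum.
   Context: A polyhedral cone in $\mathbb{R}^d$ is a set of the form $\{x\in\mathbb{R}^d : Ax\le 0\}$ for some real matrix $A$ with $d$ columns; $\mathcal{P}(\mathbb{R}^d)$ is the set of polyhedral cones in $\mathbb{R}^d$. A face of $C\in\mathcal{P}(\mathbb{R}^d)$ is a subset of the form $F=\{x\in C: \langle x,z\rangle=0\}$, where $z\in\mathbb{R}^d$ satisfies $\langle x,z\rangle\le 0$ for all $x\in C$ (in particular $C$ itself is a face). $\mathcal{L}_k(C)$ is the (finite) set of linear spans of faces of $C$ whose span has dimension $k$. The polar cone is $C^\circ=\{z: \langle x,z\rangle\le 0 \text{ for all } x\in C\}$. For a linear subspace $L$, $\gamma_L$ denotes the standard Gaussian measure on $L$ (the Dirac measure at the origin if $\dim L=0$). For $C\in\mathcal{P}(\mathbb{R}^d)$ and $0\le k\le d$, the $k$th conic intrinsic volume is $$v_k(C)=\sum_{L\in\mathcal{L}_k(C)}\gamma_L(C\cap L)\,\gamma_{L^\perp}(C^\circ\cap L^\perp).$$ The product $C_0\times\cdots\times C_n$ is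 a polyhedral cone in $\mathbb{R}^{(n+1)d}$. "Uniformly at random" in the orthogonal group $O(d)$ means distributed according to the normalized Haar measure. *)

theory Defs
  imports "HOL-Probability.Probability"
begin

definition polyhedral_cone :: "'a::euclidean_space set \<Rightarrow> bool" where
  "polyhedral_cone C \<longleftrightarrow> (\<exists>A. finite A \<and> C = {x. \<forall>a\<in>A. a \<bullet> x \<le> 0})"

definition polar_cone :: "'a::euclidean_space set \<Rightarrow> 'a set" where
  "polar_cone C = {z. \<forall>x\<in>C. x \<bullet> z \<le> 0}"

text \<open>
  Unlike the library's \<^const>\<open>face_of\<close>, this does not count the empty set as a face.
\<close>

definition cone_face :: "'a::euclidean_space set \<Rightarrow> 'a set \<Rightarrow> bool" where
  "cone_face F C \<longleftrightarrow> (\<exists>z. (\<forall>x\<in>C. x \<bullet> z \<le> 0) \<and> F = {x\<in>C. x \<bullet> z = 0})"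

definition face_spans :: "nat \<Rightarrow> 'a::euclidean_space set \<Rightarrow> 'a set set" where
  "face_spans k C = {span F | F. cone_face F C \<and> dim (span F) = k}"

definition orthonormal_basis_of :: "'a::euclidean_space set \<Rightarrow> 'a set \<Rightarrow> bool" where
  "orthonormal_basis_of B L \<longleftrightarrow>
     pairwise orthogonal B \<and> (\<forall>b\<in>B. norm b = 1) \<and> span B = L"

text \<open>
  The law of a sum of \<open>g b *\<^sub>R b\<close> over an orthonormal basis of \<open>L\<close>, where the \<open>g b\<close> are
  independent standard normal variables. By rotation invariance it does not depend on the
  basis. It is a Borel measure on the ambient space, concentrated on \<open>L\<close>.
\<close>

definition std_gaussian :: "'a::euclidean_space set \<Rightarrow> 'a measure" where
  "std_gaussian L =
     (let B = (SOME B. orthonormal_basis_of B L)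
      in distr (Pi\<^sub>M B (\<lambda>_. density lborel (\<lambda>x. ennreal (std_normal_density x)))) borel
           (\<lambda>g. \<Sum>b\<in>B. g b *\<^sub>R b))"

definition conic_intrinsic_volume :: "nat \<Rightarrow> 'a::euclidean_space set \<Rightarrow> real" where
  "conic_intrinsic_volume k C =
     (\<Sum>L\<in>face_spans k C.
        measure (std_gaussian L) (C \<inter> L) *
        measure (std_gaussian (L\<^sup>\<bottom>)) (polar_cone C \<inter> L\<^sup>\<bottom>))"

definition orthogonal_group :: "(real^'d^'d) measure" where
  "orthogonal_group = restrict_space borel {A. orthogonal_matrix A}"

text \<open>
  The Haar measure is characterised here by its defining property, left invariance;
  on the compact group of orthogonal matrices exactly one probability measure has it.
\<close>

definition normalized_haar :: "(real^'d^'d) measure \<Rightarrow> bool" where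
  "normalized_haar \<mu> \<longleftrightarrow>
     prob_space \<mu> \<and> sets \<mu> = sets (orthogonal_group :: (real^'d^'d) measure) \<and>
     (\<forall>U. orthogonal_matrix U \<longrightarrow> distr \<mu> \<mu> (\<lambda>A. U ** A) = \<mu>)"

text \<open>
  The Cartesian product of a family of cones, as a cone in the Euclidean space of tuples.
\<close>

definition cone_product :: "('n::finite \<Rightarrow> (real^'d) set) \<Rightarrow> (real^'d^'n) set" where
  "cone_product C = {x. \<forall>i. x $ i \<in> C i}"

text \<open>
  The sum in \<^const>\<open>conic_intrinsic_volume\<close> is finite, and the basis chosen in
  \<^const>\<open>std_gaussian\<close> exists.
\<close>

lemma finite_face_spans:
  assumes "polyhedral_cone C"
  shows "finite (face_spans k C)"
proof -
  obtain A where A: "finite A" "C = {x. \<forall>a\<in>A. a \<bullet> x \<le> 0}"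
    using assms unfolding polyhedral_cone_def by blast
  have "C = \<Inter>((\<lambda>a. {x. a \<bullet> x \<le> 0}) ` A)"
    using A by auto
  then have "polyhedron C"
    using A(1) by (auto intro!: polyhedron_Inter polyhedron_halfspace_le)
  moreover have "F face_of C" if F: "cone_face F C" for F
  proof -
    obtain z where z: "\<forall>x\<in>C. x \<bullet> z \<le> 0" "F = {x\<in>C. x \<bullet> z = 0}"
      using F unfolding cone_face_def by blast
    have "F = C \<inter> {x. z \<bullet> x = 0}"
      using z(2) by (auto simp: inner_commute)
    then show ?thesis
      using face_of_Int_supporting_hyperplane_le[of C z 0] z(1)
        polyhedron_imp_convex[OF \<open>polyhedron C\<close>] by (auto simp: inner_commute)
  qed
  ultimately show ?thesis
    by (intro finite_subset[OF _ finite_imageI[OF finite_polyhedron_faces, of C span]])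
       (auto simp: face_spans_def)
qed

lemma ex_orthonormal_basis_of:
  assumes "subspace L"
  shows "\<exists>B. orthonormal_basis_of B L"
  using orthonormal_basis_subspace[OF assms] unfolding orthonormal_basis_of_def by metis

lemma std_gaussian_zero: "std_gaussian {0 :: 'a::euclidean_space} = return borel 0"
proof -
  define B where "B = (SOME B. orthonormal_basis_of B {0::'a})"
  have "orthonormal_basis_of B {0}"
    unfolding B_def by (rule someI_ex, rule ex_orthonormal_basis_of) (rule subspace_single_0)
  then have "span B = {0}" "\<forall>b\<in>B. norm b = 1"
    by (simp_all add: orthonormal_basis_of_def)
  then have "b = 0 \<and> norm b = 1" if "b \<in> B" for b
    using span_base[OF that] that by blast
  then have "B = {}"
    by fastforce
  then have *: "std_gaussian {0::'a} = distr (count_space {\<lambda>_::'a. undefined :: real}) borel (\<lambda>_. 0)"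
    unfolding std_gaussian_def Let_def B_def[symmetric] by (simp add: PiM_empty)
  have "prob_space (count_space {\<lambda>_::'a. undefined :: real})"
    by (intro prob_spaceI) (simp add: emeasure_count_space)
  then show ?thesis
    unfolding * by (rule prob_space.distr_const) simp
qed

end

theory Submission
  imports Defs
begin

text \<open>
The Minkowski sum is the image of the product cone \<open>P\<close> under the linear map
\<open>A\<^sub>q x = (\<Sum>i. T\<^sub>i q\<^sub>i x\<^sub>i)\<close>, where \<open>q\<close> is the tuple of rotations. So the theorem compares
the intrinsic volumes of \<open>P\<close> with those of a random linear image of it.

For a face \<open>H\<close> of \<open>P\<close>, call \<open>y\<close> a point of the region of \<open>H\<close> if \<open>y = A x + z\<close> with \<open>x \<in> H\<close> and
\<open>z\<close> an outer normal of \<open>A P\<close> along \<open>A H\<close>. Since the components of a Gaussian vector in two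
orthogonal subspaces are independent, each summand of an intrinsic volume is the Gaussian
measure of one region (\<open>conic_intrinsic_volume_linear_image\<close>); the case \<open>A = id\<close> describes
\<open>P\<close> itself. For almost every \<open>q\<close> the map \<open>A\<^sub>q\<close> has the largest possible rank on the span of every
face of \<open>P\<close> (\<open>generic_dim\<close>). Then, for \<open>j < d\<close>, every \<open>j\<close>-dimensional face of the image comes
from exactly one \<open>j\<close>-dimensional face of \<open>P\<close>, and a face of \<open>P\<close> whose image is not a face has a
region of measure zero. Hence the sum for the image also runs over the \<open>j\<close>-dimensional faces of
\<open>P\<close> (\<open>conic_intrinsic_volume_generic_image\<close>), and it suffices to show that the expected measure
of the region of one face is the same as for \<open>A = id\<close>.

Let \<open>H\<close> be a face of \<open>P\<close> with span \<open>\<Prod>i. L\<^sub>i\<close> and dimension less than \<open>d\<close>, and decompose a Gaussian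
vector as \<open>y = A\<^sub>q x + z\<close> with \<open>x \<in> span H\<close> and \<open>z\<close> orthogonal to \<open>A\<^sub>q (span H)\<close>. Then \<open>y\<close> is in the region
if and only if \<open>x\<^sub>i \<in> C\<^sub>i\<close> and \<open>q\<^sub>i\<^sup>T T\<^sub>i\<^sup>T z\<close> is in the polar cone of \<open>C\<^sub>i\<close> for all \<open>i\<close>. These are
membership conditions on the vectors \<open>x\<^sub>i \<in> L\<^sub>i\<close> and \<open>q\<^sub>i\<^sup>T T\<^sub>i\<^sup>T z \<in> L\<^sub>i\<^sup>\<bottom>\<close>. Multiplying \<open>q\<^sub>i\<close> from the
right by the reflection along a vector \<open>v\<close> of \<open>L\<^sub>i\<close> (or of \<open>L\<^sub>i\<^sup>\<bottom>\<close>) preserves the law of \<open>(q, y)\<close>; it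
reflects \<open>x\<^sub>i\<close> (or \<open>q\<^sub>i\<^sup>T T\<^sub>i\<^sup>T z\<close>) and fixes all the other vectors. So, given the other vectors, the
direction of each one is uniformly distributed in its subspace, and the probability of the region
is the product over \<open>i\<close> of the Gaussian measures of \<open>C\<^sub>i\<close> in \<open>L\<^sub>i\<close> and of the polar cone in \<open>L\<^sub>i\<^sup>\<bottom>\<close>
(\<open>prob_cones_of_rotation_invariant\<close>, \<open>expected_region\<close>). The components in \<open>L\<^sub>i\<close> and \<open>L\<^sub>i\<^sup>\<bottom>\<close> of a Gaussian vector
of the product space have the same symmetries, which gives the same product for \<open>A = id\<close>
(\<open>measure_region_product\<close>). The hypothesis \<open>k > 0\<close> enters twice: the dimension of \<open>H\<close> must be
less than \<open>d\<close> for \<open>z\<close> to be nonzero and so to have a direction, and faces of the image of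
full dimension \<open>d\<close> may come from larger faces of \<open>P\<close>.
\<close>

section \<open>Reflections\<close>

definition reflect :: "'a::real_inner \<Rightarrow> 'a \<Rightarrow> 'a" where
  "reflect v x = x - (2 * (x \<bullet> v) / (v \<bullet> v)) *\<^sub>R v"

lemma linear_reflect: "linear (reflect v)"
  by (rule linearI) (auto simp: reflect_def algebra_simps inner_add_left inner_diff_left add_divide_distrib)

lemma reflect_reflect [simp]: "reflect v (reflect v x) = x"
  by (cases "v = 0") (auto simp: reflect_def algebra_simps inner_diff_left)

lemma inner_reflect_commute: "reflect v x \<bullet> y = x \<bullet> reflect v y"
  by (simp add: reflect_def inner_diff_left inner_diff_right inner_commute)

lemma inner_reflect_reflect [simp]: "reflect v x \<bullet> reflect v y = x \<bullet> y"
  by (simp add: inner_reflect_commute)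

lemma norm_reflect [simp]: "norm (reflect v x) = norm x"
  by (simp add: norm_eq_sqrt_inner)

lemma reflect_perp: "x \<bullet> v = 0 \<Longrightarrow> reflect v x = x"
  by (simp add: reflect_def)

lemma reflect_in_subspace: "subspace L \<Longrightarrow> v \<in> L \<Longrightarrow> x \<in> L \<Longrightarrow> reflect v x \<in> L"
  by (simp add: reflect_def subspace_diff subspace_scale)

lemma continuous_on_reflect [continuous_intros]:
  "continuous_on S f \<Longrightarrow> continuous_on S (\<lambda>x. reflect (v::'a::euclidean_space) (f x))"
  unfolding reflect_def divide_inverse by (intro continuous_intros)

lemma reflect_measurable [measurable]: "reflect (v::'a::euclidean_space) \<in> borel_measurable borel"
  by (intro borel_measurable_continuous_onI continuous_intros)

text \<open>
Any two vectors of equal length are exchanged by a reflection along their difference. So the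
reflections along vectors of a subspace act transitively on its spheres, and invariance under
them can replace invariance under the whole orthogonal group.
\<close>

lemma reflect_swaps:
  assumes "norm x = norm y"
  shows "reflect (x - y) x = y"
proof (cases "x = y")
  case True then show ?thesis by (simp add: reflect_def)
next
  case False
  have "x \<bullet> x = y \<bullet> y"
    using assms by (simp flip: power2_norm_eq_inner)
  then have *: "(x - y) \<bullet> (x - y) = 2 * (x \<bullet> (x - y))"
    by (simp add: inner_diff_left inner_diff_right inner_commute[of y x])
  have "(x - y) \<bullet> (x - y) \<noteq> 0" using False by simp
  then show ?thesis unfolding reflect_def using * by simp
qed

section \<open>Gaussian measures on subspaces\<close>

text \<open>
This is the uniqueness of Lebesgue measure on a subspace, up to a constant. Stated for measures on
the ambient space that are concentrated on \<open>L\<close>, it avoids choosing coordinates on \<open>L\<close>. The proof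
evaluates the integral of \<open>1\<^sub>A(x + y) 1\<^sub>S(y)\<close> against \<open>m \<Otimes> m'\<close> in both orders.
\<close>

lemma translation_invariant_unique:
  fixes m m' :: "'a::euclidean_space measure"
  assumes "sigma_finite_measure m" "sigma_finite_measure m'"
    and sets [simp, measurable_cong]: "sets m = sets borel" "sets m' = sets borel"
    and L: "subspace L" "AE x in m. x \<in> L" "AE x in m'. x \<in> L"
    and inv: "\<And>t. t \<in> L \<Longrightarrow> distr m borel (\<lambda>x. x + t) = m"
             "\<And>t. t \<in> L \<Longrightarrow> distr m' borel (\<lambda>x. x + t) = m'"
    and A [measurable]: "A \<in> sets borel" and S [measurable]: "S \<in> sets borel" "\<And>x. x \<in> S \<Longrightarrow> - x \<in> S"
  shows "emeasure m A * emeasure m' S = emeasure m' A * emeasure m S"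
proof -
  interpret m: sigma_finite_measure m by fact
  interpret m': sigma_finite_measure m' by fact
  interpret pair_sigma_finite m m' ..
  have [simp]: "space m = UNIV" "space m' = UNIV"
    using sets_eq_imp_space_eq[OF sets(1)] sets_eq_imp_space_eq[OF sets(2)] by auto
  have shift: "(\<integral>\<^sup>+x. f (x + t) \<partial>m) = integral\<^sup>N m f" if [measurable]: "f \<in> borel_measurable borel" and "t \<in> L" for f t
    using nn_integral_distr[of "\<lambda>x. x + t" m borel f] inv(1)[OF \<open>t \<in> L\<close>] by simp
  have shift': "(\<integral>\<^sup>+x. f (x + t) \<partial>m') = integral\<^sup>N m' f" if [measurable]: "f \<in> borel_measurable borel" and "t \<in> L" for f t
    using nn_integral_distr[of "\<lambda>x. x + t" m' borel f] inv(2)[OF \<open>t \<in> L\<close>] by simp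
  have sym: "- x \<in> S \<longleftrightarrow> x \<in> S" for x using S(2)[of x] S(2)[of "- x"] by auto
  have "emeasure m A * emeasure m' S = (\<integral>\<^sup>+y. \<integral>\<^sup>+x. indicator A x * indicator S y \<partial>m \<partial>m')"
    by (simp add: nn_integral_multc nn_integral_cmult)
  also have "\<dots> = (\<integral>\<^sup>+y. \<integral>\<^sup>+x. indicator A (x + y) * indicator S y \<partial>m \<partial>m')"
    using L(3) by (intro nn_integral_cong_AE) (auto elim!: eventually_mono simp: shift[of "\<lambda>x. indicator A x * indicator S _"])
  also have "\<dots> = (\<integral>\<^sup>+x. \<integral>\<^sup>+y. indicator A (x + y) * indicator S y \<partial>m' \<partial>m)"
    by (rule Fubini') simp
  also have "\<dots> = (\<integral>\<^sup>+x. \<integral>\<^sup>+y. indicator A y * indicator S (y - x) \<partial>m' \<partial>m)"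
  proof (intro nn_integral_cong_AE, use L(2) in eventually_elim)
    case (elim x)
    show ?case
      using shift'[of "\<lambda>y. indicator A y * indicator S (y - x)" x] elim by (simp add: add.commute)
  qed
  also have "\<dots> = (\<integral>\<^sup>+y. \<integral>\<^sup>+x. indicator A y * indicator S (y - x) \<partial>m \<partial>m')"
    by (rule Fubini'[symmetric]) simp
  also have "\<dots> = (\<integral>\<^sup>+y. \<integral>\<^sup>+x. indicator A y * indicator S x \<partial>m \<partial>m')"
  proof (intro nn_integral_cong_AE, use L(3) in eventually_elim)
    case (elim y)
    have "indicator S (y - x) = (indicator S (x + - y) :: ennreal)" for x
      using sym[of "y - x"] by (auto simp: indicator_def)
    then show ?case
      using shift[of "\<lambda>x. indicator A y * indicator S x" "- y"] elim L(1) by (simp add: subspace_neg)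
  qed
  also have "\<dots> = emeasure m' A * emeasure m S"
    by (simp add: nn_integral_multc nn_integral_cmult)
  finally show ?thesis .
qed

text \<open>
Lebesgue measure on the span of an orthonormal set, as a measure on the ambient space.
\<close>

definition sub_lborel :: "'a::euclidean_space set \<Rightarrow> 'a measure" where
  "sub_lborel B = distr (Pi\<^sub>M B (\<lambda>_. lborel)) borel (\<lambda>g. \<Sum>b\<in>B. g b *\<^sub>R b)"

definition onb_gaussian :: "'a::euclidean_space set \<Rightarrow> 'a measure" where
  "onb_gaussian B = distr (Pi\<^sub>M B (\<lambda>_. density lborel (\<lambda>x. ennreal (std_normal_density x)))) borel
     (\<lambda>g. \<Sum>b\<in>B. g b *\<^sub>R b)"

context
  fixes B L :: "'a::euclidean_space set"
  assumes B: "orthonormal_basis_of B L"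
begin

lemma onb_finite: "finite B"
  using B pairwise_orthogonal_imp_finite[of B] unfolding orthonormal_basis_of_def by blast

lemma onb_subspace: "subspace L"
  using B unfolding orthonormal_basis_of_def by (metis subspace_span)

lemma onb_in: "b \<in> B \<Longrightarrow> b \<in> L"
  using B unfolding orthonormal_basis_of_def by (auto simp: span_base)

lemma onb_inner: "b \<in> B \<Longrightarrow> (\<Sum>c\<in>B. g c *\<^sub>R c) \<bullet> b = g b"
proof -
  assume b: "b \<in> B"
  have "(\<Sum>c\<in>B. g c *\<^sub>R c) \<bullet> b = (\<Sum>c\<in>B. if c = b then g b else 0)"
    unfolding inner_sum_left using B b
    by (intro sum.cong) (auto simp: orthonormal_basis_of_def pairwise_def orthogonal_def norm_eq_1)
  then show ?thesis using b onb_finite by simp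
qed

lemma onb_sum_in: "(\<Sum>c\<in>B. g c *\<^sub>R c) \<in> L"
  using onb_in onb_subspace by (intro subspace_sum) (auto simp: subspace_scale)

lemma onb_norm: "(norm (\<Sum>c\<in>B. g c *\<^sub>R c))\<^sup>2 = (\<Sum>c\<in>B. (g c)\<^sup>2)"
  unfolding power2_norm_eq_inner inner_sum_right inner_scaleR_right by (simp add: onb_inner power2_eq_square)

lemma onb_expand: "x \<in> L \<Longrightarrow> (\<Sum>b\<in>B. (x \<bullet> b) *\<^sub>R b) = x"
proof -
  assume "x \<in> L"
  then have "x \<in> span B" using B unfolding orthonormal_basis_of_def by auto
  then obtain g where x: "x = (\<Sum>b\<in>B. g b *\<^sub>R b)"
    using span_finite[OF onb_finite] by auto
  then have "x \<bullet> b = g b" if "b \<in> B" for b using onb_inner[OF that] by simp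
  then show ?thesis using x by simp
qed

interpretation L: product_sigma_finite "\<lambda>_::'a. lborel :: real measure" ..

lemma sets_sub_lborel [simp, measurable_cong]: "sets (sub_lborel B) = sets borel"
  and space_sub_lborel [simp]: "space (sub_lborel B) = UNIV"
  by (simp_all add: sub_lborel_def)

lemma AE_sub_lborel: "AE x in sub_lborel B. x \<in> L"
proof -
  have [measurable]: "L \<in> sets borel" using onb_subspace by (simp add: borel_closed closed_subspace)
  show ?thesis unfolding sub_lborel_def
    by (subst AE_distr_iff) (auto simp: onb_sum_in)
qed

lemma sub_lborel_translate:
  assumes "t \<in> L"
  shows "distr (sub_lborel B) borel (\<lambda>x. x + t) = sub_lborel B"
proof -
  let ?P = "Pi\<^sub>M B (\<lambda>_. lborel :: real measure)"
  let ?s = "\<lambda>g. \<lambda>b\<in>B. g b + t \<bullet> b"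
  have [measurable]: "?s \<in> measurable ?P ?P" by measurable
  have "distr ?P ?P ?s = ?P"
  proof (rule L.PiM_eqI)
    fix A :: "'a \<Rightarrow> real set" assume A: "\<And>i. i \<in> B \<Longrightarrow> A i \<in> sets lborel"
    have "emeasure (distr ?P ?P ?s) (Pi\<^sub>E B A) = emeasure ?P (?s -` Pi\<^sub>E B A \<inter> space ?P)"
      using A onb_finite by (intro emeasure_distr) (auto intro!: sets_PiM_I_finite)
    also have "?s -` Pi\<^sub>E B A \<inter> space ?P = Pi\<^sub>E B (\<lambda>b. (\<lambda>x. t \<bullet> b + x) -` A b)"
      by (auto simp: space_PiM PiE_iff extensional_def add.commute split: if_splits)
    also have "emeasure ?P \<dots> = (\<Prod>b\<in>B. emeasure lborel ((\<lambda>x. t \<bullet> b + x) -` A b))"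
    proof (intro L.emeasure_PiM onb_finite)
      fix b assume "b \<in> B"
      then have [measurable]: "A b \<in> sets borel" using A by simp
      show "(\<lambda>x. t \<bullet> b + x) -` A b \<in> sets lborel"
        using measurable_sets[of "\<lambda>x. t \<bullet> b + x" borel borel "A b"] by simp
    qed
    also have "\<dots> = (\<Prod>b\<in>B. emeasure lborel (A b))"
    proof (rule prod.cong)
      fix b assume "b \<in> B"
      then show "emeasure lborel ((\<lambda>x. t \<bullet> b + x) -` A b) = emeasure lborel (A b)"
        using A[of b] emeasure_distr[of "(+) (t \<bullet> b)" lborel borel "A b"] lborel_distr_plus[of "t \<bullet> b"]
        by simp
    qed simp
    finally show "emeasure (distr ?P ?P ?s) (Pi\<^sub>E B A) = (\<Prod>i\<in>B. emeasure lborel (A i))" .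
  qed (auto intro: onb_finite)
  then have "sub_lborel B = distr (distr ?P ?P ?s) borel (\<lambda>g. \<Sum>b\<in>B. g b *\<^sub>R b)"
    by (simp add: sub_lborel_def)
  also have "\<dots> = distr ?P borel (\<lambda>g. (\<Sum>b\<in>B. g b *\<^sub>R b) + t)"
  proof (subst distr_distr, measurable, rule distr_cong)
    fix g
    show "((\<lambda>g. \<Sum>b\<in>B. g b *\<^sub>R b) \<circ> ?s) g = (\<Sum>b\<in>B. g b *\<^sub>R b) + t"
      using onb_expand[OF assms] by (simp add: scaleR_add_left sum.distrib)
  qed auto
  also have "\<dots> = distr (sub_lborel B) borel (\<lambda>x. x + t)"
    unfolding sub_lborel_def by (subst distr_distr) (auto simp: o_def)
  finally show ?thesis by simp
qed

lemma emeasure_sub_lborel_cball_finite: "emeasure (sub_lborel B) (cball 0 r) < \<infinity>"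
proof -
  let ?P = "Pi\<^sub>M B (\<lambda>_. lborel :: real measure)"
  have "emeasure (sub_lborel B) (cball 0 r) = emeasure ?P ((\<lambda>g. \<Sum>b\<in>B. g b *\<^sub>R b) -` cball 0 r \<inter> space ?P)"
    unfolding sub_lborel_def by (rule emeasure_distr) auto
  also have "\<dots> \<le> emeasure ?P (Pi\<^sub>E B (\<lambda>_. {-r..r}))"
  proof (rule emeasure_mono)
    show "(\<lambda>g. \<Sum>b\<in>B. g b *\<^sub>R b) -` cball 0 r \<inter> space ?P \<subseteq> Pi\<^sub>E B (\<lambda>_. {-r..r})"
    proof (clarsimp simp: space_PiM PiE_iff)
      fix g b assume "norm (\<Sum>b\<in>B. g b *\<^sub>R b) \<le> r" "b \<in> B"
      then have "\<bar>g b\<bar> \<le> r"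
        using Cauchy_Schwarz_ineq2[of "\<Sum>b\<in>B. g b *\<^sub>R b" b] onb_inner[of b g] B
        by (auto simp: orthonormal_basis_of_def)
      then show "- r \<le> g b \<and> g b \<le> r" by auto
    qed
  qed (auto intro!: sets_PiM_I_finite onb_finite)
  also have "\<dots> = (\<Prod>b\<in>B. emeasure lborel {-r..r})"
    by (intro L.emeasure_PiM onb_finite) auto
  also have "\<dots> < \<infinity>" by (cases "0 \<le> r") (auto simp: power_less_top_ennreal)
  finally show ?thesis .
qed

lemma emeasure_sub_lborel_cball_pos: "emeasure (sub_lborel B) (cball 0 1) > 0"
proof -
  let ?P = "Pi\<^sub>M B (\<lambda>_. lborel :: real measure)"
  define e where "e = 1 / real (card B + 1)"
  have e: "e > 0" "real (card B) * e \<le> 1" by (auto simp: e_def field_simps)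
  have "0 < (\<Prod>b\<in>B. emeasure lborel {-e..e})"
    using e(1) onb_finite by (simp add: zero_less_iff_neq_zero)
  also have "\<dots> = emeasure ?P (Pi\<^sub>E B (\<lambda>_. {-e..e}))"
    by (intro L.emeasure_PiM[symmetric] onb_finite) auto
  also have "\<dots> \<le> emeasure ?P ((\<lambda>g. \<Sum>b\<in>B. g b *\<^sub>R b) -` cball 0 1 \<inter> space ?P)"
  proof (rule emeasure_mono)
    show "Pi\<^sub>E B (\<lambda>_. {-e..e}) \<subseteq> (\<lambda>g. \<Sum>b\<in>B. g b *\<^sub>R b) -` cball 0 1 \<inter> space ?P"
    proof
      fix g assume "g \<in> Pi\<^sub>E B (\<lambda>_. {-e..e})"
      then have g: "\<forall>b\<in>B. - e \<le> g b \<and> g b \<le> e" "g \<in> space ?P"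
        by (auto simp: space_PiM PiE_iff)
      have "norm (\<Sum>b\<in>B. g b *\<^sub>R b) \<le> (\<Sum>b\<in>B. e)"
        using g B by (intro sum_norm_le) (auto simp: orthonormal_basis_of_def abs_le_iff)
      then have "norm (\<Sum>b\<in>B. g b *\<^sub>R b) \<le> 1" using e(2) by simp
      then show "g \<in> (\<lambda>g. \<Sum>b\<in>B. g b *\<^sub>R b) -` cball 0 1 \<inter> space ?P" using g(2) by simp
    qed
  qed measurable
  also have "\<dots> = emeasure (sub_lborel B) (cball 0 1)"
    unfolding sub_lborel_def by (rule emeasure_distr[symmetric]) auto
  finally show ?thesis .
qed

lemma sigma_finite_sub_lborel: "sigma_finite_measure (sub_lborel B)"
proof (rule sigma_finite_measure.intro, intro exI conjI)
  show "countable (range (\<lambda>n. cball (0::'a) (real n)))" by simp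
  show "range (\<lambda>n. cball (0::'a) (real n)) \<subseteq> sets (sub_lborel B)" by auto
  show "\<Union> (range (\<lambda>n. cball (0::'a) (real n))) = space (sub_lborel B)"
    by (auto simp: real_arch_simple)
  show "\<forall>a\<in>range (\<lambda>n. cball (0::'a) (real n)). emeasure (sub_lborel B) a \<noteq> \<infinity>"
    using emeasure_sub_lborel_cball_finite by (auto simp: less_top)
qed

text \<open>
The reflected measure is again translation-invariant, hence a multiple of the original one;
the unit ball, which is fixed by the reflection, shows that the factor is 1.
\<close>

lemma sub_lborel_reflect:
  assumes "v \<in> L"
  shows "distr (sub_lborel B) borel (reflect v) = sub_lborel B"
proof (rule measure_eqI)
  fix A assume "A \<in> sets (distr (sub_lborel B) borel (reflect v))"
  then have A [measurable]: "A \<in> sets borel" by simp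
  let ?D = "distr (sub_lborel B) borel (reflect v)"
  have lin: "reflect v (x + y) = reflect v x + reflect v y" for x y using linear_add[OF linear_reflect] .
  have meas: "L \<in> sets borel" using onb_subspace by (simp add: borel_closed closed_subspace)
  have em: "emeasure ?D X = emeasure (sub_lborel B) (reflect v -` X)" if "X \<in> sets borel" for X
    using that by (simp add: emeasure_distr)
  have ball: "reflect v -` cball 0 r = cball 0 r" for r by (auto simp: vimage_def)
  have "emeasure ?D A * emeasure (sub_lborel B) (cball 0 1) = emeasure (sub_lborel B) A * emeasure ?D (cball 0 1)"
  proof (rule translation_invariant_unique[of ?D "sub_lborel B" L])
    show "sigma_finite_measure ?D"
    proof (rule sigma_finite_measure.intro, intro exI conjI)
      show "countable (range (\<lambda>n. cball (0::'a) (real n)))" by simp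
      show "range (\<lambda>n. cball (0::'a) (real n)) \<subseteq> sets ?D" by auto
      show "\<Union> (range (\<lambda>n. cball (0::'a) (real n))) = space ?D"
        by (auto simp: real_arch_simple)
      show "\<forall>a\<in>range (\<lambda>n. cball (0::'a) (real n)). emeasure ?D a \<noteq> \<infinity>"
        using emeasure_sub_lborel_cball_finite by (auto simp: less_top em ball)
    qed
    show "AE x in ?D. x \<in> L"
      using AE_sub_lborel meas reflect_in_subspace[OF onb_subspace assms]
      by (subst AE_distr_iff) (auto elim!: eventually_mono)
    fix t assume t: "t \<in> L"
    have "distr ?D borel (\<lambda>x. x + t) = distr (sub_lborel B) borel (\<lambda>x. reflect v x + t)"
      by (subst distr_distr) (auto simp: o_def)
    also have "\<dots> = distr (sub_lborel B) borel (\<lambda>x. reflect v (x + reflect v t))"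
      by (simp add: lin)
    also have "\<dots> = distr (distr (sub_lborel B) borel (\<lambda>x. x + reflect v t)) borel (reflect v)"
      by (subst distr_distr) (auto simp: o_def)
    also have "\<dots> = ?D"
      using sub_lborel_translate reflect_in_subspace[OF onb_subspace assms t] by simp
    finally show "distr ?D borel (\<lambda>x. x + t) = ?D" .
  qed (auto intro: sigma_finite_sub_lborel onb_subspace AE_sub_lborel sub_lborel_translate)
  then have "emeasure ?D A * emeasure (sub_lborel B) (cball 0 1) = emeasure (sub_lborel B) A * emeasure (sub_lborel B) (cball 0 1)"
    by (simp add: em ball)
  then show "emeasure ?D A = emeasure (sub_lborel B) A"
    using emeasure_sub_lborel_cball_finite[of 1] emeasure_sub_lborel_cball_pos
    by (auto simp add: mult.commute[of _ "emeasure (sub_lborel B) (cball 0 1)"] ennreal_mult_cancel_left)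
qed simp

lemma PiM_std_normal_density:
  "Pi\<^sub>M B (\<lambda>_. density lborel (\<lambda>x. ennreal (std_normal_density x)))
    = density (Pi\<^sub>M B (\<lambda>_. lborel)) (\<lambda>g. \<Prod>b\<in>B. ennreal (std_normal_density (g b)))"
proof -
  have "sigma_finite_measure (density lborel (\<lambda>x. ennreal (std_normal_density x)))"
    by (rule prob_space_imp_sigma_finite) (simp add: prob_space_normal_density)
  then interpret N: product_sigma_finite "\<lambda>_::'a. density lborel (\<lambda>x. ennreal (std_normal_density x))"
    by (simp add: product_sigma_finite_def)
  let ?P = "Pi\<^sub>M B (\<lambda>_. lborel :: real measure)"
  show ?thesis
  proof (rule N.PiM_eqI[symmetric])
    fix A :: "'a \<Rightarrow> real set" assume "\<And>i. i \<in> B \<Longrightarrow> A i \<in> sets (density lborel (\<lambda>x. ennreal (std_normal_density x)))"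
    then have A [measurable]: "\<And>i. i \<in> B \<Longrightarrow> A i \<in> sets borel" by simp
    have "emeasure (density ?P (\<lambda>g. \<Prod>b\<in>B. ennreal (std_normal_density (g b)))) (Pi\<^sub>E B A)
      = (\<integral>\<^sup>+g. (\<Prod>b\<in>B. ennreal (std_normal_density (g b))) * indicator (Pi\<^sub>E B A) g \<partial>?P)"
      using A onb_finite by (intro emeasure_density) (auto intro!: sets_PiM_I_finite)
    also have "\<dots> = (\<integral>\<^sup>+g. (\<Prod>b\<in>B. ennreal (std_normal_density (g b)) * indicator (A b) (g b)) \<partial>?P)"
    proof (rule nn_integral_cong)
      fix g assume g: "g \<in> space ?P"
      have "(indicator (Pi\<^sub>E B A) g :: ennreal) = (\<Prod>b\<in>B. indicator (A b) (g b))"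
      proof (cases "g \<in> Pi\<^sub>E B A")
        case True
        then show ?thesis by (auto simp: PiE_iff intro!: prod.neutral[symmetric])
      next
        case False
        then obtain b where "b \<in> B" "g b \<notin> A b" using g by (auto simp: space_PiM PiE_iff)
        then have "(\<Prod>b\<in>B. indicator (A b) (g b) :: ennreal) = 0"
          by (intro prod_zero onb_finite bexI[of _ b]) auto
        then show ?thesis using False by simp
      qed
      then show "(\<Prod>b\<in>B. ennreal (std_normal_density (g b))) * indicator (Pi\<^sub>E B A) g
        = (\<Prod>b\<in>B. ennreal (std_normal_density (g b)) * indicator (A b) (g b))"
        by (simp add: prod.distrib)
    qed
    also have "\<dots> = (\<Prod>b\<in>B. \<integral>\<^sup>+x. ennreal (std_normal_density x) * indicator (A b) x \<partial>lborel)"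
      using A by (intro L.product_nn_integral_prod onb_finite) auto
    also have "\<dots> = (\<Prod>i\<in>B. emeasure (density lborel (\<lambda>x. ennreal (std_normal_density x))) (A i))"
      using A by (intro prod.cong refl emeasure_density[symmetric]) auto
    finally show "emeasure (density ?P (\<lambda>g. \<Prod>b\<in>B. ennreal (std_normal_density (g b)))) (Pi\<^sub>E B A)
      = (\<Prod>i\<in>B. emeasure (density lborel (\<lambda>x. ennreal (std_normal_density x))) (A i))" .
  qed (auto intro: onb_finite simp: cong: sets_PiM_cong)
qed

text \<open>
The density depends on the norm only, so the Gaussian measure inherits the
reflection invariance of Lebesgue measure on the subspace.
\<close>

lemma onb_gaussian_density:
  "onb_gaussian B = density (sub_lborel B) (\<lambda>x. ennreal ((1 / sqrt (2 * pi)) ^ card B * exp (- (norm x)\<^sup>2 / 2)))"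
proof -
  have "(\<Prod>b\<in>B. ennreal (std_normal_density (g b)))
     = ennreal ((1 / sqrt (2 * pi)) ^ card B * exp (- (norm (\<Sum>b\<in>B. g b *\<^sub>R b))\<^sup>2 / 2))" for g
  proof -
    have "(\<Prod>b\<in>B. ennreal (std_normal_density (g b))) = ennreal (\<Prod>b\<in>B. std_normal_density (g b))"
      by (rule prod_ennreal) simp
    also have "(\<Prod>b\<in>B. std_normal_density (g b)) = (1 / sqrt (2 * pi)) ^ card B * exp (\<Sum>b\<in>B. - (g b)\<^sup>2 / 2)"
      by (simp only: std_normal_density_def prod.distrib exp_sum onb_finite prod_constant)
    also have "(\<Sum>b\<in>B. - (g b)\<^sup>2 / 2) = - (norm (\<Sum>b\<in>B. g b *\<^sub>R b))\<^sup>2 / 2"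
      by (simp add: onb_norm sum_divide_distrib sum_negf)
    finally show ?thesis .
  qed
  then show ?thesis
    unfolding onb_gaussian_def PiM_std_normal_density sub_lborel_def
    by (subst density_distr) auto
qed

lemma prob_space_onb_gaussian: "prob_space (onb_gaussian B)"
  unfolding onb_gaussian_def
  by (intro prob_space.prob_space_distr prob_space_PiM) (auto intro: prob_space_normal_density)

lemma onb_gaussian_reflect:
  assumes "v \<in> L"
  shows "distr (onb_gaussian B) borel (reflect v) = onb_gaussian B"
proof -
  let ?f = "\<lambda>x::'a. ennreal ((1 / sqrt (2 * pi)) ^ card B * exp (- (norm x)\<^sup>2 / 2))"
  have "distr (density (sub_lborel B) (\<lambda>x. ?f (reflect v x))) borel (reflect v) = density (distr (sub_lborel B) borel (reflect v)) ?f"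
    by (subst density_distr) auto
  then show ?thesis using sub_lborel_reflect[OF assms] by (simp add: onb_gaussian_density)
qed

text \<open>
If a bounded part of \<open>Y\<close> had positive measure, then its disjoint translates by the vectors
\<open>b / n\<close>, for a basis vector \<open>b \<notin> Y\<close>, would all have that measure inside one bounded set.
\<close>

lemma sub_lborel_null_subspace:
  assumes Y: "subspace Y" "\<not> L \<subseteq> Y"
  shows "emeasure (sub_lborel B) Y = 0"
proof -
  obtain b where b: "b \<in> B" "b \<notin> Y"
    using Y span_minimal[of B Y] B unfolding orthonormal_basis_of_def by auto
  have YB [measurable]: "Y \<in> sets borel" using Y by (simp add: borel_closed closed_subspace)
  have z: "emeasure (sub_lborel B) (Y \<inter> cball 0 r) = 0" for r
  proof (rule ccontr)
    let ?m = "emeasure (sub_lborel B) (Y \<inter> cball 0 r)"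
    assume m: "?m \<noteq> 0"
    define S where "S n = (\<lambda>x. x + (- inverse (real (Suc n))) *\<^sub>R b) -` (Y \<inter> cball 0 r)" for n
    have S [measurable]: "S n \<in> sets borel" for n
      unfolding S_def by (rule measurable_sets_borel[where M=borel]) auto
    have eq: "emeasure (sub_lborel B) (S n) = ?m" for n
    proof -
      have "(- inverse (real (Suc n))) *\<^sub>R b \<in> L"
        using b onb_in onb_subspace by (simp add: subspace_scale subspace_neg)
      from sub_lborel_translate[OF this] show ?thesis
        using emeasure_distr[of "\<lambda>x. x + (- inverse (real (Suc n))) *\<^sub>R b" "sub_lborel B" borel "Y \<inter> cball 0 r"]
        by (simp add: S_def)
    qed
    have disj: "disjoint_family S"
      unfolding disjoint_family_on_def
    proof (intro ballI impI, rule ccontr)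
      fix i j :: nat assume ij: "i \<noteq> j"
      let ?a = "inverse (real (Suc i))" and ?c = "inverse (real (Suc j))"
      assume "S i \<inter> S j \<noteq> {}"
      then obtain x where "x - ?a *\<^sub>R b \<in> Y" "x - ?c *\<^sub>R b \<in> Y" by (auto simp: S_def)
      then have "(x - ?a *\<^sub>R b) - (x - ?c *\<^sub>R b) \<in> Y" using Y(1) subspace_diff by blast
      then have *: "(?c - ?a) *\<^sub>R b \<in> Y" by (simp add: algebra_simps)
      have "?c - ?a \<noteq> 0" using ij by simp
      then have "b \<in> Y" using subspace_scale[OF Y(1) *, of "inverse (?c - ?a)"] by simp
      then show False using b by simp
    qed
    have "(\<Sum>n. emeasure (sub_lborel B) (S n)) = emeasure (sub_lborel B) (\<Union>n. S n)"
      using disj by (intro suminf_emeasure) auto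
    also have "\<dots> \<le> emeasure (sub_lborel B) (cball 0 (r + 1))"
    proof (rule emeasure_mono)
      show "(\<Union>n. S n) \<subseteq> cball 0 (r + 1)"
      proof
        fix x assume "x \<in> (\<Union>n. S n)"
        then obtain n where "norm (x - inverse (real (Suc n)) *\<^sub>R b) \<le> r" by (auto simp: S_def)
        moreover have "norm (inverse (real (Suc n)) *\<^sub>R b) \<le> 1"
          using b B by (auto simp: orthonormal_basis_of_def inverse_eq_divide)
        ultimately show "x \<in> cball 0 (r + 1)"
          using norm_triangle_sub[of x "inverse (real (Suc n)) *\<^sub>R b"] by simp
      qed
    qed simp
    also have "\<dots> < \<infinity>" by (rule emeasure_sub_lborel_cball_finite)
    finally have fin: "(\<Sum>n::nat. ?m) \<noteq> top" by (simp add: eq less_top)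
    have "?m \<le> emeasure (sub_lborel B) (cball 0 r)" by (intro emeasure_mono) auto
    then obtain c where c: "?m = ennreal c" "c \<ge> 0"
      using emeasure_sub_lborel_cball_finite[of r] by (cases ?m) (auto simp: top_unique)
    have "summable (\<lambda>n::nat. c)"
      using fin c by (intro summable_suminf_not_top) auto
    then have "c = 0" using summable_LIMSEQ_zero LIMSEQ_const_iff by blast
    then show False using m c by simp
  qed
  have "Y = (\<Union>n. Y \<inter> cball 0 (real n))" by (auto simp: real_arch_simple)
  also have "emeasure (sub_lborel B) \<dots> = 0"
    using z by (intro emeasure_UN_eq_0) auto
  finally show ?thesis .
qed

end

lemma std_gaussian_onb:
  assumes "subspace L"
  obtains B where "orthonormal_basis_of B L" "std_gaussian L = onb_gaussian B"
proof
  let ?B = "SOME B. orthonormal_basis_of B L"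
  show B: "orthonormal_basis_of ?B L"
    by (rule someI_ex, rule ex_orthonormal_basis_of) fact
  show "std_gaussian L = onb_gaussian ?B"
    unfolding std_gaussian_def onb_gaussian_def Let_def ..
qed

lemma sets_std_gaussian [simp, measurable_cong]: "sets (std_gaussian L) = sets borel"
  and space_std_gaussian [simp]: "space (std_gaussian L) = UNIV"
  by (simp_all add: std_gaussian_def Let_def)

context
  fixes L :: "'a::euclidean_space set"
  assumes L: "subspace L"
begin

lemma prob_space_std_gaussian: "prob_space (std_gaussian L)"
  using std_gaussian_onb[OF L] prob_space_onb_gaussian by metis

lemma std_gaussian_reflect:
  assumes "v \<in> L"
  shows "distr (std_gaussian L) borel (reflect v) = std_gaussian L"
  using std_gaussian_onb[OF L] onb_gaussian_reflect[OF _ assms] by metis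

lemma AE_std_gaussian: "AE x in std_gaussian L. x \<in> L"
proof -
  obtain B where B: "orthonormal_basis_of B L" "std_gaussian L = onb_gaussian B"
    using std_gaussian_onb[OF L] .
  note sets_sub_lborel[OF B(1), measurable_cong]
  show ?thesis unfolding B(2) onb_gaussian_density[OF B(1)]
    using AE_sub_lborel[OF B(1)] by (subst AE_density) auto
qed

lemma AE_std_gaussian_not_in:
  assumes Y: "subspace Y" "\<not> L \<subseteq> Y"
  shows "AE x in std_gaussian L. x \<notin> Y"
proof -
  obtain B where B: "orthonormal_basis_of B L" "std_gaussian L = onb_gaussian B"
    using std_gaussian_onb[OF L] .
  note sets_sub_lborel[OF B(1), measurable_cong]
  have "Y \<in> sets borel" using Y by (simp add: borel_closed closed_subspace)
  then have "AE x in sub_lborel B. x \<notin> Y"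
    using sub_lborel_null_subspace[OF B(1) Y] B(1) by (intro AE_not_in) (auto simp: null_sets_def)
  then show ?thesis unfolding B(2) onb_gaussian_density[OF B(1)]
    by (subst AE_density) (auto simp: B(1))
qed

end

section \<open>Reflection-invariant laws and cones\<close>

lemma sgn_measurable [measurable]: "(sgn :: 'a::euclidean_space \<Rightarrow> 'a) \<in> borel_measurable borel"
proof -
  have "(sgn :: 'a \<Rightarrow> 'a) = (\<lambda>x. inverse (norm x) *\<^sub>R x)"
    by (simp add: fun_eq_iff sgn_div_norm)
  also have "\<dots> \<in> borel_measurable borel" by measurable
  finally show ?thesis .
qed

lemma sgn_reflect: "sgn (reflect v x) = reflect v (sgn x)"
  by (simp add: sgn_div_norm linear_scale[OF linear_reflect])

lemma dist_reflect [simp]: "dist (reflect v x) (reflect v y) = dist x y"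
  using norm_reflect[of v "x - y"] linear_diff[OF linear_reflect, of v x y] by (simp add: dist_norm)

text \<open>
The indicator function of the cone of all vectors whose direction is close to that of \<open>x\<close>. As a
function of two arguments it is symmetric and invariant under reflections.
\<close>

definition cap_kernel :: "nat \<Rightarrow> 'a::euclidean_space \<Rightarrow> 'a \<Rightarrow> ennreal" where
  "cap_kernel n x y = indicator {z. dist (sgn x) (sgn z) < 1 / real (Suc n)} y"

lemma cap_kernel_measurable [measurable]: "case_prod (cap_kernel n) \<in> borel_measurable (borel \<Otimes>\<^sub>M borel)"
proof -
  have "case_prod (cap_kernel n :: 'a \<Rightarrow> 'a \<Rightarrow> ennreal) =
     (\<lambda>p. if dist (sgn (fst p)) (sgn (snd p)) < 1 / real (Suc n) then 1 else 0)"
    by (auto simp: cap_kernel_def fun_eq_iff)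
  also have "\<dots> \<in> borel_measurable (borel \<Otimes>\<^sub>M borel)" by measurable
  finally show ?thesis .
qed

lemma cap_kernel_commute: "cap_kernel n x y = cap_kernel n y x"
  by (auto simp: cap_kernel_def dist_commute indicator_def)

text \<open>
The laws on \<open>L\<close> without an atom at the origin whose direction is uniformly distributed. The
lemmas below show that such a law gives to every cone the same mass as the Gaussian measure.
\<close>

locale reflection_invariant = prob_space M for M :: "'a::euclidean_space measure" +
  fixes L :: "'a set"
  assumes sets_M [simp, measurable_cong]: "sets M = sets borel"
    and L: "subspace L"
    and AE_L: "AE x in M. x \<in> L \<and> x \<noteq> 0"
    and invariant: "\<And>v. v \<in> L \<Longrightarrow> distr M borel (reflect v) = M"
begin

lemma space_M [simp]: "space M = UNIV"
  using sets_eq_imp_space_eq[OF sets_M] by simp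

lemma cap_kernel_sect [measurable]: "cap_kernel n x \<in> borel_measurable M"
  unfolding cap_kernel_def by measurable

lemma cap_const:
  assumes "x \<in> L" "x \<noteq> 0" "y \<in> L" "y \<noteq> 0"
  shows "(\<integral>\<^sup>+z. cap_kernel n x z \<partial>M) = (\<integral>\<^sup>+z. cap_kernel n y z \<partial>M)"
proof -
  let ?v = "sgn x - sgn y"
  have v: "?v \<in> L" using assms L by (auto simp: sgn_div_norm subspace_diff subspace_scale)
  have r: "reflect ?v (sgn x) = sgn y"
    using assms by (intro reflect_swaps) (simp add: norm_sgn)
  have "(\<integral>\<^sup>+z. cap_kernel n y z \<partial>M) = (\<integral>\<^sup>+z. cap_kernel n y z \<partial>distr M borel (reflect ?v))"
    using invariant[OF v] by simp
  also have "\<dots> = (\<integral>\<^sup>+z. cap_kernel n y (reflect ?v z) \<partial>M)"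
    using cap_kernel_sect[of n y] by (intro nn_integral_distr) (auto simp del: cap_kernel_sect)
  also have "(\<lambda>z. cap_kernel n y (reflect ?v z)) = cap_kernel n x"
  proof
    fix z
    have "dist (sgn y) (sgn (reflect ?v z)) = dist (reflect ?v (sgn x)) (reflect ?v (sgn z))"
      by (simp only: sgn_reflect r)
    then have "dist (sgn y) (sgn (reflect ?v z)) = dist (sgn x) (sgn z)"
      by (simp only: dist_reflect)
    then show "cap_kernel n y (reflect ?v z) = cap_kernel n x z"
      by (simp add: cap_kernel_def indicator_def)
  qed
  finally show ?thesis by simp
qed

text \<open>
By compactness finitely many caps of the same size cover the unit sphere of \<open>L\<close>, and they all
have the same mass, which is therefore positive.
\<close>

lemma cap_pos:
  assumes "x \<in> L" "x \<noteq> 0"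
  shows "(\<integral>\<^sup>+z. cap_kernel n x z \<partial>M) \<noteq> 0"
proof
  assume 0: "(\<integral>\<^sup>+z. cap_kernel n x z \<partial>M) = 0"
  have "compact (L \<inter> sphere 0 1)"
    using L by (simp add: closed_subspace closed_Int_compact)
  moreover have "L \<inter> sphere 0 1 \<subseteq> (\<Union>c\<in>L \<inter> sphere 0 1. ball c (1 / real (Suc n)))"
    by (auto intro!: bexI)
  ultimately obtain D where D: "D \<subseteq> L \<inter> sphere 0 1" "finite D"
    "L \<inter> sphere 0 1 \<subseteq> (\<Union>c\<in>D. ball c (1 / real (Suc n)))"
    by (elim compactE_image) auto
  have "AE z in M. \<forall>c\<in>D. cap_kernel n c z = 0"
  proof (rule AE_finite_allI[OF D(2)])
    fix c assume "c \<in> D"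
    then have c: "c \<in> L" "c \<noteq> 0" using D(1) by auto
    have "(\<integral>\<^sup>+z. cap_kernel n c z \<partial>M) = 0" using cap_const[OF assms c] 0 by simp
    then show "AE z in M. cap_kernel n c z = 0"
      by (subst (asm) nn_integral_0_iff_AE) auto
  qed
  then have "AE z in M. False"
    using AE_L
  proof eventually_elim
    case (elim z)
    then have "sgn z \<in> L \<inter> sphere 0 1"
      using L by (auto simp: sgn_div_norm subspace_scale)
    then obtain c where c: "c \<in> D" "dist c (sgn z) < 1 / real (Suc n)"
      using D(3) by auto
    moreover have "sgn c = c" using c(1) D(1) by (auto simp: sgn_div_norm)
    ultimately show False using elim by (auto simp: cap_kernel_def)
  qed
  then show False by simp
qed

lemma ex_nonzero: "\<exists>x. x \<in> L \<and> x \<noteq> 0"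
proof (rule ccontr)
  assume "\<nexists>x. x \<in> L \<and> x \<noteq> 0"
  then have *: "x \<in> L \<Longrightarrow> x = 0" for x by auto
  have "AE z in M. False" using AE_L by eventually_elim (use * in auto)
  then show False by simp
qed

end

text \<open>
Uniformly distributed measures are unique. By Fubini the caps of a given size have the same
mass \<open>c n\<close> for \<open>\<mu>\<close> and for \<open>\<nu>\<close>. Let \<open>\<Phi> n x\<close> be the proportion, measured by \<open>\<nu>\<close>, of the cap around \<open>x\<close> whose directions lie in the
open set \<open>O'\<close>. It tends to 1 if the direction of \<open>x\<close> is in \<open>O'\<close>, whereas by Fubini its integral against \<open>\<mu>\<close> is the
\<open>\<nu>\<close>-mass of directions in \<open>O'\<close>. Fatou's lemma gives the inequality; exchanging the two measures gives equality.
\<close>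

lemma sgn_law_le:
  assumes "reflection_invariant \<mu> L" "reflection_invariant \<nu> L" and O: "open O'"
  shows "emeasure \<mu> (sgn -` O') \<le> emeasure \<nu> (sgn -` O')"
proof -
  interpret m: reflection_invariant \<mu> L by fact
  interpret n: reflection_invariant \<nu> L by fact
  interpret pair_sigma_finite \<mu> \<nu> ..
  obtain x0 where x0: "x0 \<in> L" "x0 \<noteq> 0" using m.ex_nonzero by auto
  have [measurable]: "O' \<in> sets borel" using O by simp
  have [measurable]: "sgn -` O' \<in> sets borel"
    using measurable_sets[OF sgn_measurable, of O'] by simp
  define c where "c n = (\<integral>\<^sup>+z. cap_kernel n x0 z \<partial>\<nu>)" for n
  have cn: "(\<integral>\<^sup>+z. cap_kernel n x z \<partial>\<nu>) = c n" if "x \<in> L \<and> x \<noteq> 0" for x n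
    using n.cap_const[of x x0 n] that x0 by (simp add: c_def)
  have cm: "(\<integral>\<^sup>+z. cap_kernel n x z \<partial>\<mu>) = c n" if "x \<in> L \<and> x \<noteq> 0" for x n
  proof -
    have "c n = (\<integral>\<^sup>+x. \<integral>\<^sup>+z. cap_kernel n x z \<partial>\<nu> \<partial>\<mu>)"
    proof -
      have "(\<integral>\<^sup>+x. \<integral>\<^sup>+z. cap_kernel n x z \<partial>\<nu> \<partial>\<mu>) = (\<integral>\<^sup>+x. c n \<partial>\<mu>)"
        using m.AE_L by (intro nn_integral_cong_AE) (auto simp: cn)
      then show ?thesis by (simp add: m.emeasure_space_1[simplified])
    qed
    also have "\<dots> = (\<integral>\<^sup>+z. \<integral>\<^sup>+x. cap_kernel n x z \<partial>\<mu> \<partial>\<nu>)"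
      by (rule Fubini'[symmetric]) simp
    also have "\<dots> = (\<integral>\<^sup>+z. \<integral>\<^sup>+y. cap_kernel n x y \<partial>\<mu> \<partial>\<nu>)"
    proof (intro nn_integral_cong_AE, use n.AE_L in eventually_elim)
      case (elim z)
      then show ?case
        using m.cap_const[of z x n] that by (simp add: cap_kernel_commute[of n _ z])
    qed
    finally show ?thesis by (simp add: n.emeasure_space_1[simplified])
  qed
  have c0: "c n \<noteq> 0" for n using n.cap_pos[OF x0] by (simp add: c_def)
  have ct: "c n \<noteq> top" for n
  proof -
    have "c n \<le> (\<integral>\<^sup>+z. 1 \<partial>\<nu>)" unfolding c_def by (intro nn_integral_mono) (auto simp: cap_kernel_def indicator_def)
    then show ?thesis using n.emeasure_space_1 by (auto simp: top_unique)
  qed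
  have c1: "c n / c n = 1" for n
    using c0 ct by (intro ennreal_divide_self) (auto simp: top.not_eq_extremum)
  define \<Phi> where "\<Phi> n x = (\<integral>\<^sup>+z. cap_kernel n x z * indicator (sgn -` O') z \<partial>\<nu>) / c n" for n x
  have int: "(\<integral>\<^sup>+x. \<Phi> n x \<partial>\<mu>) = emeasure \<nu> (sgn -` O')" for n
  proof -
    have "(\<integral>\<^sup>+x. \<Phi> n x \<partial>\<mu>) = (\<integral>\<^sup>+x. (\<integral>\<^sup>+z. cap_kernel n x z * indicator (sgn -` O') z \<partial>\<nu>) \<partial>\<mu>) / c n"
      unfolding \<Phi>_def by (rule nn_integral_divide) measurable
    also have "(\<integral>\<^sup>+x. (\<integral>\<^sup>+z. cap_kernel n x z * indicator (sgn -` O') z \<partial>\<nu>) \<partial>\<mu>)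
        = (\<integral>\<^sup>+z. (\<integral>\<^sup>+x. cap_kernel n x z * indicator (sgn -` O') z \<partial>\<mu>) \<partial>\<nu>)"
      by (rule Fubini'[symmetric]) measurable
    also have "\<dots> = (\<integral>\<^sup>+z. c n * indicator (sgn -` O') z \<partial>\<nu>)"
    proof (intro nn_integral_cong_AE, use n.AE_L in eventually_elim)
      case (elim z)
      have "(\<integral>\<^sup>+x. cap_kernel n x z * indicator (sgn -` O') z \<partial>\<mu>) = (\<integral>\<^sup>+x. cap_kernel n z x * indicator (sgn -` O') z \<partial>\<mu>)"
        by (simp add: cap_kernel_commute[of n _ z])
      also have "\<dots> = (\<integral>\<^sup>+x. cap_kernel n z x \<partial>\<mu>) * indicator (sgn -` O') z"
        by (rule nn_integral_multc) simp
      finally show ?case by (simp add: cm elim)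
    qed
    also have "\<dots> = c n * emeasure \<nu> (sgn -` O')" by (simp add: nn_integral_cmult)
    also have "\<dots> / c n = emeasure \<nu> (sgn -` O')"
      using c0 ct by (metis mult.commute mult_divide_eq_ennreal)
    finally show ?thesis .
  qed
  have "emeasure \<mu> (sgn -` O') = (\<integral>\<^sup>+x. indicator (sgn -` O') x \<partial>\<mu>)" by simp
  also have "\<dots> \<le> (\<integral>\<^sup>+x. liminf (\<lambda>n. \<Phi> n x) \<partial>\<mu>)"
  proof (intro nn_integral_mono_AE, use m.AE_L in eventually_elim)
    case (elim x)
    show ?case
    proof (cases "sgn x \<in> O'")
      case True
      then obtain e where e: "e > 0" "ball (sgn x) e \<subseteq> O'" using O openE by blast
      obtain n0 where n0: "inverse (real (Suc n0)) < e" using reals_Archimedean[OF e(1)] by auto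
      \<comment> \<open>once the cap is smaller than \<open>e\<close>, all its directions lie in \<open>O'\<close>\<close>
      have "\<Phi> n x = 1" if "n \<ge> n0" for n
      proof -
        have "1 / real (Suc n) \<le> inverse (real (Suc n0))"
          using that by (simp add: field_simps)
        then have "1 / real (Suc n) < e" using n0 by simp
        then have "cap_kernel n x z * indicator (sgn -` O') z = cap_kernel n x z" for z
          using e(2) by (auto simp: cap_kernel_def indicator_def subset_iff)
        then show ?thesis using cn[OF elim] c1 by (simp add: \<Phi>_def)
      qed
      then have "1 \<le> liminf (\<lambda>n. \<Phi> n x)"
        by (intro Liminf_bounded) (auto simp: eventually_sequentially intro!: exI[of _ n0])
      then show ?thesis using True by simp
    qed simp
  qed
  also have "\<dots> \<le> liminf (\<lambda>n. \<integral>\<^sup>+x. \<Phi> n x \<partial>\<mu>)"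
    unfolding \<Phi>_def by (rule nn_integral_liminf) measurable
  also have "\<dots> = emeasure \<nu> (sgn -` O')"
    by (simp add: int Liminf_const)
  finally show ?thesis .
qed

lemma cone_mem_sgn: "cone K \<Longrightarrow> sgn x \<in> K \<longleftrightarrow> x \<in> K" for x :: "'a::real_normed_vector"
proof
  assume K: "cone K" and s: "sgn x \<in> K"
  have "norm x *\<^sub>R sgn x \<in> K" using K s unfolding cone_def by simp
  then show "x \<in> K" by (cases "x = 0") (simp_all add: sgn_div_norm)
next
  assume K: "cone K" and "x \<in> K"
  then show "sgn x \<in> K" unfolding cone_def by (simp add: sgn_div_norm)
qed

lemma cone_measure_unique:
  assumes \<mu>: "reflection_invariant \<mu> L" and \<nu>: "reflection_invariant \<nu> L"
    and K: "cone K" "K \<in> sets borel"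
  shows "measure \<mu> K = measure \<nu> K"
proof -
  interpret m: reflection_invariant \<mu> L by fact
  interpret n: reflection_invariant \<nu> L by fact
  have "distr \<mu> borel sgn = distr \<nu> borel sgn"
  proof (rule measure_eqI_generator_eq[where E="{S. open S}" and \<Omega>=UNIV and A="\<lambda>_. UNIV"])
    fix X :: "'a set" assume "X \<in> {S. open S}"
    then show "emeasure (distr \<mu> borel sgn) X = emeasure (distr \<nu> borel sgn) X"
      using sgn_law_le[OF \<mu> \<nu>, of X] sgn_law_le[OF \<nu> \<mu>, of X] by (simp add: emeasure_distr)
  next
    show "emeasure (distr \<mu> borel sgn) UNIV \<noteq> \<infinity>" by (simp add: emeasure_distr)
  qed (auto simp: Int_stable_def borel_def)
  then have "measure (distr \<mu> borel sgn) K = measure (distr \<nu> borel sgn) K" by simp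
  moreover have "sgn -` K = K" using cone_mem_sgn[OF K(1)] by auto
  ultimately show ?thesis using K(2) by (simp add: measure_distr)
qed

text \<open>
The source of all the product formulas. The maps \<open>\<tau>\<close> express that, conditionally on the vectors
\<open>u l\<close> with \<open>l \<noteq> j\<close>, the law of \<open>u j\<close> is invariant under the reflections of \<open>\<Lambda> j\<close>. So conditioning on the
events for the other indices does not change the probability that \<open>u j\<close> lies in a cone, which is
its Gaussian measure. Stating the invariance by measure-preserving maps makes explicit conditional
distributions superfluous, and the lengths of the vectors may depend on each other arbitrarily.
\<close>

lemma (in prob_space) prob_cones_of_rotation_invariant:
  fixes u :: "'j \<Rightarrow> 'a \<Rightarrow> 'b::euclidean_space"
  assumes J: "finite J"
    and \<Lambda>: "\<And>j. j \<in> J \<Longrightarrow> subspace (\<Lambda> j)"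
    and u: "\<And>j. j \<in> J \<Longrightarrow> u j \<in> borel_measurable M"
    and uL: "\<And>j. j \<in> J \<Longrightarrow> AE \<omega> in M. u j \<omega> \<in> \<Lambda> j"
    and u0: "\<And>j. j \<in> J \<Longrightarrow> \<Lambda> j \<noteq> {0} \<Longrightarrow> AE \<omega> in M. u j \<omega> \<noteq> 0"
    and K: "\<And>j. j \<in> J \<Longrightarrow> cone (K j)" "\<And>j. j \<in> J \<Longrightarrow> K j \<in> sets borel"
    and \<tau>: "\<And>j v. j \<in> J \<Longrightarrow> v \<in> \<Lambda> j \<Longrightarrow> \<exists>\<tau>. \<tau> \<in> measurable M M \<and> distr M M \<tau> = M \<and>
        (AE \<omega> in M. u j (\<tau> \<omega>) = reflect v (u j \<omega>)) \<and> (\<forall>l\<in>J - {j}. AE \<omega> in M. u l (\<tau> \<omega>) = u l \<omega>)"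
  shows "prob {\<omega> \<in> space M. \<forall>j\<in>J. u j \<omega> \<in> K j} = (\<Prod>j\<in>J. measure (std_gaussian (\<Lambda> j)) (K j))"
proof -
  have "prob {\<omega> \<in> space M. \<forall>j\<in>I. u j \<omega> \<in> K j} = (\<Prod>j\<in>I. measure (std_gaussian (\<Lambda> j)) (K j))" if "I \<subseteq> J" for I
    using finite_subset[OF that J] that
  proof (induction I rule: finite_induct)
    case empty
    then show ?case by (simp add: prob_space)
  next
    case (insert j I)
    then have j: "j \<in> J" "j \<notin> I" and I: "I \<subseteq> J" "finite I" by auto
    note [measurable] = u[OF j(1)] K(2)[OF j(1)]
    have uI [measurable]: "u l \<in> borel_measurable M" and KI [measurable]: "K l \<in> sets borel" if "l \<in> I" for l
      using that I u K by auto
    define R where "R = {\<omega> \<in> space M. \<forall>j\<in>I. u j \<omega> \<in> K j}"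
    have R [measurable]: "R \<in> sets M" unfolding R_def using I(2) by measurable
    define E where "E X = {\<omega> \<in> space M. u j \<omega> \<in> X}" for X
    have E [measurable]: "E X \<in> sets M" if [measurable]: "X \<in> sets borel" for X
      unfolding E_def by measurable
    have "prob (R \<inter> E (K j)) = prob R * measure (std_gaussian (\<Lambda> j)) (K j)"
    proof (cases "prob R = 0 \<or> \<Lambda> j = {0}")
      case True
      then show ?thesis
      proof
        assume "prob R = 0"
        moreover have "prob (R \<inter> E (K j)) \<le> prob R" by (intro finite_measure_mono) auto
        ultimately show ?thesis using measure_nonneg[of M "R \<inter> E (K j)"] by simp
      next
        assume L0: "\<Lambda> j = {0}"
        have "prob (R \<inter> E (K j)) = prob (if 0 \<in> K j then R else {})"
          using uL[OF j(1)] R E[OF K(2)[OF j(1)]] by (intro measure_eq_AE) (auto simp: L0 E_def R_def elim!: eventually_mono)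
        also have "\<dots> = prob R * measure (std_gaussian (\<Lambda> j)) (K j)"
          by (simp add: L0 std_gaussian_zero measure_return indicator_def)
        finally show ?thesis .
      qed
    next
      case False
      then have R0: "prob R \<noteq> 0" "emeasure M R \<noteq> 0" and L0: "\<Lambda> j \<noteq> {0}"
        by (auto simp: measure_def)
      define \<mu> where "\<mu> = distr (uniform_measure M R) borel (u j)"
      have um: "prob_space (uniform_measure M R)"
        using R0 by (intro prob_space_uniform_measure) (auto simp: emeasure_eq_measure)
      have emu: "emeasure \<mu> X = emeasure M (R \<inter> E X) / emeasure M R" if [measurable]: "X \<in> sets borel" for X
        unfolding \<mu>_def by (subst emeasure_distr) (auto simp: E_def vimage_def Int_def conj_commute intro!: arg_cong2[of _ _ _ _ emeasure])
      have \<mu>: "reflection_invariant \<mu> (\<Lambda> j)"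
      proof (intro reflection_invariant.intro reflection_invariant_axioms.intro)
        show "prob_space \<mu>" unfolding \<mu>_def using um by (intro prob_space.prob_space_distr) auto
        show "sets \<mu> = sets borel" by (simp add: \<mu>_def)
        show L: "subspace (\<Lambda> j)" using \<Lambda>[OF j(1)] .
        have [measurable]: "\<Lambda> j \<in> sets borel" using L by (simp add: borel_closed closed_subspace)
        have "AE \<omega> in uniform_measure M R. u j \<omega> \<in> \<Lambda> j \<and> u j \<omega> \<noteq> 0"
          using uL[OF j(1)] u0[OF j(1) L0] by (intro AE_uniform_measureI) auto
        then show "AE x in \<mu>. x \<in> \<Lambda> j \<and> x \<noteq> 0"
          unfolding \<mu>_def by (subst AE_distr_iff) auto
        fix v assume v: "v \<in> \<Lambda> j"
        obtain \<tau> where t [measurable]: "\<tau> \<in> measurable M M" and dt: "distr M M \<tau> = M"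
          and tj: "AE \<omega> in M. u j (\<tau> \<omega>) = reflect v (u j \<omega>)"
          and tl: "\<forall>l\<in>J - {j}. AE \<omega> in M. u l (\<tau> \<omega>) = u l \<omega>"
          using \<tau>[OF j(1) v] by blast
        have tI: "AE \<omega> in M. \<forall>l\<in>I. u l (\<tau> \<omega>) = u l \<omega>"
          using tl I j(2) by (intro AE_finite_allI) auto
        show "distr \<mu> borel (reflect v) = \<mu>"
        proof (rule measure_eqI)
          fix X assume "X \<in> sets (distr \<mu> borel (reflect v))"
          then have X [measurable]: "X \<in> sets borel" by simp
          have [measurable]: "reflect v -` X \<in> sets borel"
            using measurable_sets[OF reflect_measurable X] by simp
          have "emeasure M (R \<inter> E (reflect v -` X)) = emeasure M (\<tau> -` (R \<inter> E X) \<inter> space M)"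
          proof (rule emeasure_eq_AE)
            show "AE \<omega> in M. (\<omega> \<in> R \<inter> E (reflect v -` X)) = (\<omega> \<in> \<tau> -` (R \<inter> E X) \<inter> space M)"
              using tI tj AE_space
            proof eventually_elim
              case (elim \<omega>)
              then show ?case using measurable_space[OF t, of \<omega>] by (auto simp: R_def E_def)
            qed
          qed measurable
          also have "\<dots> = emeasure (distr M M \<tau>) (R \<inter> E X)"
            by (rule emeasure_distr[symmetric]) measurable
          finally have "emeasure M (R \<inter> E (reflect v -` X)) = emeasure M (R \<inter> E X)" by (simp add: dt)
          moreover have "emeasure (distr \<mu> borel (reflect v)) X = emeasure \<mu> (reflect v -` X)"
            by (subst emeasure_distr) (auto simp: \<mu>_def)
          ultimately show "emeasure (distr \<mu> borel (reflect v)) X = emeasure \<mu> X"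
            by (simp add: emu)
        qed (simp add: \<mu>_def)
      qed
      have \<gamma>: "reflection_invariant (std_gaussian (\<Lambda> j)) (\<Lambda> j)"
      proof (intro reflection_invariant.intro reflection_invariant_axioms.intro)
        show L: "subspace (\<Lambda> j)" using \<Lambda>[OF j(1)] .
        show "prob_space (std_gaussian (\<Lambda> j))" by (rule prob_space_std_gaussian[OF L])
        have "\<not> \<Lambda> j \<subseteq> {0}" using L0 subspace_0[OF L] by auto
        from AE_std_gaussian_not_in[OF L _ this] AE_std_gaussian[OF L]
        show "AE x in std_gaussian (\<Lambda> j). x \<in> \<Lambda> j \<and> x \<noteq> 0"
          by (auto simp: subspace_single_0)
      qed (auto intro: std_gaussian_reflect \<Lambda> j)
      have "measure \<mu> (K j) = measure (std_gaussian (\<Lambda> j)) (K j)"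
        using cone_measure_unique[OF \<mu> \<gamma>] K[OF j(1)] by simp
      moreover have "measure \<mu> (K j) = prob (R \<inter> E (K j)) / prob R"
        unfolding measure_def emu[OF K(2)[OF j(1)]]
        using R0 by (simp add: emeasure_eq_measure divide_ennreal less_le)
      ultimately show ?thesis using R0 by (simp add: field_simps)
    qed
    moreover have "R \<inter> E (K j) = {\<omega> \<in> space M. \<forall>l\<in>insert j I. u l \<omega> \<in> K l}"
      by (auto simp: R_def E_def)
    ultimately show ?case
      using insert.IH I j by (simp add: R_def mult.commute)
  qed
  from this[of J] show ?thesis by simp
qed

section \<open>Invariance of independent Haar rotations\<close>

lemma measurable_vec_lambda:
  "(\<And>i. (\<lambda>x. f x i) \<in> borel_measurable M) \<Longrightarrow> (\<lambda>x. \<chi> i::'n::finite. (f x i :: 'b::euclidean_space)) \<in> borel_measurable M"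
  by (subst borel_measurable_euclidean_space)
    (auto simp: Basis_vec_def inner_axis intro!: borel_measurable_inner)

lemma continuous_on_matrix_matrix_mult [continuous_intros]:
  fixes f g :: "'a::topological_space \<Rightarrow> real^'d^'d"
  assumes "continuous_on S f" "continuous_on S g"
  shows "continuous_on S (\<lambda>x. f x ** g x)"
  unfolding matrix_matrix_mult_def by (intro continuous_intros assms)

lemma continuous_on_transpose [continuous_intros]:
  fixes f :: "'a::topological_space \<Rightarrow> real^'d^'d"
  assumes "continuous_on S f"
  shows "continuous_on S (\<lambda>x. transpose (f x))"
  unfolding transpose_def by (intro continuous_intros assms)

lemma continuous_on_matrix_vector_mult' [continuous_intros]:
  fixes f :: "'a::topological_space \<Rightarrow> real^'d^'d" and g :: "'a \<Rightarrow> real^'d"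
  assumes "continuous_on S f" "continuous_on S g"
  shows "continuous_on S (\<lambda>x. f x *v g x)"
  unfolding matrix_vector_mult_def by (intro continuous_intros assms)

lemma matrix_mult_measurable [measurable]:
  fixes f g :: "'a \<Rightarrow> real^'d^'d"
  assumes [measurable]: "f \<in> borel_measurable M" "g \<in> borel_measurable M"
  shows "(\<lambda>x. f x ** g x) \<in> borel_measurable M"
proof -
  have "(\<lambda>p::(real^'d^'d) \<times> (real^'d^'d). fst p ** snd p) \<in> borel_measurable borel"
    by (intro borel_measurable_continuous_onI continuous_intros)
  from measurable_compose[OF borel_measurable_Pair[OF assms] this] show ?thesis by simp
qed

lemma transpose_measurable [measurable]:
  fixes f :: "'a \<Rightarrow> real^'d^'d"
  assumes [measurable]: "f \<in> borel_measurable M"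
  shows "(\<lambda>x. transpose (f x)) \<in> borel_measurable M"
proof -
  have "(transpose :: real^'d^'d \<Rightarrow> _) \<in> borel_measurable borel"
    by (intro borel_measurable_continuous_onI continuous_intros)
  from measurable_compose[OF assms this] show ?thesis by simp
qed

text \<open>
Integrating \<open>1\<^sub>X(A\<^sup>T B)\<close> over independent \<open>A\<close> and \<open>B\<close> in both orders shows that transposition, which is inversion in the
orthogonal group, preserves a left-invariant law. It turns left into right multiplication.
\<close>

lemma left_invariant_imp_right_invariant:
  fixes \<nu> :: "(real^'d^'d) measure"
  assumes "prob_space \<nu>" and sets [simp, measurable_cong]: "sets \<nu> = sets borel"
    and AE_orth: "AE A in \<nu>. orthogonal_matrix A"
    and left: "\<And>U. orthogonal_matrix U \<Longrightarrow> distr \<nu> borel (\<lambda>A. U ** A) = \<nu>"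
    and U: "orthogonal_matrix U"
  shows "distr \<nu> borel (\<lambda>A. A ** U) = \<nu>"
proof -
  interpret prob_space \<nu> by fact
  interpret pair_sigma_finite \<nu> \<nu> ..
  have [simp]: "space \<nu> = UNIV" using sets_eq_imp_space_eq[OF sets] by simp
  have left': "(\<integral>\<^sup>+A. f (V ** A) \<partial>\<nu>) = (\<integral>\<^sup>+A. f A \<partial>\<nu>)"
    if "orthogonal_matrix V" and [measurable]: "f \<in> borel_measurable borel" for V f
    using nn_integral_distr[of "\<lambda>A. V ** A" \<nu> borel f] left[OF that(1)] by simp
  \<comment> \<open>inner integral over \<open>B\<close>: left multiplication by \<open>A\<^sup>T\<close>; over \<open>A\<close>: \<open>A\<^sup>T B\<close> is the transpose of \<open>B\<^sup>T A\<close>\<close>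
  have tr: "distr \<nu> borel transpose = \<nu>"
  proof (rule measure_eqI)
    fix X assume "X \<in> sets (distr \<nu> borel transpose)"
    then have X [measurable]: "X \<in> sets borel" by simp
    have "emeasure \<nu> X = (\<integral>\<^sup>+A. \<integral>\<^sup>+B. indicator X B \<partial>\<nu> \<partial>\<nu>)"
      using emeasure_space_1 by simp
    also have "\<dots> = (\<integral>\<^sup>+A. \<integral>\<^sup>+B. indicator X (transpose A ** B) \<partial>\<nu> \<partial>\<nu>)"
    proof (intro nn_integral_cong_AE, use AE_orth in eventually_elim)
      case (elim A)
      then show ?case
        using left'[of "transpose A" "indicator X"] by (simp add: orthogonal_matrix_transpose)
    qed
    also have "\<dots> = (\<integral>\<^sup>+B. \<integral>\<^sup>+A. indicator X (transpose A ** B) \<partial>\<nu> \<partial>\<nu>)"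
      by (rule Fubini') measurable
    also have "\<dots> = (\<integral>\<^sup>+B. \<integral>\<^sup>+A. indicator X (transpose A) \<partial>\<nu> \<partial>\<nu>)"
    proof (intro nn_integral_cong_AE, use AE_orth in eventually_elim)
      case (elim B)
      then show ?case
        using left'[of "transpose B" "\<lambda>A. indicator X (transpose A)"]
        by (simp add: orthogonal_matrix_transpose matrix_transpose_mul)
    qed
    also have "\<dots> = (\<integral>\<^sup>+A. indicator X A \<partial>distr \<nu> borel transpose)"
      using emeasure_space_1 by (subst nn_integral_distr) auto
    also have "\<dots> = emeasure (distr \<nu> borel transpose) X" by simp
    finally show "emeasure (distr \<nu> borel transpose) X = emeasure \<nu> X" ..
  qed simp
  have Ut: "orthogonal_matrix (transpose U)" using U by (simp add: orthogonal_matrix_transpose)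
  have "\<nu> = distr (distr (distr \<nu> borel transpose) borel (\<lambda>A. transpose U ** A)) borel transpose"
    using left[OF Ut] by (simp add: tr)
  also have "\<dots> = distr \<nu> borel (\<lambda>A. A ** U)"
    by (simp add: distr_distr o_def matrix_transpose_mul)
  finally show ?thesis ..
qed

lemma haar_right_invariant:
  fixes X :: "'w \<Rightarrow> real^'d^'d"
  assumes "prob_space M" and X: "X \<in> measurable M orthogonal_group"
    and haar: "normalized_haar (distr M orthogonal_group X)"
    and U: "orthogonal_matrix U"
  shows "distr M borel (\<lambda>\<omega>. X \<omega> ** U) = distr M borel X"
proof -
  interpret prob_space M by fact
  have XB [measurable]: "X \<in> borel_measurable M"
    and XO: "\<And>\<omega>. \<omega> \<in> space M \<Longrightarrow> orthogonal_matrix (X \<omega>)"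
    using X unfolding orthogonal_group_def by (auto simp: measurable_restrict_space2_iff)
  have "closed {A::real^'d^'d. orthogonal_matrix A}"
    unfolding orthogonal_matrix_def by (intro closed_Collect_conj closed_Collect_eq continuous_intros)
  then have [measurable]: "{A::real^'d^'d. orthogonal_matrix A} \<in> sets borel" by simp
  have id: "(\<lambda>A. A) \<in> measurable (orthogonal_group :: (real^'d^'d) measure) borel"
    unfolding orthogonal_group_def by (rule measurable_restrict_space1) simp
  have "distr (distr M borel X) borel (\<lambda>A. A ** U) = distr M borel X"
  proof (rule left_invariant_imp_right_invariant[OF _ _ _ _ U])
    show "prob_space (distr M borel X)" by (rule prob_space_distr) fact
    show "AE A in distr M borel X. orthogonal_matrix A"
      by (subst AE_distr_iff) (auto simp: XO)
    fix V :: "real^'d^'d" assume V: "orthogonal_matrix V"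
    let ?\<mu> = "distr M orthogonal_group X"
    have V1: "(\<lambda>A. V ** A) \<in> measurable (orthogonal_group :: (real^'d^'d) measure) orthogonal_group"
      unfolding orthogonal_group_def
      using V by (intro measurable_restrict_space2 measurable_restrict_space1)
        (auto simp: space_restrict_space orthogonal_matrix_mul)
    have "distr M borel X = distr (distr ?\<mu> ?\<mu> (\<lambda>A. V ** A)) borel (\<lambda>A. A)"
      using haar V X id unfolding normalized_haar_def by (simp add: distr_distr o_def)
    also have "\<dots> = distr M borel (\<lambda>\<omega>. V ** X \<omega>)"
      using X V1 id by (simp add: distr_distr o_def cong: distr_cong)
    finally have "distr M borel X = distr M borel (\<lambda>\<omega>. V ** X \<omega>)" .
    then show "distr (distr M borel X) borel (\<lambda>A. V ** A) = distr M borel X"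
      by (subst distr_distr) (auto simp: o_def)
  qed simp
  then show ?thesis by (simp add: distr_distr o_def)
qed

definition reflect_mat :: "real^'d \<Rightarrow> real^'d^'d" where
  "reflect_mat v = matrix (reflect v)"

lemma reflect_mat_mult [simp]: "reflect_mat v *v x = reflect v x"
  by (simp add: reflect_mat_def matrix_works linear_reflect)

lemma orthogonal_reflect_mat: "orthogonal_matrix (reflect_mat v)"
proof -
  have "orthogonal_transformation (reflect v)"
    by (simp add: orthogonal_transformation_def linear_reflect)
  then show ?thesis by (simp add: orthogonal_transformation_matrix reflect_mat_def)
qed

definition rot_at :: "'n \<Rightarrow> real^'d \<Rightarrow> real^'d^'d^'n \<Rightarrow> real^'d^'d^'n" where
  "rot_at i v q = (\<chi> l. if l = i then q $ l ** reflect_mat v else q $ l)"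

lemma vec_nth_measurable [measurable]: "(\<lambda>q::('b::euclidean_space)^'n. q $ i) \<in> borel_measurable borel"
  by (intro borel_measurable_continuous_onI continuous_intros)

lemma rot_at_measurable [measurable]: "rot_at (i::'n::finite) (v::real^'d) \<in> borel_measurable borel"
proof -
  have "(\<lambda>q. rot_at i v q) \<in> borel_measurable borel"
    unfolding rot_at_def
  proof (rule measurable_vec_lambda)
    fix l :: 'n
    show "(\<lambda>q::real^'d^'d^'n. if l = i then q $ l ** reflect_mat v else q $ l) \<in> borel_measurable borel"
      by (cases "l = i") auto
  qed
  then show ?thesis by simp
qed

lemma joint_law_rot_at:
  fixes Q :: "'n::finite \<Rightarrow> 'w \<Rightarrow> real^'d^'d"
  assumes "prob_space M"
    and indep: "prob_space.indep_vars M (\<lambda>_. orthogonal_group) Q UNIV"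
    and haar: "\<And>i. normalized_haar (distr M orthogonal_group (Q i))"
  shows "(\<lambda>\<omega>. \<chi> i. Q i \<omega>) \<in> borel_measurable M"
    and "distr (distr M borel (\<lambda>\<omega>. \<chi> i. Q i \<omega>)) borel (rot_at i v) = distr M borel (\<lambda>\<omega>. \<chi> i. Q i \<omega>)"
    and "\<omega> \<in> space M \<Longrightarrow> orthogonal_matrix (Q l \<omega>)"
proof -
  interpret prob_space M by fact
  have Q: "Q i \<in> measurable M orthogonal_group" for i
    using indep unfolding indep_vars_def by blast
  have QB [measurable]: "Q i \<in> borel_measurable M"
    and QO: "\<And>\<omega>. \<omega> \<in> space M \<Longrightarrow> orthogonal_matrix (Q i \<omega>)" for i
    using Q[of i] unfolding orthogonal_group_def by (auto simp: measurable_restrict_space2_iff)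
  show "\<omega> \<in> space M \<Longrightarrow> orthogonal_matrix (Q l \<omega>)" by (rule QO)
  show QV [measurable]: "(\<lambda>\<omega>. \<chi> i. Q i \<omega>) \<in> borel_measurable M"
    by (intro measurable_vec_lambda) simp
  let ?V = "\<lambda>f. \<chi> l. f l"
  have V [measurable]: "(?V :: ('n \<Rightarrow> real^'d^'d) \<Rightarrow> _) \<in> borel_measurable (Pi\<^sub>M UNIV (\<lambda>_. borel))"
    by (intro measurable_vec_lambda) simp
  define g where "g l = (\<lambda>A::real^'d^'d. if l = i then A ** reflect_mat v else A)" for l :: 'n
  have g [measurable]: "g l \<in> borel_measurable borel" for l
    unfolding g_def by (cases "l = i") (auto intro!: matrix_mult_measurable)
  have id: "(\<lambda>A. A) \<in> measurable (orthogonal_group :: (real^'d^'d) measure) borel"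
    unfolding orthogonal_group_def by (rule measurable_restrict_space1) simp
  have iQ: "indep_vars (\<lambda>_. borel) Q UNIV"
    using indep_vars_compose2[OF indep, of "\<lambda>_ A. A" "\<lambda>_. borel"] id by simp
  have igQ: "indep_vars (\<lambda>_. borel) (\<lambda>l \<omega>. g l (Q l \<omega>)) UNIV"
    using indep_vars_compose2[OF iQ, of g "\<lambda>_. borel"] by simp
  have law: "distr M borel (\<lambda>\<omega>. g l (Q l \<omega>)) = distr M borel (Q l)" for l
    using haar_right_invariant[OF \<open>prob_space M\<close> Q haar orthogonal_reflect_mat]
    by (cases "l = i") (simp_all add: g_def)
  have "distr M (Pi\<^sub>M UNIV (\<lambda>_. borel)) (\<lambda>\<omega>. \<lambda>l\<in>UNIV. g l (Q l \<omega>)) = Pi\<^sub>M UNIV (\<lambda>l. distr M borel (\<lambda>\<omega>. g l (Q l \<omega>)))"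
    using indep_vars_iff_distr_eq_PiM[where I=UNIV and M'="\<lambda>_. borel" and X="\<lambda>l \<omega>. g l (Q l \<omega>)"] igQ by simp
  also have "\<dots> = distr M (Pi\<^sub>M UNIV (\<lambda>_. borel)) (\<lambda>\<omega>. \<lambda>l\<in>UNIV. Q l \<omega>)"
    using indep_vars_iff_distr_eq_PiM[where I=UNIV and M'="\<lambda>_. borel" and X=Q] iQ by (simp add: law)
  finally have "distr (distr M (Pi\<^sub>M UNIV (\<lambda>_. borel)) (\<lambda>\<omega>. \<lambda>l\<in>UNIV. g l (Q l \<omega>))) borel ?V
    = distr (distr M (Pi\<^sub>M UNIV (\<lambda>_. borel)) (\<lambda>\<omega>. \<lambda>l\<in>UNIV. Q l \<omega>)) borel ?V" by simp
  then have "distr M borel (\<lambda>\<omega>. \<chi> l. g l (Q l \<omega>)) = distr M borel (\<lambda>\<omega>. \<chi> l. Q l \<omega>)"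
    by (simp add: distr_distr o_def) (simp add: restrict_def)
  moreover have "distr (distr M borel (\<lambda>\<omega>. \<chi> i. Q i \<omega>)) borel (rot_at i v) = distr M borel (\<lambda>\<omega>. rot_at i v (\<chi> i. Q i \<omega>))"
    by (subst distr_distr) (auto simp: o_def)
  moreover have "rot_at i v (\<chi> i. Q i \<omega>) = (\<chi> l. g l (Q l \<omega>))" for \<omega>
    by (simp add: rot_at_def g_def vec_eq_iff)
  ultimately show "distr (distr M borel (\<lambda>\<omega>. \<chi> i. Q i \<omega>)) borel (rot_at i v) = distr M borel (\<lambda>\<omega>. \<chi> i. Q i \<omega>)"
    by simp
qed

section \<open>Orthogonal projection and the splitting of a Gaussian vector\<close>

text \<open>
Projections of Borel sets need not be Borel, but the projection of a countable union of compact
sets is again one. All the measurability questions below concern sets of the form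
\<open>{a. \<exists>b. \<dots>}\<close> where the condition is closed, or the intersection of a closed and an open one.
\<close>

lemma borel_projection:
  fixes T O' :: "('a::euclidean_space \<times> 'b::euclidean_space) set"
  assumes "closed T" "open O'"
  shows "{a. \<exists>b. (a, b) \<in> T \<inter> O'} \<in> sets borel"
proof -
  obtain C :: "nat \<Rightarrow> ('a \<times> 'b) set" where C: "\<And>n. compact (C n)" "\<Union> (range C) = O'"
    using open_Union_compact_subsets[OF assms(2)] by metis
  have "{a. \<exists>b. (a, b) \<in> T \<inter> O'} = fst ` (T \<inter> O')"
    by (auto intro: rev_image_eqI)
  also have "\<dots> = (\<Union>n. fst ` (T \<inter> C n))" unfolding C(2)[symmetric] by blast
  finally have "{a. \<exists>b. (a, b) \<in> T \<inter> O'} = (\<Union>n. fst ` (T \<inter> C n))" .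
  moreover have "compact (fst ` (T \<inter> C n))" for n
    using C(1)[of n] assms(1) by (intro compact_continuous_image closed_Int_compact continuous_intros)
  ultimately show ?thesis by (auto simp: borel_compact)
qed

lemma closed_Collect_Ball:
  "(\<And>a. a \<in> A \<Longrightarrow> closed {x. Q a x}) \<Longrightarrow> closed {x. \<forall>a\<in>A. Q a x}"
  by (simp add: Collect_ball_eq closed_INT)

lemma polyhedral_cone_facts:
  assumes "polyhedral_cone P"
  shows "closed P" "cone P" "0 \<in> P"
proof -
  obtain A where A: "finite A" "P = {x. \<forall>a\<in>A. a \<bullet> x \<le> 0}"
    using assms unfolding polyhedral_cone_def by blast
  show "closed P" unfolding A(2)
    by (intro closed_Collect_Ball closed_Collect_le continuous_intros)
  show "cone P" unfolding A(2) cone_def by (auto simp: mult_nonneg_nonpos)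
  show "0 \<in> P" unfolding A(2) by simp
qed

lemma subspace_zero_set: "linear f \<Longrightarrow> subspace {y. f y = 0}"
  by (auto simp: subspace_def linear_add linear_scale linear_0)

text \<open>
Orthogonal projection onto \<open>L\<close>; it does not depend on the basis (\<open>oproj_unique\<close>).
\<close>

definition oproj :: "'a::euclidean_space set \<Rightarrow> 'a \<Rightarrow> 'a" where
  "oproj L y = (\<Sum>b\<in>(SOME B. orthonormal_basis_of B L). (y \<bullet> b) *\<^sub>R b)"

lemma linear_oproj: "linear (oproj L)"
  by (rule linearI) (simp_all add: oproj_def inner_add_left scaleR_add_left sum.distrib scaleR_sum_right)

lemma oproj_measurable [measurable]: "oproj L \<in> borel_measurable borel"
  using linear_continuous_on[OF linear_oproj[unfolded linear_conv_bounded_linear]]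
  by (rule borel_measurable_continuous_onI)

context
  fixes L :: "'a::euclidean_space set"
  assumes L: "subspace L"
begin

lemma onb_some: "orthonormal_basis_of (SOME B. orthonormal_basis_of B L) L"
  by (rule someI_ex, rule ex_orthonormal_basis_of) (rule L)

lemma oproj_in: "oproj L y \<in> L"
  unfolding oproj_def by (rule onb_sum_in[OF onb_some])

lemma oproj_perp: "l \<in> L \<Longrightarrow> (y - oproj L y) \<bullet> l = 0"
proof -
  let ?B = "SOME B. orthonormal_basis_of B L"
  assume "l \<in> L"
  then have l: "l = (\<Sum>b\<in>?B. (l \<bullet> b) *\<^sub>R b)" using onb_expand[OF onb_some] by simp
  have *: "(y - oproj L y) \<bullet> b = 0" if "b \<in> ?B" for b
    using onb_inner[OF onb_some that] by (simp add: oproj_def inner_diff_left)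
  have "(y - oproj L y) \<bullet> (\<Sum>b\<in>?B. (l \<bullet> b) *\<^sub>R b) = 0"
    by (simp add: inner_sum_right *)
  then show ?thesis using l by simp
qed

lemma oproj_unique:
  assumes "x \<in> L" "\<And>l. l \<in> L \<Longrightarrow> (y - x) \<bullet> l = 0"
  shows "oproj L y = x"
proof -
  let ?d = "x - oproj L y"
  have d: "?d \<in> L" using assms(1) oproj_in L by (simp add: subspace_diff)
  have "?d \<bullet> ?d = (y - oproj L y) \<bullet> ?d - (y - x) \<bullet> ?d" by (simp add: inner_diff_left)
  also have "\<dots> = 0" using oproj_perp[OF d] assms(2)[OF d] by simp
  finally show ?thesis by simp
qed

lemma oproj_self: "x \<in> L \<Longrightarrow> oproj L x = x"
  by (rule oproj_unique) auto

lemma diff_oproj_in: "y - oproj L y \<in> L\<^sup>\<bottom>"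
  using oproj_perp by (auto simp: orthogonal_comp_def orthogonal_def inner_commute)

lemma oproj_reflect: "v \<in> L \<Longrightarrow> oproj L (reflect v y) = reflect v (oproj L y)"
proof (rule oproj_unique)
  assume v: "v \<in> L"
  show "reflect v (oproj L y) \<in> L" using v oproj_in L by (simp add: reflect_in_subspace)
  fix l assume "l \<in> L"
  then have "reflect v l \<in> L" using v L by (simp add: reflect_in_subspace)
  then show "(reflect v y - reflect v (oproj L y)) \<bullet> l = 0"
    using oproj_perp[of "reflect v l" y]
    by (simp add: linear_diff[OF linear_reflect, symmetric] inner_reflect_commute)
qed

lemma oproj_reflect_perp: "v \<in> L\<^sup>\<bottom> \<Longrightarrow> oproj L (reflect v y) = oproj L y"
proof (rule oproj_unique)
  assume v: "v \<in> L\<^sup>\<bottom>"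
  then have vl: "l \<bullet> v = 0" if "l \<in> L" for l
    using that by (auto simp: orthogonal_comp_def orthogonal_def)
  show "oproj L y \<in> L" by (rule oproj_in)
  fix l assume l: "l \<in> L"
  have "(reflect v y - oproj L y) \<bullet> l = reflect v (y - oproj L y) \<bullet> l"
    using reflect_perp[OF vl[OF oproj_in]] by (simp add: linear_diff[OF linear_reflect])
  also have "\<dots> = (y - oproj L y) \<bullet> l"
    using reflect_perp[OF vl[OF l]] by (simp add: inner_reflect_commute)
  finally show "(reflect v y - oproj L y) \<bullet> l = 0" using oproj_perp[OF l] by simp
qed

lemma diff_oproj_reflect_perp: "v \<in> L\<^sup>\<bottom> \<Longrightarrow> reflect v y - oproj L (reflect v y) = reflect v (y - oproj L y)"
proof -
  assume v: "v \<in> L\<^sup>\<bottom>"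
  have "oproj L y \<bullet> v = 0"
    using v oproj_in by (auto simp: orthogonal_comp_def orthogonal_def)
  then show ?thesis using v by (simp add: oproj_reflect_perp linear_diff[OF linear_reflect] reflect_perp)
qed

lemma diff_oproj_reflect: "v \<in> L \<Longrightarrow> reflect v y - oproj L (reflect v y) = y - oproj L y"
proof -
  assume v: "v \<in> L"
  have "reflect v y - oproj L (reflect v y) = reflect v (y - oproj L y)"
    using v by (simp add: oproj_reflect linear_diff[OF linear_reflect])
  also have "\<dots> = y - oproj L y" by (rule reflect_perp) (rule oproj_perp[OF v])
  finally show ?thesis .
qed

text \<open>
The components of a Gaussian vector in \<open>L\<close> and \<open>L\<^sup>\<bottom>\<close> are independent Gaussian vectors. For
cones this follows from the invariance of the Gaussian measure under reflections along vectors
of \<open>L\<close> and of \<open>L\<^sup>\<bottom>\<close>, each of which affects only one component.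
\<close>

lemma gaussian_split:
  assumes X: "X \<subseteq> L" "cone X" "X \<in> sets borel"
    and Y: "Y \<subseteq> L\<^sup>\<bottom>" "cone Y" "Y \<in> sets borel"
  shows "measure (std_gaussian L) X * measure (std_gaussian (L\<^sup>\<bottom>)) Y
     = measure (std_gaussian UNIV) {y. \<exists>x\<in>X. y - x \<in> Y}"
proof -
  interpret G: prob_space "std_gaussian (UNIV :: 'a set)"
    by (rule prob_space_std_gaussian) simp
  let ?u = "\<lambda>b y. if b then oproj L y else y - oproj L y"
  let ?\<Lambda> = "\<lambda>b. if b then L else L\<^sup>\<bottom>"
  let ?K = "\<lambda>b. if b then X else Y"
  have Lp: "subspace (L\<^sup>\<bottom>)" by (rule subspace_orthogonal_comp)
  have "G.prob {y \<in> space (std_gaussian UNIV). \<forall>b\<in>UNIV. ?u b y \<in> ?K b}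
    = (\<Prod>b\<in>UNIV. measure (std_gaussian (?\<Lambda> b)) (?K b))"
  proof (rule G.prob_cones_of_rotation_invariant)
    fix b :: bool
    show "?u b \<in> borel_measurable (std_gaussian UNIV)" by (cases b) auto
    show "AE y in std_gaussian UNIV. ?u b y \<in> ?\<Lambda> b" using oproj_in diff_oproj_in by auto
    show "AE y in std_gaussian UNIV. ?u b y \<noteq> 0" if "?\<Lambda> b \<noteq> {0}"
    proof -
      have lin: "linear (?u b)"
        using linear_oproj[of L] linear_compose_sub[OF linear_id linear_oproj[of L]] by (cases b) (auto simp: id_def)
      have "subspace {y. ?u b y = 0}" using subspace_zero_set[OF lin] .
      moreover have "\<not> UNIV \<subseteq> {y. ?u b y = 0}"
      proof
        assume "UNIV \<subseteq> {y. ?u b y = 0}"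
        then have *: "?u b y = 0" for y by auto
        have "y = 0" if y: "y \<in> ?\<Lambda> b" for y
        proof (cases b)
          case True then show ?thesis using *[of y] oproj_self y by simp
        next
          case False
          then have "y = oproj L y" "y \<in> L\<^sup>\<bottom>" using *[of y] y by auto
          then have "y \<in> L" "y \<in> L\<^sup>\<bottom>" using oproj_in[of y] by auto
          then show ?thesis by (auto simp: orthogonal_comp_def orthogonal_def)
        qed
        moreover have "0 \<in> ?\<Lambda> b" using subspace_0[OF L] subspace_0[OF Lp] by simp
        ultimately show False using that by blast
      qed
      ultimately show ?thesis using AE_std_gaussian_not_in[OF subspace_UNIV, of "{y. ?u b y = 0}"] by auto
    qed
    fix v assume v: "v \<in> ?\<Lambda> b"
    show "\<exists>\<tau>. \<tau> \<in> measurable (std_gaussian UNIV) (std_gaussian UNIV) \<and> distr (std_gaussian UNIV) (std_gaussian UNIV) \<tau> = std_gaussian UNIV \<and>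
        (AE y in std_gaussian UNIV. ?u b (\<tau> y) = reflect v (?u b y)) \<and> (\<forall>l\<in>UNIV - {b}. AE y in std_gaussian UNIV. ?u l (\<tau> y) = ?u l y)"
    proof (intro exI conjI)
      show "reflect v \<in> measurable (std_gaussian UNIV) (std_gaussian UNIV)" by simp
      have "distr (std_gaussian UNIV) (std_gaussian UNIV) (reflect v) = distr (std_gaussian UNIV) borel (reflect v)"
        by (rule distr_cong) auto
      then show "distr (std_gaussian UNIV) (std_gaussian UNIV) (reflect v) = std_gaussian UNIV"
        using std_gaussian_reflect[OF subspace_UNIV, of v] by simp
      show "AE y in std_gaussian UNIV. ?u b (reflect v y) = reflect v (?u b y)"
        using v oproj_reflect diff_oproj_reflect_perp by (cases b) auto
      show "\<forall>l\<in>UNIV - {b}. AE y in std_gaussian UNIV. ?u l (reflect v y) = ?u l y"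
        using v oproj_reflect_perp diff_oproj_reflect by (cases b) auto
    qed
  qed (use X Y L Lp in \<open>auto split: if_splits\<close>)
  also have "{y \<in> space (std_gaussian UNIV). \<forall>b\<in>UNIV. ?u b y \<in> ?K b} = {y. \<exists>x\<in>X. y - x \<in> Y}"
  proof (intro set_eqI iffI)
    fix y assume "y \<in> {y \<in> space (std_gaussian UNIV). \<forall>b\<in>UNIV. ?u b y \<in> ?K b}"
    then show "y \<in> {y. \<exists>x\<in>X. y - x \<in> Y}" by (auto simp: UNIV_bool)
  next
    fix y assume "y \<in> {y. \<exists>x\<in>X. y - x \<in> Y}"
    then obtain x where x: "x \<in> X" "y - x \<in> Y" by auto
    then have "oproj L y = x"
      using X(1) Y(1) by (intro oproj_unique) (auto simp: orthogonal_comp_def orthogonal_def subset_iff inner_commute)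
    then show "y \<in> {y \<in> space (std_gaussian UNIV). \<forall>b\<in>UNIV. ?u b y \<in> ?K b}"
      using x by (simp add: UNIV_bool)
  qed
  finally show ?thesis by (simp add: UNIV_bool mult.commute)
qed

end

section \<open>Faces of the linear image of a polyhedral cone\<close>

text \<open>
The normal cone of \<open>A P\<close> along \<open>A H\<close>. Parametrising it by subsets \<open>H\<close> of \<open>P\<close> instead of faces
of \<open>A P\<close> fixes the index set while the map \<open>A\<close> varies.
\<close>

definition normals :: "('b::euclidean_space \<Rightarrow> 'a::euclidean_space) \<Rightarrow> 'b set \<Rightarrow> 'b set \<Rightarrow> 'a set" where
  "normals A P H = {z. (\<forall>p\<in>P. A p \<bullet> z \<le> 0) \<and> (\<forall>h\<in>H. A h \<bullet> z = 0)}"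

definition region :: "('b::euclidean_space \<Rightarrow> 'a::euclidean_space) \<Rightarrow> 'b set \<Rightarrow> 'b set \<Rightarrow> 'a set" where
  "region A P H = {y. \<exists>x\<in>H. y - A x \<in> normals A P H}"

text \<open>
\<open>H\<close> is the full preimage in \<open>P\<close> of a face of \<open>A P\<close>.
\<close>

definition exposed :: "('b::euclidean_space \<Rightarrow> 'a::euclidean_space) \<Rightarrow> 'b set \<Rightarrow> 'b set \<Rightarrow> bool" where
  "exposed A P H \<longleftrightarrow> (\<exists>z. (\<forall>p\<in>P. A p \<bullet> z \<le> 0) \<and> {p\<in>P. A p \<bullet> z = 0} = H)"

lemma exposed_imp_cone_face:
  assumes "linear A" "exposed A P H"
  shows "cone_face H P"
proof -
  obtain z where "\<forall>p\<in>P. A p \<bullet> z \<le> 0" "{p\<in>P. A p \<bullet> z = 0} = H"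
    using assms(2) unfolding exposed_def by blast
  then show ?thesis unfolding cone_face_def
    by (intro exI[of _ "adjoint A z"]) (auto simp: adjoint_works[OF assms(1)])
qed

lemma exposed_id: "exposed (\<lambda>x. x) P H \<longleftrightarrow> cone_face H P"
  by (auto simp: exposed_def cone_face_def)

lemma span_orthogonal: "x \<in> span S \<Longrightarrow> (\<And>s. s \<in> S \<Longrightarrow> s \<bullet> z = 0) \<Longrightarrow> x \<bullet> z = 0"
  using orthogonal_to_span[of x S z] by (auto simp: orthogonal_def inner_commute)

lemma cone_face_Int_span: "cone_face H P \<Longrightarrow> P \<inter> span H = H"
  unfolding cone_face_def using span_orthogonal[of _ H] by (fastforce intro: span_base)

lemma cone_face_closed_cone:
  assumes "polyhedral_cone P" "cone_face H P"
  shows "closed H" "cone H" "0 \<in> H" "H \<subseteq> P"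
proof -
  obtain z where H: "H = {x\<in>P. x \<bullet> z = 0}" using assms(2) unfolding cone_face_def by blast
  then have "H = P \<inter> {x. x \<bullet> z = 0}" by auto
  then show "closed H"
    using polyhedral_cone_facts(1)[OF assms(1)] by (auto intro!: closed_Int closed_Collect_eq continuous_intros)
  show "cone H" "0 \<in> H" "H \<subseteq> P"
    using polyhedral_cone_facts(2,3)[OF assms(1)] by (auto simp: H cone_def)
qed

lemma finite_cone_faces:
  assumes "polyhedral_cone P"
  shows "finite {H. cone_face H P}"
proof (rule finite_subset)
  show "{H. cone_face H P} \<subseteq> (\<lambda>L. P \<inter> L) ` (\<Union>k\<le>DIM('a). face_spans k P)"
  proof clarify
    fix H assume H: "cone_face H P"
    then have "span H \<in> face_spans (dim (span H)) P" unfolding face_spans_def by auto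
    moreover have "dim (span H) \<le> DIM('a)" by (rule dim_subset_UNIV)
    ultimately show "H \<in> (\<lambda>L. P \<inter> L) ` (\<Union>k\<le>DIM('a). face_spans k P)"
      using cone_face_Int_span[OF H] by (intro image_eqI[of _ _ "span H"]) auto
  qed
qed (use finite_face_spans[OF assms] in auto)

text \<open>
A face of \<open>A P\<close> is determined by its preimage in \<open>P\<close> and by its span, so the spans of
\<open>j\<close>-dimensional faces of the image correspond to the exposed faces of \<open>P\<close> with \<open>j\<close>-dimensional
image. The two Gaussian factors of a summand are merged into one by \<open>gaussian_split\<close>.
\<close>

lemma conic_intrinsic_volume_linear_image:
  fixes A :: "'b::euclidean_space \<Rightarrow> 'a::euclidean_space"
  assumes A: "linear A" and P: "polyhedral_cone P"
  shows "conic_intrinsic_volume j (A ` P) =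
    (\<Sum>H | exposed A P H \<and> dim (span (A ` H)) = j. measure (std_gaussian UNIV) (region A P H))"
proof -
  let ?S = "{H. exposed A P H \<and> dim (span (A ` H)) = j}"
  let ?f = "\<lambda>H. span (A ` H)"
  let ?t = "\<lambda>L. measure (std_gaussian L) (A ` P \<inter> L) *
        measure (std_gaussian (L\<^sup>\<bottom>)) (polar_cone (A ` P) \<inter> L\<^sup>\<bottom>)"
  have mem: "p \<in> H" if "exposed A P H" "p \<in> P" "A p \<in> span (A ` H)" for H p
  proof -
    obtain z where z: "{p\<in>P. A p \<bullet> z = 0} = H" using \<open>exposed A P H\<close> unfolding exposed_def by blast
    then have "A p \<bullet> z = 0" using that(3) by (intro span_orthogonal[of "A p" "A ` H"]) auto
    then show ?thesis using z that(2) by auto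
  qed
  have sub: "H \<subseteq> P" if "exposed A P H" for H using that unfolding exposed_def by auto
  have bij: "bij_betw ?f ?S (face_spans j (A ` P))"
    unfolding bij_betw_def
  proof
    show "inj_on ?f ?S"
    proof (rule inj_onI)
      fix H H' assume HH: "H \<in> ?S" "H' \<in> ?S" "?f H = ?f H'"
      have e: "H = {p\<in>P. A p \<in> ?f H}" if "H \<in> ?S" for H
        using that mem[of H] sub[of H] by (auto intro: span_base)
      have "H = {p\<in>P. A p \<in> ?f H'}" using e[OF HH(1)] unfolding HH(3) .
      also have "\<dots> = H'" by (rule e[OF HH(2), symmetric])
      finally show "H = H'" .
    qed
    show "?f ` ?S = face_spans j (A ` P)"
    proof (intro equalityI subsetI)
      fix L assume "L \<in> ?f ` ?S"
      then obtain H where H: "L = ?f H" "exposed A P H" "dim (?f H) = j" by auto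
      then obtain z where z: "\<forall>p\<in>P. A p \<bullet> z \<le> 0" "{p\<in>P. A p \<bullet> z = 0} = H"
        unfolding exposed_def by blast
      have "A ` H = {s \<in> A ` P. s \<bullet> z = 0}" using z(2) by auto
      then have "cone_face (A ` H) (A ` P)" using z(1) unfolding cone_face_def by auto
      then show "L \<in> face_spans j (A ` P)" using H unfolding face_spans_def by auto
    next
      fix L assume "L \<in> face_spans j (A ` P)"
      then obtain F where F: "L = span F" "cone_face F (A ` P)" "dim (span F) = j"
        unfolding face_spans_def by auto
      then obtain z where z: "\<forall>s\<in>A ` P. s \<bullet> z \<le> 0" "F = {s \<in> A ` P. s \<bullet> z = 0}"
        unfolding cone_face_def by blast
      let ?H = "{p\<in>P. A p \<bullet> z = 0}"
      have "A ` ?H = F" using z by auto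
      moreover have "exposed A P ?H" using z(1) unfolding exposed_def by auto
      ultimately show "L \<in> ?f ` ?S" using F by (intro image_eqI[of _ _ ?H]) auto
    qed
  qed
  have "conic_intrinsic_volume j (A ` P) = (\<Sum>H\<in>?S. ?t (?f H))"
    unfolding conic_intrinsic_volume_def by (rule sum.reindex_bij_betw[OF bij, symmetric])
  also have "\<dots> = (\<Sum>H\<in>?S. measure (std_gaussian UNIV) (region A P H))"
  proof (rule sum.cong[OF HOL.refl])
    fix H assume "H \<in> ?S"
    then have H: "exposed A P H" by simp
    let ?L = "?f H"
    note cf = cone_face_closed_cone[OF P exposed_imp_cone_face[OF A H]]
    have 1: "A ` P \<inter> ?L = A ` H"
      using mem[OF H] sub[OF H] by (auto intro: span_base)
    have 2: "polar_cone (A ` P) \<inter> ?L\<^sup>\<bottom> = normals A P H"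
    proof (intro set_eqI iffI)
      fix z assume "z \<in> polar_cone (A ` P) \<inter> ?L\<^sup>\<bottom>"
      then show "z \<in> normals A P H"
        by (auto simp: polar_cone_def normals_def orthogonal_comp_def orthogonal_def span_base)
    next
      fix z assume z: "z \<in> normals A P H"
      then have "x \<bullet> z = 0" if "x \<in> ?L" for x
        by (intro span_orthogonal[OF that]) (auto simp: normals_def)
      then show "z \<in> polar_cone (A ` P) \<inter> ?L\<^sup>\<bottom>"
        using z by (auto simp: polar_cone_def normals_def orthogonal_comp_def orthogonal_def)
    qed
    have "measure (std_gaussian ?L) (A ` H) * measure (std_gaussian (?L\<^sup>\<bottom>)) (normals A P H)
      = measure (std_gaussian UNIV) {y. \<exists>x\<in>A ` H. y - x \<in> normals A P H}"
    proof (rule gaussian_split)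
      show "A ` H \<subseteq> ?L" by (auto intro: span_base)
      show "cone (A ` H)" using cf(2) A by (auto simp: cone_def linear_scale[symmetric])
      define T where "T = {p :: 'a \<times> 'b. snd p \<in> H \<and> fst p = A (snd p)}"
      have Tm: "(a, b) \<in> T \<longleftrightarrow> b \<in> H \<and> a = A b" for a b by (simp add: T_def)
      have "continuous_on UNIV A"
        using A by (simp add: linear_continuous_on linear_conv_bounded_linear)
      then have "continuous_on UNIV (\<lambda>p :: 'a \<times> 'b. A (snd p))"
        by (rule continuous_on_compose2[OF _ continuous_on_snd[OF continuous_on_id]]) auto
      moreover have "closed {p :: 'a \<times> 'b. snd p \<in> H}"
        using closed_vimage_snd[OF cf(1)] by (simp add: vimage_def)
      ultimately have "closed T"
        unfolding T_def by (intro closed_Collect_conj closed_Collect_eq continuous_intros)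
      from borel_projection[OF this open_UNIV]
      have "{a. \<exists>b. (a, b) \<in> T \<inter> UNIV} \<in> sets borel" .
      moreover have "{a. \<exists>b. (a, b) \<in> T \<inter> UNIV} = A ` H"
        unfolding Int_UNIV_right Tm by blast
      ultimately show "A ` H \<in> sets borel" by metis
      show "normals A P H \<subseteq> ?L\<^sup>\<bottom>" using 2 by auto
      show "cone (normals A P H)" by (auto simp: cone_def normals_def mult_nonneg_nonpos)
      have "closed (normals A P H)" unfolding normals_def
        by (intro closed_Collect_conj closed_Collect_Ball closed_Collect_le closed_Collect_eq continuous_intros)
      then show "normals A P H \<in> sets borel" by simp
    qed simp
    also have "{y. \<exists>x\<in>A ` H. y - x \<in> normals A P H} = region A P H"
      by (auto simp: region_def)
    finally show "?t ?L = measure (std_gaussian UNIV) (region A P H)" by (simp only: 1 2)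
  qed
  finally show ?thesis .
qed

text \<open>
The region lies in the sum of the span of \<open>A H\<close> and the span of the normals along \<open>A H\<close>. If this
sum is the whole space, then a sum of finitely many spanning normals exposes a
face whose image lies in the span of \<open>A H\<close>. In general position that face is no larger than \<open>H\<close>, so \<open>H\<close> is exposed.
Otherwise the region lies in a proper subspace.
\<close>

lemma measure_region_zero:
  fixes A :: "'b::euclidean_space \<Rightarrow> 'a::euclidean_space"
  assumes A: "linear A" and P: "polyhedral_cone P" and j: "dim H < DIM('a)"
    and generic: "\<And>H. cone_face H P \<Longrightarrow> dim (A ` H) = min (DIM('a)) (dim H)"
    and H: "cone_face H P" "\<not> exposed A P H"
  shows "measure (std_gaussian UNIV) (region A P H) = 0"
proof -
  let ?D = "normals A P H"
  let ?W = "span (A ` H \<union> ?D)"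
  have "?W \<noteq> UNIV"
  proof
    assume W: "?W = UNIV"
    obtain B where B: "B \<subseteq> ?D" "finite B" "span B = span ?D"
    proof -
      obtain B where "B \<subseteq> ?D" "independent B" "?D \<subseteq> span B"
        using maximal_independent_subset by metis
      then show ?thesis using that[of B] by (metis independent_imp_finite span_mono span_span subset_antisym)
    qed
    \<comment> \<open>a point of \<open>P\<close> is orthogonal to \<open>z\<close> only if it is orthogonal to each summand, since all the inner products are nonpositive\<close>
    define z where "z = (\<Sum>b\<in>B. b)"
    have zP: "A p \<bullet> z = (\<Sum>b\<in>B. A p \<bullet> b)" for p by (simp add: z_def inner_sum_right)
    have Bn: "A p \<bullet> b \<le> 0" if "p \<in> P" "b \<in> B" for p b using B(1) that by (auto simp: normals_def)
    have z1: "\<forall>p\<in>P. A p \<bullet> z \<le> 0" using Bn by (auto simp: zP intro: sum_nonpos)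
    define H' where "H' = {p\<in>P. A p \<bullet> z = 0}"
    have ex: "exposed A P H'" using z1 unfolding exposed_def H'_def by auto
    have cf: "cone_face H' P" by (rule exposed_imp_cone_face[OF A ex])
    have HH': "H \<subseteq> H'" using B(1) cone_face_closed_cone(4)[OF P H(1)] by (auto simp: H'_def zP normals_def intro!: sum.neutral)
    have sub: "A p \<in> span (A ` H)" if "p \<in> H'" for p
    proof -
      have "A p \<bullet> b = 0" if "b \<in> B" for b
      proof -
        have "(\<Sum>b\<in>B. A p \<bullet> b) = 0" "p \<in> P" using \<open>p \<in> H'\<close> by (auto simp: H'_def zP)
        then show ?thesis 
          using sum_nonneg_eq_0_iff[of B "\<lambda>b. - (A p \<bullet> b)"] Bn B(2) that by (simp add: sum_negf)
      qed
      then have pD: "d \<bullet> A p = 0" if "d \<in> span ?D" for d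
        using that unfolding B(3)[symmetric] by (intro span_orthogonal[of d B]) (auto simp: inner_commute)
      obtain l d where ld: "A p = l + d" "l \<in> span (A ` H)" "d \<in> span ?D"
      proof -
        have "A p \<in> {x + y |x y. x \<in> span (A ` H) \<and> y \<in> span ?D}"
          unfolding span_Un[symmetric] W by simp
        then show ?thesis using that by blast
      qed
      have "l \<bullet> d = 0"
      proof (rule span_orthogonal[OF ld(2)])
        fix s assume s: "s \<in> A ` H"
        have "d \<bullet> s = 0" using s by (intro span_orthogonal[OF ld(3)]) (auto simp: normals_def inner_commute)
        then show "s \<bullet> d = 0" by (simp add: inner_commute)
      qed
      moreover have "d \<bullet> (l + d) = 0" using pD[OF ld(3)] ld(1) by simp
      ultimately have "d = 0" by (simp add: inner_add_right inner_commute)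
      then show ?thesis using ld by simp
    qed
    have "dim (A ` H') \<le> dim (span (A ` H))" using sub by (intro dim_subset) auto
    then have "dim H' \<le> dim H" using generic[OF cf] generic[OF H(1)] j by simp
    then have "span H = span H'"
      using dim_eq_span[OF HH'] by simp
    then have "H = H'" using cone_face_Int_span[OF cf] cone_face_Int_span[OF H(1)] by metis
    then show False using ex H(2) by simp
  qed
  then have "AE y in std_gaussian UNIV. y \<notin> ?W"
    by (intro AE_std_gaussian_not_in) auto
  moreover have Wb: "?W \<in> sets borel" by (simp add: borel_closed closed_subspace)
  ultimately have "measure (std_gaussian UNIV) ?W = 0"
    by (subst (asm) AE_iff_measurable[of ?W]) (auto simp: measure_def)
  moreover have "region A P H \<subseteq> ?W"
  proof
    fix y assume "y \<in> region A P H"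
    then obtain x where x: "x \<in> H" "y - A x \<in> ?D" by (auto simp: region_def)
    then have "A x + (y - A x) \<in> ?W" by (intro span_add) (auto intro: span_base)
    then show "y \<in> ?W" by simp
  qed
  moreover have "finite_measure (std_gaussian (UNIV :: 'a set))"
    using prob_space_std_gaussian[OF subspace_UNIV] prob_space.finite_measure by blast
  ultimately show ?thesis
    using finite_measure.finite_measure_mono[of "std_gaussian UNIV" "region A P H" ?W] Wb
    by (metis measure_le_0_iff sets_std_gaussian)
qed

text \<open>
For \<open>j < d\<close> the rank condition makes the dimension of a face equal to \<open>j\<close> as soon as that of its
image is, so the exposed faces with \<open>j\<close>-dimensional image are among the \<open>j\<close>-dimensional
faces of \<open>P\<close>, and the additional terms vanish.
\<close>

lemma conic_intrinsic_volume_generic_image: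
  fixes A :: "'b::euclidean_space \<Rightarrow> 'a::euclidean_space"
  assumes A: "linear A" and P: "polyhedral_cone P" and j: "j < DIM('a)"
    and generic: "\<And>H. cone_face H P \<Longrightarrow> dim (A ` H) = min (DIM('a)) (dim H)"
  shows "conic_intrinsic_volume j (A ` P) =
    (\<Sum>H | cone_face H P \<and> dim H = j. measure (std_gaussian UNIV) (region A P H))"
  unfolding conic_intrinsic_volume_linear_image[OF A P]
proof (rule sum.mono_neutral_left)
  show "finite {H. cone_face H P \<and> dim H = j}" using finite_cone_faces[OF P] by simp
  show "{H. exposed A P H \<and> dim (span (A ` H)) = j} \<subseteq> {H. cone_face H P \<and> dim H = j}"
    using exposed_imp_cone_face[OF A] generic j by (fastforce simp: min_def split: if_splits)
  show "\<forall>H\<in>{H. cone_face H P \<and> dim H = j} - {H. exposed A P H \<and> dim (span (A ` H)) = j}.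
       measure (std_gaussian UNIV) (region A P H) = 0"
    using measure_region_zero[OF A P _ generic] generic j by auto
qed

lemma conic_intrinsic_volume_regions:
  fixes P :: "'a::euclidean_space set"
  assumes P: "polyhedral_cone P"
  shows "conic_intrinsic_volume j P =
    (\<Sum>H | cone_face H P \<and> dim H = j. measure (std_gaussian UNIV) (region (\<lambda>x. x) P H))"
  using conic_intrinsic_volume_linear_image[OF linear_ident P, of j]
  by (simp add: exposed_id)

section \<open>General position of sums of rotated cones\<close>

definition rot_sum :: "('n::finite \<Rightarrow> real^'d^'d) \<Rightarrow> real^'d^'d^'n \<Rightarrow> real^'d^'n \<Rightarrow> real^'d" where
  "rot_sum T q x = (\<Sum>i\<in>UNIV. T i *v (q $ i *v x $ i))"

lemma linear_rot_sum: "linear (rot_sum T q)"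
  by (rule linearI)
    (simp_all add: rot_sum_def matrix_vector_right_distrib sum.distrib scaleR_sum_right
      matrix_vector_mult_scaleR)

lemma continuous_on_rot_sum [continuous_intros]:
  assumes "continuous_on S f" "continuous_on S g"
  shows "continuous_on S (\<lambda>x. rot_sum T (f x) (g x))"
  unfolding rot_sum_def by (intro continuous_intros assms)

lemma rot_sum_axis: "rot_sum T q (axis i b) = T i *v (q $ i *v b)"
proof -
  have "rot_sum T q (axis i b) = (\<Sum>l\<in>UNIV. if l = i then T i *v (q $ i *v b) else 0)"
    unfolding rot_sum_def by (intro sum.cong) (auto simp: axis_def)
  then show ?thesis by simp
qed

lemma reflect_axis_nth: "reflect (axis i v) x $ l = (if l = i then reflect v (x $ i) else x $ l)"
proof -
  have "reflect (axis i v) x $ l = x $ l - (2 * (x $ i \<bullet> v) / (v \<bullet> v)) *\<^sub>R (axis i v $ l)"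
    by (simp add: reflect_def inner_axis inner_axis_axis)
  then show ?thesis by (auto simp: axis_def reflect_def)
qed

lemma reflect_axis_axis: "reflect (axis i v) (axis i w) = axis i (reflect v w)"
  by (simp add: vec_eq_iff reflect_axis_nth) (simp add: axis_def)

lemma rot_sum_rot_at: "rot_sum T (rot_at i v q) x = rot_sum T q (reflect (axis i v) x)"
  unfolding rot_sum_def
  by (intro sum.cong) (auto simp: rot_at_def reflect_axis_nth matrix_vector_mul_assoc[symmetric])

lemma sum_axis: "(\<Sum>i\<in>UNIV. axis i (x $ i)) = (x :: 'b::comm_monoid_add ^ 'n::finite)"
  by (simp add: vec_eq_iff axis_def if_distrib cong: if_cong)

lemma linear_axis: "linear (axis i :: 'b::real_vector \<Rightarrow> 'b ^ 'n)"
  by (rule linearI) (simp_all add: vec_eq_iff axis_def)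

lemma subspace_rot_sum_axis_span:
  "subspace {u. rot_sum T q (axis i u) \<in> span S}"
proof -
  have "linear (\<lambda>u. T i *v (q $ i *v u))"
    by (rule linearI) (simp_all add: matrix_vector_right_distrib matrix_vector_mult_scaleR)
  from linear_subspace_linear_preimage[OF this subspace_span] show ?thesis
    by (simp add: rot_sum_axis)
qed

text \<open>
Left-invariance and independence of the rotations are used only through the invariance of their joint law
under \<^const>\<open>rot_at\<close>.
\<close>

locale random_rotations = prob_space N
  for N :: "(real^'d^'d^'n) measure" +
  fixes T :: "'n::finite \<Rightarrow> real^'d^'d"
  assumes sets_N [simp, measurable_cong]: "sets N = sets borel"
    and AE_orth: "AE q in N. \<forall>i. orthogonal_matrix (q $ i)"
    and rot_inv: "\<And>i v. distr N borel (rot_at i v) = N"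
    and T_inv: "\<And>i. invertible (T i)"
begin

lemma space_N [simp]: "space N = UNIV"
  using sets_eq_imp_space_eq[OF sets_N] by simp

lemma surj_block: "orthogonal_matrix (q $ i) \<Longrightarrow> \<exists>u. T i *v (q $ i *v u) = w"
proof -
  assume q: "orthogonal_matrix (q $ i)"
  obtain S where S: "T i ** S = mat 1" using T_inv[of i] unfolding invertible_def by blast
  have "q $ i ** transpose (q $ i) = mat 1" using q by (simp add: orthogonal_matrix_def)
  then have "T i *v (q $ i *v (transpose (q $ i) *v (S *v w))) = w"
    using S by (simp add: matrix_vector_mul_assoc matrix_mul_assoc[symmetric])
      (simp add: matrix_mul_assoc)
  then show ?thesis by blast
qed

text \<open>
Replacing \<open>q\<^sub>i\<close> by its product with a reflection that fixes the vectors of \<open>J\<close> shows that the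
probability of linear dependence is the same for all nonzero \<open>u\<close> in the subspace \<open>\<Lambda>\<close> instead of \<open>b\<close>. Averaged
over a Gaussian \<open>u\<close> in \<open>\<Lambda>\<close> it vanishes, since for each \<open>q\<close> the bad \<open>u\<close> form a subspace that does not
contain \<open>\<Lambda>\<close>: otherwise the image of \<open>J\<close>, of fewer than \<open>d\<close> vectors, would span the whole space.
\<close>

lemma generic_independent_step:
  fixes J :: "(real^'d^'n) set"
  assumes J: "finite J" "card J < CARD('d)" "\<And>y. y \<in> J \<Longrightarrow> \<exists>i b. y = axis i b"
    and b: "b \<noteq> 0" "\<And>y. y \<in> J \<Longrightarrow> y \<bullet> axis i b = 0"
  shows "AE q in N. rot_sum T q (axis i b) \<notin> span (rot_sum T q ` J)"
proof -
  define \<Lambda> where "\<Lambda> = {u. \<forall>y\<in>J. y \<bullet> axis i u = 0}"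
  have ax: "axis i (u + v) = axis i u + axis i v" "axis i (c *\<^sub>R u) = c *\<^sub>R axis i u" "axis i (0 :: real^'d) = 0" for u v :: "real^'d" and c
    by (simp_all add: vec_eq_iff axis_def)
  have L: "subspace \<Lambda>"
    unfolding \<Lambda>_def subspace_def by (auto simp: ax inner_add_right)
  define bad where "bad q u \<longleftrightarrow> rot_sum T q (axis i u) \<in> span (rot_sum T q ` J)" for q u
  have bad_span: "bad q u \<longleftrightarrow> (\<exists>x. x \<in> span J \<and> rot_sum T q (axis i u) = rot_sum T q x)" for q u
    unfolding bad_def linear_span_image[OF linear_rot_sum] by (simp add: image_iff Bex_def)
  define Z where "Z = {p :: ((real^'d^'d^'n) \<times> (real^'d)) \<times> (real^'d^'n). snd p \<in> span J \<and>
      rot_sum T (fst (fst p)) (axis i (snd (fst p))) = rot_sum T (fst (fst p)) (snd p)}"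
  have cax: "continuous_on S (\<lambda>x. axis i (f x))" if "continuous_on S f" for S and f :: "'z::topological_space \<Rightarrow> real^'d"
    unfolding axis_def
  proof (rule continuous_on_vec_lambda)
    fix l show "continuous_on S (\<lambda>x. if l = i then f x else 0)"
      using that by (cases "l = i") auto
  qed
  have "closed {p :: ((real^'d^'d^'n) \<times> (real^'d)) \<times> (real^'d^'n). snd p \<in> span J}"
    using closed_vimage_snd[OF closed_subspace[OF subspace_span[of J]]] by (simp add: vimage_def)
  then have "closed Z"
    unfolding Z_def by (intro closed_Collect_conj closed_Collect_eq continuous_intros cax)
  from borel_projection[OF this open_UNIV]
  have Bad: "{p. bad (fst p) (snd p)} \<in> sets borel"
    by (simp add: Z_def bad_span)
  then have Bad' [measurable]: "Measurable.pred (borel \<Otimes>\<^sub>M borel) (\<lambda>p. bad (fst p) (snd p))"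
    by (simp add: pred_def borel_prod)
  have sect [measurable]: "{q. bad q u} \<in> sets borel" for u
    using measurable_compose[OF measurable_Pair2'[of u borel borel] Bad'] by (simp add: pred_def)
  interpret G: prob_space "std_gaussian \<Lambda>" by (rule prob_space_std_gaussian[OF L])
  interpret pair_sigma_finite N "std_gaussian \<Lambda>" ..
  have const: "emeasure N {q. bad q u} = emeasure N {q. bad q b}" if u: "u \<in> \<Lambda>" "u \<noteq> 0" for u
  proof -
    \<comment> \<open>rescaling makes \<open>u\<close> as long as \<open>b\<close>, so that a reflection along a vector of \<open>\<Lambda>\<close> carries \<open>b\<close> to it\<close>
    define r where "r = norm b / norm u"
    have r: "r \<noteq> 0" using u b by (simp add: r_def)
    define u' where "u' = r *\<^sub>R u"
    have "norm b = norm u'" using u by (simp add: u'_def r_def)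
    then have rb: "reflect (b - u') b = u'" by (rule reflect_swaps)
    have bL: "b \<in> \<Lambda>" using b by (simp add: \<Lambda>_def)
    then have vL: "b - u' \<in> \<Lambda>" using u L by (simp add: u'_def subspace_diff subspace_scale)
    have Jfix: "rot_sum T (rot_at i (b - u') q) ` J = rot_sum T q ` J" for q
    proof (rule image_cong[OF HOL.refl])
      fix y assume "y \<in> J"
      then have "reflect (axis i (b - u')) y = y" using vL by (intro reflect_perp) (auto simp: \<Lambda>_def)
      then show "rot_sum T (rot_at i (b - u') q) y = rot_sum T q y" by (simp add: rot_sum_rot_at)
    qed
    have "bad (rot_at i (b - u') q) b \<longleftrightarrow> bad q u'" for q
      unfolding bad_def Jfix by (simp add: rot_sum_rot_at reflect_axis_axis rb)
    moreover have "bad q u' \<longleftrightarrow> bad q u" for q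
    proof -
      have s: "subspace {u. bad q u}" unfolding bad_def by (rule subspace_rot_sum_axis_span)
      show ?thesis using subspace_scale[OF s, of u r] subspace_scale[OF s, of u' "inverse r"] r
        by (auto simp: u'_def)
    qed
    ultimately have "emeasure N {q. bad q u} = emeasure N (rot_at i (b - u') -` {q. bad q b})"
      by (simp add: vimage_def)
    also have "\<dots> = emeasure (distr N borel (rot_at i (b - u'))) {q. bad q b}"
      by (subst emeasure_distr) auto
    finally show ?thesis by (simp add: rot_inv)
  qed
  have "\<Lambda> \<noteq> {0}" using b by (auto simp: \<Lambda>_def)
  then have "\<not> \<Lambda> \<subseteq> {0}" using subspace_0[OF L] by auto
  from AE_std_gaussian_not_in[OF L subspace_single_0 this] AE_std_gaussian[OF L]
  have AEL: "AE u in std_gaussian \<Lambda>. u \<in> \<Lambda> \<and> u \<noteq> 0" by auto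
  have "emeasure N {q. bad q b} = (\<integral>\<^sup>+u. emeasure N {q. bad q b} \<partial>std_gaussian \<Lambda>)"
    using G.emeasure_space_1 by simp
  also have "\<dots> = (\<integral>\<^sup>+u. emeasure N {q. bad q u} \<partial>std_gaussian \<Lambda>)"
  proof (intro nn_integral_cong_AE, use AEL in eventually_elim)
    case (elim u)
    then show ?case using const[of u] by simp
  qed
  also have "\<dots> = (\<integral>\<^sup>+u. \<integral>\<^sup>+q. indicator {p. bad (fst p) (snd p)} (q, u) \<partial>N \<partial>std_gaussian \<Lambda>)"
  proof (rule nn_integral_cong)
    fix u
    have "(\<integral>\<^sup>+q. indicator {p. bad (fst p) (snd p)} (q, u) \<partial>N) = (\<integral>\<^sup>+q. indicator {q. bad q u} q \<partial>N)"
      by (intro nn_integral_cong) (simp add: indicator_def)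
    then show "emeasure N {q. bad q u} = (\<integral>\<^sup>+q. indicator {p. bad (fst p) (snd p)} (q, u) \<partial>N)" by simp
  qed
  also have "\<dots> = (\<integral>\<^sup>+q. \<integral>\<^sup>+u. indicator {p. bad (fst p) (snd p)} (q, u) \<partial>std_gaussian \<Lambda> \<partial>N)"
  proof (rule Fubini')
    have "(indicator {p. bad (fst p) (snd p)} :: _ \<Rightarrow> ennreal) \<in> borel_measurable (borel \<Otimes>\<^sub>M borel)"
      using Bad by (simp add: borel_prod)
    then show "(\<lambda>(q, u). indicator {p. bad (fst p) (snd p)} (q, u) :: ennreal) \<in> borel_measurable (N \<Otimes>\<^sub>M std_gaussian \<Lambda>)"
      unfolding case_prod_eta
        measurable_cong_sets[OF sets_pair_measure_cong[OF sets_N sets_std_gaussian[of \<Lambda>]] HOL.refl] .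
  qed
  also have "\<dots> = (\<integral>\<^sup>+q. 0 \<partial>N)"
  proof (intro nn_integral_cong_AE, use AE_orth in eventually_elim)
    case (elim q)
    let ?Y = "{u. bad q u}"
    have Y: "subspace ?Y" unfolding bad_def by (rule subspace_rot_sum_axis_span)
    have "\<not> \<Lambda> \<subseteq> ?Y"
    proof
      assume LY: "\<Lambda> \<subseteq> ?Y"
      \<comment> \<open>\<open>?Y\<close> contains \<open>\<Lambda>\<close> and also the \<open>i\<close>-th blocks of the vectors of \<open>J\<close>, whose orthogonal complement is \<open>\<Lambda>\<close>\<close>
      have "?Y\<^sup>\<bottom> \<subseteq> {0}"
      proof
        fix w assume w: "w \<in> ?Y\<^sup>\<bottom>"
        have "w \<in> \<Lambda>"
          unfolding \<Lambda>_def
        proof clarify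
          fix y assume y: "y \<in> J"
          then obtain l c where lc: "y = axis l c" using J(3) by blast
          show "y \<bullet> axis i w = 0"
          proof (cases "l = i")
            case True
            then have "bad q c" using y lc unfolding bad_def by (auto intro: span_base)
            then show ?thesis using w True lc by (auto simp: orthogonal_comp_def orthogonal_def inner_axis_axis)
          qed (simp add: lc inner_axis_axis)
        qed
        then have "w \<bullet> w = 0" using LY w by (auto simp: orthogonal_comp_def orthogonal_def)
        then show "w \<in> {0}" by simp
      qed
      then have "?Y\<^sup>\<bottom> = {0}" using subspace_0[OF subspace_orthogonal_comp] by blast
      then have "?Y = UNIV" using orthogonal_comp_self[OF Y] by simp
      then have all: "rot_sum T q (axis i u) \<in> span (rot_sum T q ` J)" for u
        by (auto simp: bad_def)
      have "UNIV \<subseteq> span (rot_sum T q ` J)"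
      proof
        fix w :: "real^'d"
        obtain u where "T i *v (q $ i *v u) = w" using surj_block elim by blast
        then show "w \<in> span (rot_sum T q ` J)" using all[of u] by (simp add: rot_sum_axis)
      qed
      then have "dim (UNIV :: (real^'d) set) \<le> card (rot_sum T q ` J)"
        using J(1) by (intro dim_le_card) auto
      also have "\<dots> \<le> card J" using J(1) by (rule card_image_le)
      finally show False using J(2) by simp
    qed
    then have AEu: "AE u in std_gaussian \<Lambda>. u \<notin> ?Y" by (rule AE_std_gaussian_not_in[OF L Y])
    have "(\<integral>\<^sup>+u. indicator {p. bad (fst p) (snd p)} (q, u) \<partial>std_gaussian \<Lambda>) = (\<integral>\<^sup>+u. 0 \<partial>std_gaussian \<Lambda>)"
      using AEu by (intro nn_integral_cong_AE) (auto simp: indicator_def elim!: eventually_mono)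
    then show ?case by simp
  qed
  finally have "emeasure N {q. bad q b} = 0" by simp
  then have "AE q in N. \<not> bad q b" by (subst AE_iff_measurable[of "{q. bad q b}"]) auto
  then show ?thesis by (simp add: bad_def)
qed

lemma generic_independent:
  fixes J :: "(real^'d^'n) set"
  assumes "finite J" "\<And>y. y \<in> J \<Longrightarrow> \<exists>i b. y = axis i b" "pairwise orthogonal J" "0 \<notin> J" "card J \<le> CARD('d)"
  shows "AE q in N. dim (rot_sum T q ` J) = card J"
  using assms
proof (induction J rule: finite_induct)
  case empty
  then show ?case by simp
next
  case (insert x J)
  then obtain i b where x: "x = axis i b" by blast
  have IH: "AE q in N. dim (rot_sum T q ` J) = card J"
    using insert by (intro insert.IH) (auto simp: pairwise_insert)
  have "AE q in N. rot_sum T q (axis i b) \<notin> span (rot_sum T q ` J)"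
  proof (rule generic_independent_step)
    show "b \<noteq> 0" using insert.prems(3) x axis_eq_0_iff[of i b] by auto
    show "y \<bullet> axis i b = 0" if "y \<in> J" for y
      using insert.prems(2) insert.hyps(2) that x by (auto simp: pairwise_insert orthogonal_def)
  qed (use insert in auto)
  then show ?case using IH
    by eventually_elim (use insert x in \<open>simp add: dim_insert\<close>)
qed

text \<open>
A basis of the product subspace made of vectors supported on one block is sent to vectors of which
as many as possible, namely \<open>d\<close> or all of them, are almost surely independent.
\<close>

lemma generic_dim:
  fixes L :: "'n \<Rightarrow> (real^'d) set"
  assumes L: "\<And>i. subspace (L i)"
  shows "AE q in N. dim (rot_sum T q ` {x. \<forall>i. x $ i \<in> L i}) = min CARD('d) (dim {x. \<forall>i. x $ i \<in> L i})"
proof -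
  let ?L = "{x. \<forall>i. x $ i \<in> L i}"
  obtain B where B: "\<And>i. orthonormal_basis_of (B i) (L i)"
    using ex_orthonormal_basis_of[OF L] by metis
  define J where "J = (\<Union>i. axis i ` B i)"
  have J: "finite J" "\<And>y. y \<in> J \<Longrightarrow> \<exists>i b. y = axis i b" "0 \<notin> J" "pairwise orthogonal J"
  proof -
    show "finite J" unfolding J_def using onb_finite[OF B] by simp
    show "\<And>y. y \<in> J \<Longrightarrow> \<exists>i b. y = axis i b" by (auto simp: J_def)
    have "b \<noteq> 0" if "b \<in> B i" for b i using B[of i] that by (auto simp: orthonormal_basis_of_def)
    then show "0 \<notin> J" by (auto simp: J_def)
    show "pairwise orthogonal J"
      using B by (auto simp: pairwise_def J_def orthogonal_def inner_axis_axis orthonormal_basis_of_def)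
        metis
  qed
  have "axis i b $ l \<in> L l" if "b \<in> B i" for i b l
    using onb_in[OF B that] subspace_0[OF L] by (simp add: axis_def)
  then have JL: "J \<subseteq> ?L" by (auto simp: J_def)
  have sL: "subspace ?L" using L by (auto simp: subspace_def)
  have "?L \<subseteq> span J"
  proof
    fix x assume x: "x \<in> ?L"
    have "axis i (x $ i) \<in> span J" for i
    proof -
      have "x $ i \<in> span (B i)" using x B[of i] by (simp add: orthonormal_basis_of_def)
      then have "axis i (x $ i) \<in> span (axis i ` B i)" by (simp add: linear_span_image[OF linear_axis])
      moreover have "span (axis i ` B i) \<subseteq> span J" by (intro span_mono) (auto simp: J_def)
      ultimately show ?thesis by blast
    qed
    then have "(\<Sum>i\<in>UNIV. axis i (x $ i)) \<in> span J" by (intro span_sum)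
    then show "x \<in> span J" by (simp add: sum_axis)
  qed
  then have span: "span J = ?L" using JL sL by (simp add: span_minimal subset_antisym)
  have "independent J" using J by (intro pairwise_orthogonal_independent)
  then have dimL: "dim ?L = card J" using span by (metis dim_eq_card_independent dim_span)
  obtain J' where J': "J' \<subseteq> J" "card J' = min CARD('d) (card J)" "finite J'"
    using obtain_subset_with_card_n[of "min CARD('d) (card J)" J] by auto
  have "AE q in N. dim (rot_sum T q ` J') = card J'"
    using J J' by (intro generic_independent) (auto intro: pairwise_subset)
  then show ?thesis
  proof eventually_elim
    case (elim q)
    have "card J' \<le> dim (rot_sum T q ` ?L)"
      unfolding elim[symmetric] using J' JL by (intro dim_subset) auto
    moreover have "dim (rot_sum T q ` ?L) \<le> dim ?L" by (rule dim_image_le[OF linear_rot_sum])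
    moreover have "dim (rot_sum T q ` ?L) \<le> CARD('d)"
      using dim_subset_UNIV[of "rot_sum T q ` ?L"] by simp
    ultimately show ?case using J'(2) dimL by simp
  qed
qed

end

section \<open>Measurability of the intrinsic volumes of a random sum\<close>

lemma closed_rot_sum_normals:
  "closed {p :: (real^'d^'d^'n) \<times> (real^'d). snd p \<in> normals (rot_sum T (fst p)) P H}"
  unfolding normals_def mem_Collect_eq
  by (intro closed_Collect_conj closed_Collect_Ball closed_Collect_le closed_Collect_eq continuous_intros)

text \<open>
This form describes exposedness by the existence of a point in the intersection of a closed set
and finitely many open sets, as \<open>borel_projection\<close> requires.
\<close>

lemma exposed_iff:
  assumes "linear A" "cone_face H P" "H \<subseteq> P"
  shows "exposed A P H \<longleftrightarrow> (\<exists>z. z \<in> normals A P H \<and> (\<forall>H'\<in>{H'. cone_face H' P \<and> H \<subset> H'}. z \<notin> normals A P H'))"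
proof
  assume "exposed A P H"
  then obtain z where z: "\<forall>p\<in>P. A p \<bullet> z \<le> 0" "{p\<in>P. A p \<bullet> z = 0} = H" unfolding exposed_def by blast
  show "\<exists>z. z \<in> normals A P H \<and> (\<forall>H'\<in>{H'. cone_face H' P \<and> H \<subset> H'}. z \<notin> normals A P H')"
  proof (intro exI conjI ballI)
    show "z \<in> normals A P H" using z by (auto simp: normals_def)
    fix H' assume H': "H' \<in> {H'. cone_face H' P \<and> H \<subset> H'}"
    then have "H' \<subseteq> P" by (auto simp: cone_face_def)
    then show "z \<notin> normals A P H'" using H' z by (auto simp: normals_def)
  qed
next
  assume "\<exists>z. z \<in> normals A P H \<and> (\<forall>H'\<in>{H'. cone_face H' P \<and> H \<subset> H'}. z \<notin> normals A P H')"
  then obtain z where z: "z \<in> normals A P H" "\<And>H'. cone_face H' P \<Longrightarrow> H \<subset> H' \<Longrightarrow> z \<notin> normals A P H'"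
    by blast
  let ?H = "{p\<in>P. A p \<bullet> z = 0}"
  have ex: "exposed A P ?H" using z(1) by (auto simp: exposed_def normals_def)
  have "H \<subseteq> ?H" using z(1) assms(3) by (auto simp: normals_def)
  moreover have "z \<in> normals A P ?H" using z(1) by (auto simp: normals_def)
  ultimately have "H = ?H" using z(2)[OF exposed_imp_cone_face[OF assms(1) ex]] by blast
  then show "exposed A P H" using ex by simp
qed

lemma exposed_rot_sum_measurable:
  fixes T :: "'n::finite \<Rightarrow> real^'d^'d"
  assumes P: "polyhedral_cone P" and H: "cone_face H P"
  shows "{q. exposed (rot_sum T q) P H} \<in> sets borel"
proof -
  let ?F = "{H'. cone_face H' P \<and> H \<subset> H'}"
  let ?N = "\<lambda>H. {p. snd p \<in> normals (rot_sum T (fst p)) P H}"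
  have "finite ?F" using finite_cone_faces[OF P] by simp
  then have "open (\<Inter>H'\<in>?F. - ?N H')"
    by (intro open_INT ballI open_Compl closed_rot_sum_normals)
  from borel_projection[OF closed_rot_sum_normals this]
  have "{q. \<exists>z. (q, z) \<in> ?N H \<inter> (\<Inter>H'\<in>?F. - ?N H')} \<in> sets borel" .
  also have "{q. \<exists>z. (q, z) \<in> ?N H \<inter> (\<Inter>H'\<in>?F. - ?N H')} = {q. exposed (rot_sum T q) P H}"
    by (simp add: exposed_iff[OF linear_rot_sum H cone_face_closed_cone(4)[OF P H]])
  finally show ?thesis .
qed

lemma not_injective_measurable:
  fixes T :: "'n::finite \<Rightarrow> real^'d^'d"
  assumes "subspace W"
  shows "{q. \<exists>x. x \<in> W \<and> x \<noteq> 0 \<and> rot_sum T q x = 0} \<in> sets borel"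
proof -
  let ?Z = "{p :: (real^'d^'d^'n) \<times> (real^'d^'n). snd p \<in> W \<and> rot_sum T (fst p) (snd p) = 0}"
  have "closed {p :: (real^'d^'d^'n) \<times> (real^'d^'n). snd p \<in> W}"
    using closed_vimage_snd[OF closed_subspace[OF assms]] by (simp add: vimage_def)
  then have 1: "closed ?Z" by (intro closed_Collect_conj closed_Collect_eq continuous_intros)
  have 2: "open {p :: (real^'d^'d^'n) \<times> (real^'d^'n). snd p \<noteq> 0}"
    by (intro open_Collect_neq continuous_intros)
  have "{q. \<exists>x. (q, x) \<in> ?Z \<inter> {p. snd p \<noteq> 0}} \<in> sets borel"
    by (rule borel_projection[OF 1 2])
  also have "{q. \<exists>x. (q, x) \<in> ?Z \<inter> {p. snd p \<noteq> 0}} = {q. \<exists>x. x \<in> W \<and> x \<noteq> 0 \<and> rot_sum T q x = 0}"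
    by auto
  finally show ?thesis .
qed

lemma inj_on_subspace_iff:
  assumes "linear f" "subspace W"
  shows "inj_on f W \<longleftrightarrow> \<not> (\<exists>x. x \<in> W \<and> x \<noteq> 0 \<and> f x = 0)"
  using linear_inj_on_iff_eq_0[OF assms] by blast

text \<open>
Testing the rank on the subsets of a fixed basis expresses it by finitely many injectivity conditions.
\<close>

lemma dim_image_ge_iff:
  fixes A :: "'b::euclidean_space \<Rightarrow> 'a::euclidean_space"
  assumes A: "linear A" and B: "finite B" "independent B" "span B = span H"
  shows "m \<le> dim (A ` H) \<longleftrightarrow> (\<exists>B'\<in>{B'. B' \<subseteq> B \<and> card B' = m}. \<not> (\<exists>x. x \<in> span B' \<and> x \<noteq> 0 \<and> A x = 0))"
proof -
  have dH: "dim (A ` H) = dim (A ` B)"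
    using linear_span_image[OF A, of H] linear_span_image[OF A, of B] B(3) by (metis dim_span)
  show ?thesis
  proof
    assume m: "m \<le> dim (A ` H)"
    obtain C where C: "C \<subseteq> A ` B" "independent C" "A ` B \<subseteq> span C"
      using maximal_independent_subset by metis
    have "card C = dim (A ` B)" using C by (metis basis_card_eq_dim)
    then obtain C' where C': "C' \<subseteq> C" "card C' = m"
      using obtain_subset_with_card_n[of m C] m dH by auto
    then obtain B' where B': "B' \<subseteq> B" "inj_on A B'" "C' = A ` B'"
      using subset_image_inj[of C' A B] C(1) by auto
    have "independent (A ` B')" using C(2) C'(1) B'(3) independent_mono by metis
    then have "inj_on A (span B')" using linear_inj_on_span_independent_image[OF A _ B'(2)] by simp
    then have "\<not> (\<exists>x. x \<in> span B' \<and> x \<noteq> 0 \<and> A x = 0)" using inj_on_subspace_iff[OF A subspace_span] by blast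
    moreover have "card B' = m" using C'(2) B' card_image by metis
    ultimately show "\<exists>B'\<in>{B'. B' \<subseteq> B \<and> card B' = m}. \<not> (\<exists>x. x \<in> span B' \<and> x \<noteq> 0 \<and> A x = 0)"
      using B'(1) by blast
  next
    assume "\<exists>B'\<in>{B'. B' \<subseteq> B \<and> card B' = m}. \<not> (\<exists>x. x \<in> span B' \<and> x \<noteq> 0 \<and> A x = 0)"
    then obtain B' where B': "B' \<subseteq> B" "card B' = m" "inj_on A (span B')"
      using inj_on_subspace_iff[OF A subspace_span] by blast
    have "independent B'" using B(2) B'(1) by (rule independent_mono)
    then have "m = dim (A ` B')"
      using dim_image_eq[OF A B'(3)] B'(2) dim_eq_card_independent by metis
    also have "\<dots> \<le> dim (A ` B)" using B'(1) by (intro dim_subset) auto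
    finally show "m \<le> dim (A ` H)" by (simp add: dH)
  qed
qed

lemma dim_rot_sum_measurable:
  fixes T :: "'n::finite \<Rightarrow> real^'d^'d"
  shows "{q. dim (rot_sum T q ` H) = j} \<in> sets borel"
proof -
  obtain B where B: "B \<subseteq> H" "independent B" "H \<subseteq> span B"
    using maximal_independent_subset by metis
  then have sB: "span B = span H" by (metis span_mono span_span subset_antisym)
  have fB: "finite B" using B(2) by (rule independent_imp_finite)
  have ge: "{q. m \<le> dim (rot_sum T q ` H)} \<in> sets borel" for m
  proof -
    have "{q. m \<le> dim (rot_sum T q ` H)} =
      (\<Union>B'\<in>{B'. B' \<subseteq> B \<and> card B' = m}. - {q. \<exists>x. x \<in> span B' \<and> x \<noteq> 0 \<and> rot_sum T q x = 0})"
      unfolding dim_image_ge_iff[OF linear_rot_sum fB B(2) sB] by auto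
    moreover have "finite {B'. B' \<subseteq> B \<and> card B' = m}" using fB by simp
    ultimately show ?thesis
      using not_injective_measurable[OF subspace_span] by (auto intro!: sets.finite_UN borel_comp)
  qed
  have "{q. dim (rot_sum T q ` H) = j} = {q. j \<le> dim (rot_sum T q ` H)} - {q. Suc j \<le> dim (rot_sum T q ` H)}"
    by auto
  then show ?thesis using ge by simp
qed

lemma region_rot_sum_measurable:
  fixes T :: "'n::finite \<Rightarrow> real^'d^'d"
  assumes "closed H"
  shows "{p. snd p \<in> region (rot_sum T (fst p)) P H} \<in> sets borel"
proof -
  define Z where "Z = {p :: ((real^'d^'d^'n) \<times> (real^'d)) \<times> (real^'d^'n). snd p \<in> H \<and>
      snd (fst p) - rot_sum T (fst (fst p)) (snd p) \<in> normals (rot_sum T (fst (fst p))) P H}"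
  have "closed {p :: ((real^'d^'d^'n) \<times> (real^'d)) \<times> (real^'d^'n). snd p \<in> H}"
    using closed_vimage_snd[OF assms] by (simp add: vimage_def)
  then have "closed Z" unfolding Z_def normals_def mem_Collect_eq
    by (intro closed_Collect_conj closed_Collect_Ball closed_Collect_le closed_Collect_eq continuous_intros)
  from borel_projection[OF this open_UNIV]
  show ?thesis by (simp add: Z_def region_def Bex_def)
qed

lemma measure_region_measurable:
  fixes T :: "'n::finite \<Rightarrow> real^'d^'d"
  assumes "closed H"
  shows "(\<lambda>q. measure (std_gaussian UNIV) (region (rot_sum T q) P H)) \<in> borel_measurable borel"
proof -
  interpret G: prob_space "std_gaussian (UNIV :: (real^'d) set)"
    by (rule prob_space_std_gaussian[OF subspace_UNIV])
  have "{p. snd p \<in> region (rot_sum T (fst p)) P H} \<in> sets (borel \<Otimes>\<^sub>M std_gaussian UNIV)"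
    using region_rot_sum_measurable[OF assms, of T P]
    unfolding sets_pair_measure_cong[OF HOL.refl sets_std_gaussian] borel_prod .
  from G.measurable_emeasure_Pair[OF this]
  have "(\<lambda>q. emeasure (std_gaussian UNIV) (region (rot_sum T q) P H)) \<in> borel_measurable borel"
    by (simp add: vimage_def)
  then show ?thesis unfolding measure_def by measurable
qed

text \<open>
The index set no longer depends on \<open>q\<close>, so measurability and boundedness can be read off
the summands.
\<close>

lemma conic_intrinsic_volume_rot_sum_eq:
  fixes T :: "'n::finite \<Rightarrow> real^'d^'d"
  assumes P: "polyhedral_cone P"
  shows "conic_intrinsic_volume j (rot_sum T q ` P) =
    (\<Sum>H | cone_face H P. indicator {q. exposed (rot_sum T q) P H} q * indicator {q. dim (rot_sum T q ` H) = j} q *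
       measure (std_gaussian UNIV) (region (rot_sum T q) P H))"
  unfolding conic_intrinsic_volume_linear_image[OF linear_rot_sum P]
  using finite_cone_faces[OF P] exposed_imp_cone_face[OF linear_rot_sum]
  by (intro sum.mono_neutral_cong_left) (auto simp: indicator_def)

lemma conic_intrinsic_volume_rot_sum_measurable:
  fixes T :: "'n::finite \<Rightarrow> real^'d^'d"
  assumes P: "polyhedral_cone P"
  shows "(\<lambda>q. conic_intrinsic_volume j (rot_sum T q ` P)) \<in> borel_measurable borel"
  unfolding conic_intrinsic_volume_rot_sum_eq[OF P]
  using exposed_rot_sum_measurable[OF P] dim_rot_sum_measurable
    measure_region_measurable[OF cone_face_closed_cone(1)[OF P]]
  by (intro borel_measurable_sum borel_measurable_times borel_measurable_indicator) auto

lemma conic_intrinsic_volume_rot_sum_bounded: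
  fixes T :: "'n::finite \<Rightarrow> real^'d^'d"
  assumes P: "polyhedral_cone P"
  shows "norm (conic_intrinsic_volume j (rot_sum T q ` P)) \<le> real (card {H. cone_face H P})"
proof -
  interpret G: prob_space "std_gaussian (UNIV :: (real^'d) set)"
    by (rule prob_space_std_gaussian[OF subspace_UNIV])
  have "norm (conic_intrinsic_volume j (rot_sum T q ` P)) \<le> (\<Sum>H | cone_face H P. 1)"
    unfolding conic_intrinsic_volume_rot_sum_eq[OF P]
    by (rule sum_norm_le) (auto simp: indicator_def)
  then show ?thesis by simp
qed

section \<open>Faces and polars of product cones\<close>

lemma polyhedral_cone_product:
  fixes C :: "'n::finite \<Rightarrow> (real^'d) set"
  assumes "\<And>i. polyhedral_cone (C i)"
  shows "polyhedral_cone (cone_product C)"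
proof -
  have "\<forall>i. \<exists>A. finite A \<and> C i = {x. \<forall>a\<in>A. a \<bullet> x \<le> 0}"
    using assms unfolding polyhedral_cone_def by blast
  from choice[OF this] obtain A where A: "\<And>i. finite (A i)" "\<And>i. C i = {x. \<forall>a\<in>A i. a \<bullet> x \<le> 0}"
    by blast
  have "cone_product C = {x. \<forall>a\<in>(\<Union>i. axis i ` A i). a \<bullet> x \<le> 0}"
    by (auto simp: cone_product_def A(2) inner_axis')
  then show ?thesis unfolding polyhedral_cone_def
    using A(1) by (intro exI[of _ "\<Union>i. axis i ` A i"]) auto
qed

lemma axis_in_cone_product:
  assumes "\<And>i. polyhedral_cone (C i)" "x \<in> C i"
  shows "axis i x \<in> cone_product C"
  using polyhedral_cone_facts(3)[OF assms(1)] assms(2) by (simp add: cone_product_def axis_def)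

lemma cone_product_nonpos_iff:
  fixes C :: "'n::finite \<Rightarrow> (real^'d) set"
  assumes "\<And>i. polyhedral_cone (C i)"
  shows "(\<forall>p\<in>cone_product C. p \<bullet> z \<le> 0) \<longleftrightarrow> (\<forall>i. z $ i \<in> polar_cone (C i))"
proof
  assume z: "\<forall>p\<in>cone_product C. p \<bullet> z \<le> 0"
  show "\<forall>i. z $ i \<in> polar_cone (C i)"
    unfolding polar_cone_def using z axis_in_cone_product[of C, OF assms] by (fastforce simp: inner_axis')
next
  assume z: "\<forall>i. z $ i \<in> polar_cone (C i)"
  show "\<forall>p\<in>cone_product C. p \<bullet> z \<le> 0"
  proof
    fix p assume "p \<in> cone_product C"
    then show "p \<bullet> z \<le> 0" unfolding inner_vec_def[of p z]
      using z by (intro sum_nonpos) (simp add: polar_cone_def cone_product_def)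
  qed
qed

lemma span_face_of_cone_product:
  fixes C :: "'n::finite \<Rightarrow> (real^'d) set"
  assumes C: "\<And>i. polyhedral_cone (C i)" and H: "cone_face H (cone_product C)"
  obtains L where "\<And>i. subspace (L i)" "span H = {x. \<forall>i. x $ i \<in> L i}"
proof -
  obtain z where z: "\<forall>p\<in>cone_product C. p \<bullet> z \<le> 0" "H = {p\<in>cone_product C. p \<bullet> z = 0}"
    using H unfolding cone_face_def by blast
  have zi: "x \<bullet> z $ i \<le> 0" if "x \<in> C i" for x i
    using z(1) that unfolding cone_product_nonpos_iff[OF C] polar_cone_def by auto
  define F where "F i = {x \<in> C i. x \<bullet> z $ i = 0}" for i
  have F0: "0 \<in> F i" for i using polyhedral_cone_facts(3)[OF C] by (simp add: F_def)
  have HF: "H = {x. \<forall>i. x $ i \<in> F i}"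
  proof (intro set_eqI iffI)
    fix x assume "x \<in> H"
    then have x: "\<And>i. x $ i \<in> C i" "(\<Sum>i\<in>UNIV. - (x $ i \<bullet> z $ i)) = 0"
      unfolding z(2) by (auto simp: cone_product_def inner_vec_def sum_negf)
    have "(\<Sum>i\<in>UNIV. - (x $ i \<bullet> z $ i)) = 0 \<longleftrightarrow> (\<forall>i\<in>UNIV. - (x $ i \<bullet> z $ i) = 0)"
      using zi[OF x(1)] by (intro sum_nonneg_eq_0_iff) auto
    then show "x \<in> {x. \<forall>i. x $ i \<in> F i}" using x by (simp add: F_def)
  next
    fix x assume "x \<in> {x. \<forall>i. x $ i \<in> F i}"
    then show "x \<in> H" unfolding z(2) by (auto simp: F_def cone_product_def inner_vec_def)
  qed
  have "span H = {x. \<forall>i. x $ i \<in> span (F i)}"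
  proof
    have "subspace {x. \<forall>i. x $ i \<in> span (F i)}"
      by (auto simp: subspace_def span_add span_scale span_zero)
    then show "span H \<subseteq> {x. \<forall>i. x $ i \<in> span (F i)}"
      by (rule span_minimal[rotated]) (auto simp: HF span_base)
    show "{x. \<forall>i. x $ i \<in> span (F i)} \<subseteq> span H"
    proof
      fix x assume x: "x \<in> {x. \<forall>i. x $ i \<in> span (F i)}"
      have "axis i (x $ i) \<in> span H" for i
      proof -
        have "axis i ` F i \<subseteq> H" using F0 by (auto simp: HF axis_def)
        then have "axis i ` span (F i) \<subseteq> span H"
          unfolding linear_span_image[OF linear_axis, symmetric] by (rule span_mono)
        then show ?thesis using x by blast
      qed
      then have "(\<Sum>i\<in>UNIV. axis i (x $ i)) \<in> span H" by (intro span_sum)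
      then show "x \<in> span H" by (simp add: sum_axis)
    qed
  qed
  then show ?thesis using that[of "\<lambda>i. span (F i)"] by simp
qed

section \<open>The probability attached to a face\<close>

definition rot_sum_adj :: "('n::finite \<Rightarrow> real^'d^'d) \<Rightarrow> real^'d^'d^'n \<Rightarrow> real^'d \<Rightarrow> real^'d^'n" where
  "rot_sum_adj T q z = (\<chi> i. transpose (q $ i) *v (transpose (T i) *v z))"

lemma inner_matrix_transpose: "((A :: real^'d^'d) *v x) \<bullet> y = x \<bullet> (transpose A *v y)"
  using dot_lmul_matrix[of y A x] by (simp add: inner_commute)

lemma rot_sum_inner: "rot_sum T q x \<bullet> z = x \<bullet> rot_sum_adj T q z"
proof -
  have "rot_sum T q x \<bullet> z = (\<Sum>i\<in>UNIV. (T i *v (q $ i *v x $ i)) \<bullet> z)"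
    by (simp add: rot_sum_def inner_sum_left)
  also have "\<dots> = (\<Sum>i\<in>UNIV. x $ i \<bullet> (transpose (q $ i) *v (transpose (T i) *v z)))"
    by (simp only: inner_matrix_transpose)
  also have "\<dots> = x \<bullet> rot_sum_adj T q z"
    unfolding inner_vec_def[of x] rot_sum_adj_def by simp
  finally show ?thesis .
qed

lemma continuous_on_rot_sum_adj [continuous_intros]:
  assumes "continuous_on S f" "continuous_on S g"
  shows "continuous_on S (\<lambda>x. rot_sum_adj T (f x) (g x))"
  unfolding rot_sum_adj_def by (intro continuous_intros assms)

lemma rot_sum_adj_rot_at: "rot_sum_adj T (rot_at i v q) z = reflect (axis i v) (rot_sum_adj T q z)"
proof -
  have "x \<bullet> rot_sum_adj T (rot_at i v q) z = x \<bullet> reflect (axis i v) (rot_sum_adj T q z)" for x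
    using rot_sum_inner[of T "rot_at i v q" x z, symmetric]
    by (simp add: rot_sum_rot_at rot_sum_inner inner_reflect_commute)
  then show ?thesis by (metis vector_eq_ldot)
qed

text \<open>
The point \<open>x\<close> of \<open>L\<close> for which \<open>A\<^sub>q x\<close> is closest to \<open>y\<close>. The value 0 for a map that is not injective on
\<open>L\<close> is arbitrary, since such \<open>q\<close> form a null set for the subspaces considered.
\<close>

definition least_squares :: "('n::finite \<Rightarrow> real^'d^'d) \<Rightarrow> (real^'d^'n) set \<Rightarrow> real^'d^'d^'n \<Rightarrow> real^'d \<Rightarrow> real^'d^'n" where
  "least_squares T L q y = (if inj_on (rot_sum T q) L
     then THE x. x \<in> L \<and> (\<forall>l\<in>L. rot_sum T q l \<bullet> (y - rot_sum T q x) = 0) else 0)"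

lemma least_squares_ex1:
  assumes "subspace L" "inj_on (rot_sum T q) L"
  shows "\<exists>!x. x \<in> L \<and> (\<forall>l\<in>L. rot_sum T q l \<bullet> (y - rot_sum T q x) = 0)"
proof -
  let ?A = "rot_sum T q"
  have AL: "subspace (?A ` L)" by (rule linear_subspace_image[OF linear_rot_sum assms(1)])
  obtain x where x: "x \<in> L" "oproj (?A ` L) y = ?A x" using oproj_in[OF AL, of y] by auto
  show ?thesis
  proof (rule ex1I[of _ x])
    show "x \<in> L \<and> (\<forall>l\<in>L. ?A l \<bullet> (y - ?A x) = 0)"
      using x oproj_perp[OF AL, of _ y] by (auto simp: inner_commute)
    fix x' assume x': "x' \<in> L \<and> (\<forall>l\<in>L. ?A l \<bullet> (y - ?A x') = 0)"
    then have "oproj (?A ` L) y = ?A x'"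
      by (intro oproj_unique[OF AL]) (auto simp: inner_commute)
    then show "x' = x" using x x' assms(2) by (auto simp: inj_on_def)
  qed
qed

lemma least_squares_props:
  assumes "subspace L" "inj_on (rot_sum T q) L"
  shows "least_squares T L q y \<in> L" "\<And>l. l \<in> L \<Longrightarrow> rot_sum T q l \<bullet> (y - rot_sum T q (least_squares T L q y)) = 0"
  using theI'[OF least_squares_ex1[OF assms, of y]] assms(2) by (auto simp: least_squares_def)

lemma least_squares_unique:
  assumes "subspace L" "inj_on (rot_sum T q) L" "x \<in> L" "\<And>l. l \<in> L \<Longrightarrow> rot_sum T q l \<bullet> (y - rot_sum T q x) = 0"
  shows "least_squares T L q y = x"
  using least_squares_ex1[OF assms(1,2), of y] least_squares_props(1)[OF assms(1,2), of y] least_squares_props(2)[OF assms(1,2), of _ y] assms(3,4)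
  by blast

lemma inj_measurable:
  fixes T :: "'n::finite \<Rightarrow> real^'d^'d"
  assumes "subspace L"
  shows "{q. inj_on (rot_sum T q) L} \<in> sets borel"
proof -
  have "{q. inj_on (rot_sum T q) L} = - {q. \<exists>x. x \<in> L \<and> x \<noteq> 0 \<and> rot_sum T q x = 0}"
    using inj_on_subspace_iff[OF linear_rot_sum assms] by blast
  then show ?thesis using not_injective_measurable[OF assms, of T] by auto
qed

lemma least_squares_measurable:
  fixes T :: "'n::finite \<Rightarrow> real^'d^'d"
  assumes L: "subspace L"
  shows "(\<lambda>p. least_squares T L (fst p) (snd p)) \<in> borel_measurable borel"
proof (rule borel_measurableI)
  fix S :: "(real^'d^'n) set" assume S: "open S"
  define Z where "Z = {p :: ((real^'d^'d^'n) \<times> (real^'d)) \<times> (real^'d^'n). snd p \<in> L \<and>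
      (\<forall>l\<in>L. rot_sum T (fst (fst p)) l \<bullet> (snd (fst p) - rot_sum T (fst (fst p)) (snd p)) = 0)}"
  have "closed {p :: ((real^'d^'d^'n) \<times> (real^'d)) \<times> (real^'d^'n). snd p \<in> L}"
    using closed_vimage_snd[OF closed_subspace[OF L]] by (simp add: vimage_def)
  then have "closed Z" unfolding Z_def
    by (intro closed_Collect_conj closed_Collect_Ball closed_Collect_eq continuous_intros)
  moreover have "open {p :: ((real^'d^'d^'n) \<times> (real^'d)) \<times> (real^'d^'n). snd p \<in> S}"
    using open_vimage_snd[OF S] by (simp add: vimage_def)
  ultimately have E: "{p. \<exists>x. (p, x) \<in> Z \<inter> {p. snd p \<in> S}} \<in> sets borel"
    by (rule borel_projection)
  define I where "I = {p :: (real^'d^'d^'n) \<times> (real^'d). inj_on (rot_sum T (fst p)) L}"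
  have "(fst :: (real^'d^'d^'n) \<times> (real^'d) \<Rightarrow> _) \<in> borel_measurable borel"
    by (intro borel_measurable_continuous_onI continuous_intros)
  from measurable_sets[OF this inj_measurable[OF L, of T]]
  have I: "I \<in> sets borel" by (simp add: I_def vimage_def)
  have "(\<lambda>p. least_squares T L (fst p) (snd p)) -` S =
     ({p. \<exists>x. (p, x) \<in> Z \<inter> {p. snd p \<in> S}} \<inter> I) \<union> (if 0 \<in> S then - I else {})"
  proof (rule set_eqI)
    fix p
    show "p \<in> (\<lambda>p. least_squares T L (fst p) (snd p)) -` S \<longleftrightarrow>
      p \<in> ({p. \<exists>x. (p, x) \<in> Z \<inter> {p. snd p \<in> S}} \<inter> I) \<union> (if 0 \<in> S then - I else {})"
    proof (cases "p \<in> I")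
      case True
      then have inj: "inj_on (rot_sum T (fst p)) L" by (simp add: I_def)
      have "(p, x) \<in> Z \<longleftrightarrow> x = least_squares T L (fst p) (snd p)" for x
        using least_squares_props(1)[OF L inj, of "snd p"] least_squares_props(2)[OF L inj, of _ "snd p"] least_squares_unique[OF L inj, of x "snd p"] by (auto simp: Z_def)
      then show ?thesis using True by auto
    next
      case False
      then show ?thesis by (auto simp: I_def least_squares_def)
    qed
  qed
  then show "(\<lambda>p. least_squares T L (fst p) (snd p)) -` S \<inter> space borel \<in> sets borel"
    using E I by auto
qed

lemma region_iff_least_squares:
  assumes H: "cone_face H P" and inj: "inj_on (rot_sum T q) (span H)"
  shows "y \<in> region (rot_sum T q) P H \<longleftrightarrow> least_squares T (span H) q y \<in> P \<and>
     (\<forall>p\<in>P. p \<bullet> rot_sum_adj T q (y - rot_sum T q (least_squares T (span H) q y)) \<le> 0)"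
proof
  assume "y \<in> region (rot_sum T q) P H"
  then obtain x where x: "x \<in> H" "y - rot_sum T q x \<in> normals (rot_sum T q) P H"
    by (auto simp: region_def)
  have "rot_sum T q l \<bullet> (y - rot_sum T q x) = 0" if "l \<in> span H" for l
    unfolding rot_sum_inner using x(2)
    by (intro span_orthogonal[OF that]) (auto simp: normals_def rot_sum_inner[symmetric])
  then have "least_squares T (span H) q y = x"
    using x(1) by (intro least_squares_unique[OF subspace_span inj]) (auto intro: span_base)
  moreover have "x \<in> P" using x(1) cone_face_Int_span[OF H] by blast
  ultimately show "least_squares T (span H) q y \<in> P \<and>
     (\<forall>p\<in>P. p \<bullet> rot_sum_adj T q (y - rot_sum T q (least_squares T (span H) q y)) \<le> 0)"
    using x(2) by (auto simp: normals_def rot_sum_inner)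
next
  assume a: "least_squares T (span H) q y \<in> P \<and>
     (\<forall>p\<in>P. p \<bullet> rot_sum_adj T q (y - rot_sum T q (least_squares T (span H) q y)) \<le> 0)"
  then have "least_squares T (span H) q y \<in> H"
    using least_squares_props(1)[OF subspace_span inj, of y] cone_face_Int_span[OF H] by blast
  moreover have "y - rot_sum T q (least_squares T (span H) q y) \<in> normals (rot_sum T q) P H"
    using a least_squares_props(2)[OF subspace_span inj, of _ y] by (auto simp: normals_def rot_sum_inner[symmetric] span_base)
  ultimately show "y \<in> region (rot_sum T q) P H" by (auto simp: region_def)
qed

lemma least_squares_rot_at:
  assumes L: "subspace L" and R: "\<And>l. l \<in> L \<Longrightarrow> reflect (axis i v) l \<in> L" and inj: "inj_on (rot_sum T q) L"
  shows "least_squares T L (rot_at i v q) y = reflect (axis i v) (least_squares T L q y)"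
proof (rule least_squares_unique[OF L])
  have RL: "reflect (axis i v) ` L = L"
  proof
    show "L \<subseteq> reflect (axis i v) ` L"
    proof
      fix l assume "l \<in> L"
      then show "l \<in> reflect (axis i v) ` L" using R by (intro image_eqI[of _ _ "reflect (axis i v) l"]) auto
    qed
  qed (use R in auto)
  have injR: "inj_on (reflect (axis i v)) L"
    by (rule inj_on_inverseI[of _ "reflect (axis i v)"]) simp
  have "inj_on (rot_sum T q \<circ> reflect (axis i v)) L"
    using inj by (intro comp_inj_on injR) (simp add: RL)
  then show "inj_on (rot_sum T (rot_at i v q)) L"
    by (simp add: rot_sum_rot_at[abs_def] o_def)
  show "reflect (axis i v) (least_squares T L q y) \<in> L" using R least_squares_props(1)[OF L inj] by blast
  fix l assume "l \<in> L"
  then show "rot_sum T (rot_at i v q) l \<bullet> (y - rot_sum T (rot_at i v q) (reflect (axis i v) (least_squares T L q y))) = 0"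
    using least_squares_props(2)[OF L inj R] by (simp add: rot_sum_rot_at)
qed

lemma inj_on_span_of_dim_image:
  fixes A :: "'b::euclidean_space \<Rightarrow> 'a::euclidean_space"
  assumes A: "linear A" and d: "dim (A ` H) = dim H"
  shows "inj_on A (span H)"
proof -
  obtain B where B: "B \<subseteq> H" "independent B" "H \<subseteq> span B"
    using maximal_independent_subset by metis
  then have sB: "span B = span H" by (metis span_mono span_span subset_antisym)
  have fB: "finite B" using B(2) by (rule independent_imp_finite)
  have cB: "card B = dim H" using B by (metis basis_card_eq_dim)
  have "card B \<le> dim (A ` H)" using d cB by simp
  then obtain B' where B': "B' \<subseteq> B" "card B' = card B" "\<not> (\<exists>x. x \<in> span B' \<and> x \<noteq> 0 \<and> A x = 0)"
    unfolding dim_image_ge_iff[OF A fB B(2) sB] by blast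
  then have "B' = B" using fB by (simp add: card_subset_eq)
  then show ?thesis using B'(3) inj_on_subspace_iff[OF A subspace_span, of B] sB by simp
qed

lemma linear_least_squares:
  assumes L: "subspace L" and inj: "inj_on (rot_sum T q) L"
  shows "linear (least_squares T L q)"
proof (rule linearI)
  note A = linear_add[OF linear_rot_sum] linear_scale[OF linear_rot_sum]
  fix y y' c
  show "least_squares T L q (y + y') = least_squares T L q y + least_squares T L q y'"
  proof (rule least_squares_unique[OF L inj])
    fix l assume l: "l \<in> L"
    show "rot_sum T q l \<bullet> (y + y' - rot_sum T q (least_squares T L q y + least_squares T L q y')) = 0"
      using least_squares_props(2)[OF L inj l, of y] least_squares_props(2)[OF L inj l, of y']
      by (simp add: A inner_add_right inner_diff_right)
  qed (simp add: least_squares_props(1)[OF L inj] subspace_add[OF L])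
  show "least_squares T L q (c *\<^sub>R y) = c *\<^sub>R least_squares T L q y"
  proof (rule least_squares_unique[OF L inj])
    fix l assume l: "l \<in> L"
    show "rot_sum T q l \<bullet> (c *\<^sub>R y - rot_sum T q (c *\<^sub>R least_squares T L q y)) = 0"
      using least_squares_props(2)[OF L inj l, of y]
      by (simp add: A inner_diff_right)
  qed (simp add: least_squares_props(1)[OF L inj] subspace_scale[OF L])
qed

lemma linear_rot_sum_adj: "linear (rot_sum_adj T q)"
  by (rule linearI)
    (simp_all add: rot_sum_adj_def vec_eq_iff matrix_vector_right_distrib matrix_vector_mult_scaleR
      del: transpose_matrix_vector)

lemma polar_cone_closed_cone: "closed (polar_cone C)" "cone (polar_cone C)"
proof -
  show "closed (polar_cone C)" unfolding polar_cone_def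
    by (intro closed_Collect_Ball closed_Collect_le continuous_intros)
  show "cone (polar_cone C)" by (auto simp: cone_def polar_cone_def mult_nonneg_nonpos)
qed

context random_rotations
begin

text \<open>
The rotation lemma is applied to the pair of \<open>q\<close> and an independent Gaussian vector \<open>y\<close>. The
random vectors are, for each block \<open>i\<close>, the component \<open>x\<^sub>i \<in> L\<^sub>i\<close> of the least squares solution and the
component in \<open>L\<^sub>i\<^sup>\<bottom>\<close> of the residual, pulled back to the \<open>i\<close>-th space. The matrices \<open>T\<^sub>i\<close> and
the position of the subspaces influence only the lengths of these vectors and how they depend on each
other, not the directions; this is why the result does not depend on \<open>T\<close>.
\<close>

lemma expected_region:
  fixes C :: "'n \<Rightarrow> (real^'d) set"
  assumes C: "\<And>i. polyhedral_cone (C i)" and H: "cone_face H (cone_product C)"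
    and dimH: "dim H < CARD('d)"
    and L: "\<And>i. subspace (L i)" and spanH: "span H = {x. \<forall>i. x $ i \<in> L i}"
  shows "(\<integral>q. measure (std_gaussian UNIV) (region (rot_sum T q) (cone_product C) H) \<partial>N)
    = (\<Prod>(i, b)\<in>UNIV. measure (std_gaussian (if b then L i else (L i)\<^sup>\<bottom>)) (if b then C i else polar_cone (C i)))"
proof -
  let ?\<gamma> = "std_gaussian (UNIV :: (real^'d) set)"
  let ?P = "cone_product C"
  let ?S = "span H"
  interpret G: prob_space ?\<gamma> by (rule prob_space_std_gaussian[OF subspace_UNIV])
  interpret NG: pair_prob_space N ?\<gamma> ..
  let ?W = "N \<Otimes>\<^sub>M ?\<gamma>"
  have setsW [simp, measurable_cong]: "sets ?W = sets borel"
    using sets_pair_measure_cong[OF sets_N sets_std_gaussian[of UNIV]] unfolding borel_prod .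
  have spaceW [simp]: "space ?W = UNIV" by (simp add: space_pair_measure)
  define x where "x p = least_squares T ?S (fst p) (snd p)" for p
  define z where "z p = rot_sum_adj T (fst p) (snd p - rot_sum T (fst p) (x p))" for p
  define u where "u = (\<lambda>(i, b) p. if b then x p $ i else z p $ i)"
  define \<Lambda> where "\<Lambda> = (\<lambda>(i, b). if b then L i else (L i)\<^sup>\<bottom>)"
  define K where "K = (\<lambda>(i, b). if b then C i else polar_cone (C i))"
  have x_meas [measurable]: "x \<in> borel_measurable borel"
    unfolding x_def using least_squares_measurable[OF subspace_span] .
  have z_meas [measurable]: "z \<in> borel_measurable borel"
  proof -
    have "(\<lambda>t :: ((real^'d^'d^'n) \<times> (real^'d)) \<times> (real^'d^'n).
        rot_sum_adj T (fst (fst t)) (snd (fst t) - rot_sum T (fst (fst t)) (snd t))) \<in> borel_measurable borel"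
      by (intro borel_measurable_continuous_onI continuous_intros)
    from measurable_compose[OF borel_measurable_Pair[OF measurable_ident_sets[OF HOL.refl] x_meas] this]
    show ?thesis by (simp add: z_def[abs_def])
  qed
  have inj: "AE q in N. inj_on (rot_sum T q) ?S"
    using generic_dim[of L, OF L]
  proof eventually_elim
    case (elim q)
    then have "dim (rot_sum T q ` ?S) = dim H" using dimH unfolding spanH[symmetric] by simp
    then have "dim (rot_sum T q ` H) = dim H"
      unfolding linear_span_image[OF linear_rot_sum, symmetric] by simp
    then show ?case by (rule inj_on_span_of_dim_image[OF linear_rot_sum])
  qed
  have AEW: "AE p in ?W. Q (fst p)" if ae: "AE q in N. Q q" for Q
  proof -
    obtain Z where Z: "{q \<in> space N. \<not> Q q} \<subseteq> Z" "Z \<in> sets N" "emeasure N Z = 0"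
      by (rule AE_E[OF ae])
    have "emeasure ?W (Z \<times> UNIV) = 0" using Z by (subst G.emeasure_pair_measure_Times) auto
    moreover have "Z \<times> UNIV \<in> sets ?W" using Z(2) pair_measureI[of Z N UNIV ?\<gamma>] by simp
    ultimately show ?thesis using Z(1) by (intro AE_I[of _ _ "Z \<times> UNIV"]) auto
  qed
  have S: "subspace ?S" by (rule subspace_span)
  have axS: "axis i w \<in> ?S" if "w \<in> L i" for i w
    using that subspace_0[OF L] by (simp add: spanH axis_def)
  have xL: "x (q, y) $ i \<in> L i" if "inj_on (rot_sum T q) ?S" for q y i
    using least_squares_props(1)[OF S that, of y] spanH by (auto simp: x_def)
  have zS: "l \<bullet> z (q, y) = 0" if "inj_on (rot_sum T q) ?S" "l \<in> ?S" for q y l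
    using least_squares_props(2)[OF S that, of y] by (simp add: z_def x_def rot_sum_inner)
  have zL: "z (q, y) $ i \<in> (L i)\<^sup>\<bottom>" if "inj_on (rot_sum T q) ?S" for q y i
    using zS[OF that axS] by (auto simp: orthogonal_comp_def orthogonal_def inner_axis')
  have W: "prob_space ?W" by unfold_locales
  have u_meas: "u j \<in> borel_measurable ?W" for j
    by (cases j) (auto simp: u_def)
  have E: "measure ?W {p \<in> space ?W. \<forall>j\<in>UNIV. u j p \<in> K j} = (\<Prod>j\<in>UNIV. measure (std_gaussian (\<Lambda> j)) (K j))"
  proof (rule prob_space.prob_cones_of_rotation_invariant[OF W])
    fix j :: "'n \<times> bool"
    obtain i b where j: "j = (i, b)" by (cases j)
    show "subspace (\<Lambda> j)" using L by (simp add: \<Lambda>_def j subspace_orthogonal_comp)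
    show "u j \<in> borel_measurable ?W" by (rule u_meas)
    show "cone (K j)"
      using polyhedral_cone_facts(2)[OF C] by (simp add: K_def j polar_cone_closed_cone(2))
    have "closed (K j)"
      using polyhedral_cone_facts(1)[OF C] by (simp add: K_def j polar_cone_closed_cone(1))
    then show "K j \<in> sets borel" by simp
    show "AE p in ?W. u j p \<in> \<Lambda> j"
      using AEW[OF inj]
    proof eventually_elim
      case (elim p)
      then show ?case using xL[of "fst p" "snd p" i] zL[of "fst p" "snd p" i] by (simp add: u_def \<Lambda>_def j)
    qed
    show "AE p in ?W. u j p \<noteq> 0" if L0: "\<Lambda> j \<noteq> {0}"
    proof (rule NG.AE_pair_measure)
      show "{p \<in> space ?W. u j p \<noteq> 0} \<in> sets ?W" using u_meas[of j] by measurable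
      show "AE q in N. AE y in ?\<gamma>. u j (q, y) \<noteq> 0"
        using inj AE_orth
      proof eventually_elim
        case (elim q)
        have lx: "linear (\<lambda>y. x (q, y))" using linear_least_squares[OF S elim(1)] by (simp add: x_def)
        have lz: "linear (\<lambda>y. z (q, y))"
        proof -
          have "linear (\<lambda>y. y - rot_sum T q (x (q, y)))"
            using linear_compose_sub[OF linear_ident linear_compose[OF lx linear_rot_sum, of T q]]
            by (simp add: o_def)
          from linear_compose[OF this linear_rot_sum_adj[of T q]] show ?thesis by (simp add: z_def o_def)
        qed
        have lu: "linear (\<lambda>y. u j (q, y))"
          using lx lz by (cases b) (auto simp: u_def j linear_iff)
        have "\<exists>y. u j (q, y) \<noteq> 0"
        proof (cases b)
          case True
          then obtain w where w: "w \<in> L i" "w \<noteq> 0"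
            using L0 subspace_0[OF L[of i]] by (auto simp: \<Lambda>_def j)
          have "least_squares T ?S q (rot_sum T q (axis i w)) = axis i w"
            using axS[OF w(1)] by (intro least_squares_unique[OF S elim(1)]) auto
          then have "u j (q, rot_sum T q (axis i w)) = w"
            using True by (simp add: u_def j x_def)
          then show ?thesis using w by metis
        next
          case False
          \<comment> \<open>here the dimension bound is essential: it makes the residual nonzero for some \<open>y\<close>\<close>
          have "rot_sum T q ` ?S \<noteq> UNIV"
          proof
            assume "rot_sum T q ` ?S = UNIV"
            then have "dim (UNIV :: (real^'d) set) \<le> dim ?S"
              using dim_image_le[OF linear_rot_sum, of T q ?S] by simp
            then show False using dimH by simp
          qed
          then obtain y where "y \<notin> rot_sum T q ` ?S" by blast
          then have y: "y - rot_sum T q (x (q, y)) \<noteq> 0"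
            using least_squares_props(1)[OF S elim(1), of y] by (auto simp: x_def)
          have "z (q, y) $ i \<noteq> 0"
          proof
            assume z0: "z (q, y) $ i = 0"
            let ?r = "y - rot_sum T q (x (q, y))"
            obtain w where w: "T i *v (q $ i *v w) = ?r" using surj_block elim(2) by blast
            have "?r \<bullet> ?r = rot_sum T q (axis i w) \<bullet> ?r" by (simp add: rot_sum_axis w)
            also have "\<dots> = axis i w \<bullet> z (q, y)" by (simp add: rot_sum_inner z_def)
            also have "\<dots> = 0" using z0 by (simp add: inner_axis')
            finally show False using y by simp
          qed
          then show ?thesis using False by (auto simp: u_def j)
        qed
        then have "\<not> UNIV \<subseteq> {y. u j (q, y) = 0}" by auto
        from AE_std_gaussian_not_in[OF subspace_UNIV subspace_zero_set[OF lu] this]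
        show ?case by simp
      qed
    qed
    fix v assume v: "v \<in> \<Lambda> j"
    let ?R = "reflect (axis i v) :: real^'d^'n \<Rightarrow> _"
    let ?\<tau> = "\<lambda>(q, y). (rot_at i v q, y)"
    show "\<exists>\<tau>. \<tau> \<in> measurable ?W ?W \<and> distr ?W ?W \<tau> = ?W \<and>
        (AE p in ?W. u j (\<tau> p) = reflect v (u j p)) \<and> (\<forall>l\<in>UNIV - {j}. AE p in ?W. u l (\<tau> p) = u l p)"
    proof (intro exI conjI)
      have rN: "rot_at i v \<in> measurable N N" by simp
      show "?\<tau> \<in> measurable ?W ?W"
        using measurable_compose[OF measurable_fst rN, of ?\<gamma>]
        by (auto simp: case_prod_unfold intro!: measurable_Pair)
      have dN: "distr N N (rot_at i v) = N" using rot_inv[of i v] by (simp cong: distr_cong)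
      have "distr N N (rot_at i v) \<Otimes>\<^sub>M distr ?\<gamma> ?\<gamma> (\<lambda>y. y) = distr ?W ?W ?\<tau>"
        by (rule pair_measure_distr) (auto simp: rN distr_id intro: prob_space_imp_sigma_finite G.prob_space_axioms)
      then show "distr ?W ?W ?\<tau> = ?W" by (simp add: dN distr_id)
      have Rl: "?R l \<in> ?S" if "l \<in> ?S" for l
      proof (cases b)
        case True
        then have "axis i v \<in> ?S" using v axS by (simp add: \<Lambda>_def j)
        then show ?thesis using that by (intro reflect_in_subspace[OF S])
      next
        case False
        then have "l \<bullet> axis i v = 0"
          using v that by (auto simp: \<Lambda>_def j spanH inner_axis orthogonal_comp_def orthogonal_def)
        then show ?thesis using that by (simp add: reflect_perp)
      qed
      have xt: "x (rot_at i v q, y) = ?R (x (q, y))" if "inj_on (rot_sum T q) ?S" for q y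
        using least_squares_rot_at[OF S Rl that] by (simp add: x_def)
      have zt: "z (rot_at i v q, y) = ?R (z (q, y))" if "inj_on (rot_sum T q) ?S" for q y
        using xt[OF that] by (simp add: z_def rot_sum_adj_rot_at rot_sum_rot_at)
      \<comment> \<open>a reflection along \<open>v \<in> L\<^sub>i\<^sup>\<bottom>\<close> does not move the solution, and one along \<open>v \<in> L\<^sub>i\<close> does not move the pulled-back residual\<close>
      have xR: "?R (x (q, y)) = x (q, y)" if "inj_on (rot_sum T q) ?S" "\<not> b" for q y
        using xL[OF that(1), of y i] v that(2)
        by (intro reflect_perp) (auto simp: \<Lambda>_def j inner_axis orthogonal_comp_def orthogonal_def)
      have zR: "?R (z (q, y)) = z (q, y)" if "inj_on (rot_sum T q) ?S" "b" for q y
        using zS[OF that(1) axS[of v i]] v that(2)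
        by (intro reflect_perp) (auto simp: \<Lambda>_def j inner_commute)
      show "AE p in ?W. u j (?\<tau> p) = reflect v (u j p)"
        using AEW[OF inj]
      proof eventually_elim
        case (elim p)
        then show ?case using xt[of "fst p" "snd p"] zt[of "fst p" "snd p"]
          by (simp add: u_def j case_prod_unfold reflect_axis_nth)
      qed
      show "\<forall>l\<in>UNIV - {j}. AE p in ?W. u l (?\<tau> p) = u l p"
      proof
        fix l assume "l \<in> UNIV - {j}"
        then obtain l' b' where l: "l = (l', b')" "l' \<noteq> i \<or> b' \<noteq> b" by (cases l) (auto simp: j)
        show "AE p in ?W. u l (?\<tau> p) = u l p"
          using AEW[OF inj]
        proof eventually_elim
          case (elim p)
          have "?R (x p) $ l' = x p $ l'" if "b'"
            using l that xR[of "fst p" "snd p"] elim by (cases "l' = i") (auto simp: reflect_axis_nth)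
          moreover have "?R (z p) $ l' = z p $ l'" if "\<not> b'"
            using l that zR[of "fst p" "snd p"] elim by (cases "l' = i") (auto simp: reflect_axis_nth)
          ultimately show ?case using xt[of "fst p" "snd p"] zt[of "fst p" "snd p"] elim
            by (simp add: u_def l case_prod_unfold)
        qed
      qed
    qed
  qed simp
  let ?E = "{p \<in> space ?W. \<forall>j\<in>UNIV. u j p \<in> K j}"
  have KB: "K j \<in> sets borel" for j
    using polyhedral_cone_facts(1)[OF C] by (cases j) (auto simp: K_def polar_cone_closed_cone(1))
  have E_sets: "?E \<in> sets ?W"
  proof -
    have "{p \<in> space ?W. u j p \<in> K j} \<in> sets ?W" for j
      using u_meas[of j] KB[of j] by measurable
    then show ?thesis by (intro sets.sets_Collect_finite_All) auto
  qed
  have sect: "region (rot_sum T q) ?P H = Pair q -` ?E" if "inj_on (rot_sum T q) ?S" for q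
  proof (rule set_eqI)
    fix y
    have "y \<in> region (rot_sum T q) ?P H \<longleftrightarrow> x (q, y) \<in> ?P \<and> (\<forall>p\<in>?P. p \<bullet> z (q, y) \<le> 0)"
      using region_iff_least_squares[OF H that, of y] by (simp add: x_def z_def)
    also have "\<dots> \<longleftrightarrow> (\<forall>i. x (q, y) $ i \<in> C i) \<and> (\<forall>i. z (q, y) $ i \<in> polar_cone (C i))"
      unfolding cone_product_nonpos_iff[OF C] by (simp add: cone_product_def)
    also have "\<dots> \<longleftrightarrow> y \<in> Pair q -` ?E"
      by (auto simp: u_def K_def split_paired_All all_bool_eq)
    finally show "y \<in> region (rot_sum T q) ?P H \<longleftrightarrow> y \<in> Pair q -` ?E" .
  qed
  have "(\<integral>q. measure ?\<gamma> (region (rot_sum T q) ?P H) \<partial>N) = enn2real (\<integral>\<^sup>+q. ennreal (measure ?\<gamma> (region (rot_sum T q) ?P H)) \<partial>N)"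
  proof (rule integral_eq_nn_integral)
    show "(\<lambda>q. measure ?\<gamma> (region (rot_sum T q) ?P H)) \<in> borel_measurable N"
      using measure_region_measurable[OF cone_face_closed_cone(1)[OF polyhedral_cone_product[OF C] H], of T] by simp
  qed simp
  also have "(\<integral>\<^sup>+q. ennreal (measure ?\<gamma> (region (rot_sum T q) ?P H)) \<partial>N) = (\<integral>\<^sup>+q. emeasure ?\<gamma> (Pair q -` ?E) \<partial>N)"
  proof (intro nn_integral_cong_AE, use inj in eventually_elim)
    case (elim q)
    show ?case unfolding sect[OF elim] G.emeasure_eq_measure ..
  qed
  also have "\<dots> = emeasure ?W ?E" by (rule G.emeasure_pair_measure_alt[OF E_sets, symmetric])
  also have "enn2real (emeasure ?W ?E) = measure ?W ?E" by (simp add: measure_def)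
  also have "\<dots> = (\<Prod>(i, b)\<in>UNIV. measure (std_gaussian (if b then L i else (L i)\<^sup>\<bottom>)) (if b then C i else polar_cone (C i)))"
    unfolding E by (intro prod.cong) (auto simp: \<Lambda>_def K_def)
  finally show ?thesis .
qed

end

text \<open>
The same argument for a Gaussian vector of the product space, with its components in \<open>L\<^sub>i\<close> and \<open>L\<^sub>i\<^sup>\<bottom>\<close>.
\<close>

lemma measure_region_product:
  fixes C :: "'n::finite \<Rightarrow> (real^'d) set"
  assumes C: "\<And>i. polyhedral_cone (C i)" and H: "cone_face H (cone_product C)"
    and L: "\<And>i. subspace (L i)" and spanH: "span H = {x. \<forall>i. x $ i \<in> L i}"
  shows "measure (std_gaussian UNIV) (region (\<lambda>x. x) (cone_product C) H)
    = (\<Prod>(i, b)\<in>UNIV. measure (std_gaussian (if b then L i else (L i)\<^sup>\<bottom>)) (if b then C i else polar_cone (C i)))"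
proof -
  let ?\<gamma> = "std_gaussian (UNIV :: (real^'d^'n) set)"
  let ?P = "cone_product C"
  have G: "prob_space ?\<gamma>" by (rule prob_space_std_gaussian[OF subspace_UNIV])
  define u where "u = (\<lambda>(i, b) y :: real^'d^'n. if b then oproj (L i) (y $ i) else y $ i - oproj (L i) (y $ i))"
  define \<Lambda> where "\<Lambda> = (\<lambda>(i, b). if b then L i else (L i)\<^sup>\<bottom>)"
  define K where "K = (\<lambda>(i, b). if b then C i else polar_cone (C i))"
  have E: "measure ?\<gamma> {y \<in> space ?\<gamma>. \<forall>j\<in>UNIV. u j y \<in> K j} = (\<Prod>j\<in>UNIV. measure (std_gaussian (\<Lambda> j)) (K j))"
  proof (rule prob_space.prob_cones_of_rotation_invariant[OF G])
    fix j :: "'n \<times> bool"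
    obtain i b where j: "j = (i, b)" by (cases j)
    show "subspace (\<Lambda> j)" using L by (simp add: \<Lambda>_def j subspace_orthogonal_comp)
    have lin: "linear (u j)"
      unfolding u_def j
      by (cases b) (auto intro!: linearI simp: linear_add[OF linear_oproj] linear_scale[OF linear_oproj] scaleR_diff_right)
    have "u j \<in> borel_measurable borel"
      using linear_continuous_on[OF lin[unfolded linear_conv_bounded_linear]]
      by (rule borel_measurable_continuous_onI)
    then show "u j \<in> borel_measurable ?\<gamma>" by simp
    show "cone (K j)"
      using polyhedral_cone_facts(2)[OF C] by (simp add: K_def j polar_cone_closed_cone(2))
    have "closed (K j)"
      using polyhedral_cone_facts(1)[OF C] by (simp add: K_def j polar_cone_closed_cone(1))
    then show "K j \<in> sets borel" by simp
    have uL: "u j y \<in> \<Lambda> j" for y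
      using oproj_in[OF L] diff_oproj_in[OF L] by (simp add: u_def \<Lambda>_def j)
    then show "AE y in ?\<gamma>. u j y \<in> \<Lambda> j" by simp
    \<comment> \<open>a linear map that does not vanish identically vanishes only on a proper subspace\<close>
    show "AE y in ?\<gamma>. u j y \<noteq> 0" if L0: "\<Lambda> j \<noteq> {0}"
    proof -
      have "subspace (\<Lambda> j)" by fact
      then obtain w where w: "w \<in> \<Lambda> j" "w \<noteq> 0" using L0 subspace_0 by blast
      have "u j (axis i w) = w"
      proof (cases b)
        case True
        then show ?thesis using w oproj_self[OF L, of w i] by (simp add: u_def \<Lambda>_def j)
      next
        case False
        then have "oproj (L i) w = 0"
          using w by (intro oproj_unique[OF L])
            (auto simp: \<Lambda>_def j subspace_0[OF L] orthogonal_comp_def orthogonal_def inner_commute)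
        then show ?thesis using False by (simp add: u_def j)
      qed
      then have "axis i w \<notin> {y. u j y = 0}" using w by simp
      then have "\<not> UNIV \<subseteq> {y. u j y = 0}" by blast
      from AE_std_gaussian_not_in[OF subspace_UNIV subspace_zero_set[OF lin] this]
      show ?thesis by simp
    qed
    fix v assume v: "v \<in> \<Lambda> j"
    let ?R = "reflect (axis i v) :: real^'d^'n \<Rightarrow> _"
    show "\<exists>\<tau>. \<tau> \<in> measurable ?\<gamma> ?\<gamma> \<and> distr ?\<gamma> ?\<gamma> \<tau> = ?\<gamma> \<and>
        (AE y in ?\<gamma>. u j (\<tau> y) = reflect v (u j y)) \<and> (\<forall>l\<in>UNIV - {j}. AE y in ?\<gamma>. u l (\<tau> y) = u l y)"
    proof (intro exI conjI)
      show "?R \<in> measurable ?\<gamma> ?\<gamma>" by simp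
      show "distr ?\<gamma> ?\<gamma> ?R = ?\<gamma>"
        using std_gaussian_reflect[OF subspace_UNIV, of "axis i v"] by (simp cong: distr_cong)
      show "AE y in ?\<gamma>. u j (?R y) = reflect v (u j y)"
        using v oproj_reflect[OF L] diff_oproj_reflect_perp[OF L]
        by (cases b) (auto simp: u_def j \<Lambda>_def reflect_axis_nth)
      show "\<forall>l\<in>UNIV - {j}. AE y in ?\<gamma>. u l (?R y) = u l y"
      proof
        fix l assume "l \<in> UNIV - {j}"
        then obtain l' b' where l: "l = (l', b')" "l' \<noteq> i \<or> b' \<noteq> b" by (cases l) (auto simp: j)
        have "u l (?R y) = u l y" for y
          using v l oproj_reflect_perp[OF L] diff_oproj_reflect[OF L]
          by (cases b; cases b'; cases "l' = i") (auto simp: u_def j \<Lambda>_def reflect_axis_nth)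
        then show "AE y in ?\<gamma>. u l (?R y) = u l y" by simp
      qed
    qed
  qed simp
  have "region (\<lambda>x. x) ?P H = {y \<in> space ?\<gamma>. \<forall>j\<in>UNIV. u j y \<in> K j}"
  proof (rule set_eqI)
    fix y
    have "y \<in> region (\<lambda>x. x) ?P H \<longleftrightarrow> (\<forall>i. oproj (L i) (y $ i) \<in> C i \<and> y $ i - oproj (L i) (y $ i) \<in> polar_cone (C i))"
    proof
      assume "y \<in> region (\<lambda>x. x) ?P H"
      then obtain x where x: "x \<in> H" "\<forall>p\<in>?P. p \<bullet> (y - x) \<le> 0" "\<forall>h\<in>H. h \<bullet> (y - x) = 0"
        by (auto simp: region_def normals_def)
      have xP: "x \<in> ?P" "x \<in> span H" using x(1) cone_face_Int_span[OF H] by (auto intro: span_base)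
      have "oproj (L i) (y $ i) = x $ i" for i
      proof (rule oproj_unique[OF L])
        show "x $ i \<in> L i" using xP(2) by (simp add: spanH)
        fix l assume "l \<in> L i"
        then have "axis i l \<in> span H" using subspace_0[OF L] by (simp add: spanH axis_def)
        then have "axis i l \<bullet> (y - x) = 0" 
          by (rule span_orthogonal) (use x(3) in auto)
        then show "(y $ i - x $ i) \<bullet> l = 0" by (simp add: inner_axis' inner_commute)
      qed
      then show "\<forall>i. oproj (L i) (y $ i) \<in> C i \<and> y $ i - oproj (L i) (y $ i) \<in> polar_cone (C i)"
        using xP(1) x(2) unfolding cone_product_nonpos_iff[OF C] by (simp add: cone_product_def)
    next
      assume a: "\<forall>i. oproj (L i) (y $ i) \<in> C i \<and> y $ i - oproj (L i) (y $ i) \<in> polar_cone (C i)"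
      define x where "x = (\<chi> i. oproj (L i) (y $ i))"
      have "x \<in> ?P \<inter> span H" using a oproj_in[OF L] by (simp add: x_def cone_product_def spanH)
      then have "x \<in> H" using cone_face_Int_span[OF H] by simp
      moreover have "\<forall>p\<in>?P. p \<bullet> (y - x) \<le> 0"
        unfolding cone_product_nonpos_iff[OF C] using a by (simp add: x_def)
      moreover have "h \<bullet> (y - x) = 0" if "h \<in> H" for h
      proof -
        have "h $ i \<in> L i" for i using that span_base[of h H] by (simp add: spanH)
        then have "h $ i \<bullet> (y - x) $ i = 0" for i
          using oproj_perp[OF L, of "h $ i" i "y $ i"] by (simp add: x_def inner_commute)
        then show ?thesis unfolding inner_vec_def[of h] by simp
      qed
      ultimately show "y \<in> region (\<lambda>x. x) ?P H" by (auto simp: region_def normals_def)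
    qed
    also have "\<dots> \<longleftrightarrow> y \<in> {y \<in> space ?\<gamma>. \<forall>j\<in>UNIV. u j y \<in> K j}"
      by (auto simp: u_def K_def split_paired_All all_bool_eq)
    finally show "y \<in> region (\<lambda>x. x) ?P H \<longleftrightarrow> y \<in> {y \<in> space ?\<gamma>. \<forall>j\<in>UNIV. u j y \<in> K j}" .
  qed
  then have "measure ?\<gamma> (region (\<lambda>x. x) ?P H) = (\<Prod>j\<in>UNIV. measure (std_gaussian (\<Lambda> j)) (K j))"
    using E by simp
  also have "\<dots> = (\<Prod>(i, b)\<in>UNIV. measure (std_gaussian (if b then L i else (L i)\<^sup>\<bottom>)) (if b then C i else polar_cone (C i)))"
    by (intro prod.cong) (auto simp: \<Lambda>_def K_def)
  finally show ?thesis .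
qed

context random_rotations
begin

lemma expected_conic_intrinsic_volume:
  fixes C :: "'n \<Rightarrow> (real^'d) set"
  assumes C: "\<And>i. polyhedral_cone (C i)" and j: "j < CARD('d)"
  shows "integrable N (\<lambda>q. conic_intrinsic_volume j (rot_sum T q ` cone_product C))"
    and "(\<integral>q. conic_intrinsic_volume j (rot_sum T q ` cone_product C) \<partial>N) = conic_intrinsic_volume j (cone_product C)"
proof -
  let ?P = "cone_product C"
  have P: "polyhedral_cone ?P" by (rule polyhedral_cone_product[OF C])
  have meas: "(\<lambda>q. conic_intrinsic_volume j (rot_sum T q ` ?P)) \<in> borel_measurable N"
    using conic_intrinsic_volume_rot_sum_measurable[OF P, of j T] by simp
  show "integrable N (\<lambda>q. conic_intrinsic_volume j (rot_sum T q ` ?P))"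
    using meas conic_intrinsic_volume_rot_sum_bounded[OF P, of j T]
    by (intro integrable_const_bound[where B="real (card {H. cone_face H ?P})"]) auto
  let ?r = "\<lambda>q H. measure (std_gaussian UNIV) (region (rot_sum T q) ?P H)"
  let ?F = "{H. cone_face H ?P \<and> dim H = j}"
  have "AE q in N. \<forall>H\<in>{H. cone_face H ?P}. dim (rot_sum T q ` H) = min CARD('d) (dim H)"
  proof (rule AE_finite_allI[OF finite_cone_faces[OF P]])
    fix H assume "H \<in> {H. cone_face H ?P}"
    then have H: "cone_face H ?P" by simp
    obtain L where L: "\<And>i. subspace (L i)" "span H = {x. \<forall>i. x $ i \<in> L i}"
      by (rule span_face_of_cone_product[OF C H], rule that)
    show "AE q in N. dim (rot_sum T q ` H) = min CARD('d) (dim H)"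
      using generic_dim[of L, OF L(1)]
    proof eventually_elim
      case (elim q)
      then have "dim (rot_sum T q ` span H) = min CARD('d) (dim (span H))" unfolding L(2) .
      then show ?case unfolding linear_span_image[OF linear_rot_sum, symmetric] dim_span .
    qed
  qed
  then have "AE q in N. conic_intrinsic_volume j (rot_sum T q ` ?P) = (\<Sum>H\<in>?F. ?r q H)"
    by eventually_elim (rule conic_intrinsic_volume_generic_image[OF linear_rot_sum P], use j in auto)
  then have "(\<integral>q. conic_intrinsic_volume j (rot_sum T q ` ?P) \<partial>N) = (\<integral>q. (\<Sum>H\<in>?F. ?r q H) \<partial>N)"
    using meas measure_region_measurable[OF cone_face_closed_cone(1)[OF P], of _ T]
    by (intro integral_cong_AE borel_measurable_sum) auto
  also have "\<dots> = (\<Sum>H\<in>?F. \<integral>q. ?r q H \<partial>N)"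
  proof (rule Bochner_Integration.integral_sum)
    fix H assume "H \<in> ?F"
    then have "(\<lambda>q. ?r q H) \<in> borel_measurable N"
      using measure_region_measurable[OF cone_face_closed_cone(1)[OF P], of H T] by simp
    then show "integrable N (\<lambda>q. ?r q H)"
      using prob_space.prob_le_1[OF prob_space_std_gaussian[OF subspace_UNIV, where 'a = "real^'d"]]
      by (intro integrable_const_bound[where B=1]) auto
  qed
  also have "\<dots> = (\<Sum>H\<in>?F. measure (std_gaussian UNIV) (region (\<lambda>x. x) ?P H))"
  proof (rule sum.cong[OF HOL.refl])
    fix H assume "H \<in> ?F"
    then have H: "cone_face H ?P" and dimH: "dim H < CARD('d)" using j by auto
    obtain L where L: "\<And>i. subspace (L i)" "span H = {x. \<forall>i. x $ i \<in> L i}"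
      by (rule span_face_of_cone_product[OF C H], rule that)
    show "(\<integral>q. ?r q H \<partial>N) = measure (std_gaussian UNIV) (region (\<lambda>x. x) ?P H)"
      unfolding expected_region[OF C H dimH L] measure_region_product[OF C H L] ..
  qed
  also have "\<dots> = conic_intrinsic_volume j ?P"
    by (rule conic_intrinsic_volume_regions[OF P, symmetric])
  finally show "(\<integral>q. conic_intrinsic_volume j (rot_sum T q ` ?P) \<partial>N) = conic_intrinsic_volume j ?P" .
qed

end

section \<open>The expected intrinsic volume of the Minkowski sum\<close>

lemma sum_images_eq_rot_sum_image:
  fixes C :: "'n::finite \<Rightarrow> (real^'d) set"
  shows "(\<Sum>i\<in>UNIV. (\<lambda>x. T i *v (q $ i *v x)) ` C i) = rot_sum T q ` cone_product C"
proof -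
  have "(\<Sum>i\<in>UNIV. (\<lambda>x. T i *v (q $ i *v x)) ` C i)
    = {sum s UNIV | s. \<forall>i\<in>UNIV. s i \<in> (\<lambda>x. T i *v (q $ i *v x)) ` C i}"
    by (rule set_sum_alt) simp
  also have "\<dots> = rot_sum T q ` cone_product C"
  proof (intro equalityI subsetI)
    fix y assume "y \<in> {sum s UNIV | s. \<forall>i\<in>UNIV. s i \<in> (\<lambda>x. T i *v (q $ i *v x)) ` C i}"
    then obtain s where s: "y = sum s UNIV" "\<forall>i\<in>UNIV. s i \<in> (\<lambda>x. T i *v (q $ i *v x)) ` C i" by auto
    then have "\<forall>i. \<exists>x. x \<in> C i \<and> s i = T i *v (q $ i *v x)" by blast
    from choice[OF this] obtain x where x: "\<And>i. x i \<in> C i" "\<And>i. s i = T i *v (q $ i *v x i)" by blast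
    then have "y = rot_sum T q (\<chi> i. x i)" "(\<chi> i. x i) \<in> cone_product C"
      using s(1) by (simp_all add: rot_sum_def cone_product_def)
    then show "y \<in> rot_sum T q ` cone_product C" by blast
  next
    fix y assume "y \<in> rot_sum T q ` cone_product C"
    then obtain x where x: "y = rot_sum T q x" "\<And>i. x $ i \<in> C i" by (auto simp: cone_product_def)
    then show "y \<in> {sum s UNIV | s. \<forall>i\<in>UNIV. s i \<in> (\<lambda>x. T i *v (q $ i *v x)) ` C i}"
      unfolding rot_sum_def by blast
  qed
  finally show ?thesis .
qed

theorem corollary1p3:
  fixes C :: "'n::finite \<Rightarrow> (real^'d) set"
    and T :: "'n \<Rightarrow> real^'d^'d"
    and k :: nat
    and M :: "'w measure"
    and Q :: "'n \<Rightarrow> 'w \<Rightarrow> real^'d^'d"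
  assumes "\<And>i. polyhedral_cone (C i)"
    and "\<And>i. invertible (T i)"
    and "0 < k" and "k \<le> CARD('d)"
    and "prob_space M"
    and "prob_space.indep_vars M (\<lambda>_. orthogonal_group) Q UNIV"
    and "\<And>i. normalized_haar (distr M orthogonal_group (Q i))"
  shows "integrable M (\<lambda>\<omega>. conic_intrinsic_volume (CARD('d) - k)
             (\<Sum>i\<in>UNIV. (\<lambda>x. T i *v (Q i \<omega> *v x)) ` C i))
    \<and> prob_space.expectation M (\<lambda>\<omega>. conic_intrinsic_volume (CARD('d) - k)
             (\<Sum>i\<in>UNIV. (\<lambda>x. T i *v (Q i \<omega> *v x)) ` C i))
      = conic_intrinsic_volume (CARD('d) - k) (cone_product C)"
proof -
  define X where "X \<omega> = (\<chi> i. Q i \<omega>)" for \<omega>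
  define N where "N = distr M borel X"
  note law = joint_law_rot_at[OF assms(5-7), folded X_def, folded N_def]
  have X: "X \<in> borel_measurable M" using law(1) unfolding X_def .
  have O_closed: "closed {q :: real^'d^'d^'n. \<forall>i. orthogonal_matrix (q $ i)}"
    unfolding orthogonal_matrix_def
    by (intro closed_Collect_all closed_Collect_conj closed_Collect_eq continuous_intros)
  interpret random_rotations N T
  proof (intro random_rotations.intro random_rotations_axioms.intro)
    show "prob_space N" unfolding N_def by (rule prob_space.prob_space_distr[OF assms(5) X])
    have "{q :: real^'d^'d^'n. \<forall>i. orthogonal_matrix (q $ i)} \<in> sets borel" using O_closed by simp
    then show "AE q in N. \<forall>i. orthogonal_matrix (q $ i)"
      unfolding N_def by (subst AE_distr_iff) (auto simp: X X_def law(3))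
    show "distr N borel (rot_at i v) = N" for i v
      using law(2)[of i v] .
  qed (auto simp: N_def assms(2))
  let ?v = "\<lambda>q. conic_intrinsic_volume (CARD('d) - k) (rot_sum T q ` cone_product C)"
  have j: "CARD('d) - k < CARD('d)" using assms(3) by simp
  note exp = expected_conic_intrinsic_volume[OF assms(1) j]
  have meas: "?v \<in> borel_measurable borel"
    by (rule conic_intrinsic_volume_rot_sum_measurable[OF polyhedral_cone_product[OF assms(1)]])
  have eq: "(\<Sum>i\<in>UNIV. (\<lambda>x. T i *v (Q i \<omega> *v x)) ` C i) = rot_sum T (X \<omega>) ` cone_product C" for \<omega>
    using sum_images_eq_rot_sum_image[of T "X \<omega>" C] by (simp add: X_def)
  have "integrable M (\<lambda>\<omega>. ?v (X \<omega>))"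
    using integrable_distr[OF X, of ?v] exp(1) unfolding N_def by simp
  moreover have "(\<integral>\<omega>. ?v (X \<omega>) \<partial>M) = conic_intrinsic_volume (CARD('d) - k) (cone_product C)"
    using integral_distr[OF X meas] exp(2) unfolding N_def by simp
  ultimately show ?thesis unfolding eq by blast
qed

end
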